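(* Let $F=\mathbb{C}(\kappa,c_0,d_1,\dots,d_{r-1})$ and let $\lambda$ be an $r$-partition of $n$. For $(\mu,T)\in\mathbb{Z}_{\ge0}^n\times\mathrm{SYT}(\lambda)$ write $a_i=\mathrm{ct}(T(w_\mu(i)))$ and $b_i=\beta(T(w_\mu(i)))$. Then the norm of $f_{\mu,T}$ with respect to the contravariant form on $M(\lambda)$ is \begin{align*} \langle f_{\mu,T},f_{\mu,T}\rangle&=\prod_{i=1}^n\prod_{k=1}^{\mu_i}\big(\kappa k-(d_{b_i}-d_{b_i-k})-c_0ra_i\big)\\ &\times\prod_{\substack{1\le i<j\le n\\ \mu_i>\mu_j}}\ \prod_{\substack{1\le k\le\mu_i-\mu_j\\ k=b_i-b_j\ \mathrm{mod}\ r}}\frac{\big(\kappa k-(d_{b_i}-d_{b_j})-c_0r(a_i-a_j)\big)^2-(c_0r)^2}{\big(\kappa k-(d_{b_i}-d_{b_j})-c_0r(a_i-a_j)\big)^2}\\ &\times\prod_{\substack{1\le i<j\le n\\ \mu_i<\mu_j-1}}\ \prod_{\substack{1\le k\le\mu_j-\mu_i-1\\ k=b_j-b_i\ \mathrm{mod}\ r}}\frac{\big(\kappa k-(d_{b_j}-d_{b_i})-c_0r(a_j-a_i)\big)^2-(c_0r)^2}{\big(\kappa k-(d_{b_j}-d_{b_i})-c_0r(a_j-a_i)\big)^2}. \end{align*}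
   Context: **Group and tableaux.** Let $r,n\ge 1$, $\zeta=e^{2\pi i/r}$, and let $W=G(r,1,n)$ be the group of $n\times n$ monomial matrices whose nonzero entries are $r$th roots of $1$. $\zeta_i\in W$ is the diagonal matrix with $\zeta$ in position $i$ and $1$'s elsewhere; $s_{ij}$ is the transposition interchanging $i$ and $j$; $s_i=s_{i,i+1}$; $t_w$ is the group-algebra element of $w\in W$. An $r$-partition $\lambda=(\lambda^0,\dots,\lambda^{r-1})$ of $n$ is a sequence of $r$ (possibly empty) partitions with $n$ boxes in total. For a box $b$ of $\lambda^l$ in row $p$ and column $q$ put $\mathrm{ct}(b)=q-p$ and $\beta(b)=l$. A standard Young tableau on $\lambda$ is a bijection $T$ from $\{1,\dots,n\}$ to the boxes of $\lambda$ ($T(i)$ is the box containing $i$) such that within each $\lambda^l$ entries strictly increase left to right and top to bottom; $\mathrm{SYT}(\lambda)$ is the set of these. $s_i.T$ is obtained from $T$ by interchanging $i$ and $i+1$. $S^\lambda$ is the irreducible $\mathbb{C}W$-module with basis $v_T$, $T\in\mathrm{SYT}(\lambda)$, on which $t_{\zeta_i}v_T=\zeta^{\beta(T(i))}v_T$; $t_{s_i}v_T=v_{s_i.T}$ if $\beta(T(i))\ne\beta(T(i+1))$; and if $\beta(T(i))=\beta(T(i+1))$ then with $a=\mathrm{ct}(T(i+1))-\mathrm{ct}(T(i))$, $t_{s_i}v_T=\frac1a v_T+(1-\frac1{a^2})^{1/2}v_{s_i.T}$ (second term read as $0$ if $s_i.T$ is not standard). **Compositions.** $S_n$ acts on $\mathbb{Z}_{\ge0}^n$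 by $(w.\mu)_i=\mu_{w^{-1}(i)}$. $\mu^+$ (resp. $\mu^-$) is the non-increasing (resp. non-decreasing) rearrangement of $\mu$; $w_\mu$ is the longest $w\in S_n$ with $w.\mu=\mu^-$, i.e. $w_\mu(i)=|\{j<i:\mu_j<\mu_i\}|+|\{j\ge i:\mu_j\le\mu_i\}|$. $\epsilon_i$ is the $i$th standard basis vector. Define $\mu<\nu$ iff $\mu^+<_d\nu^+$, or $\mu^+=\nu^+$ and $w_\mu<w_\nu$ in Bruhat order on $S_n$; here $\mu>_d\nu$ (strict dominance) means $\mu\neq\nu$ and $\mu-\nu=\sum_{i=1}^{n-1}k_i(\epsilon_i-\epsilon_{i+1})$ with integers $k_i\ge 0$. Put $v_T^\mu=t_{w_\mu}^{-1}.v_T$. **Algebra.** Let $F=\mathbb{C}(\kappa,c_0,d_1,\dots,d_{r-1})$ be the field of rational functions in the parameters; define $d_i$ for all $i\in\mathbb{Z}$ by $d_0+\cdots+d_{r-1}=0$ and $d_i=d_j$ if $i=j$ mod $r$. Let $y_1,\dots,y_n$ be the standard basis of $\mathfrak{h}=\mathbb{C}^n$ and $x_1,\dots,x_n$ the dual basis of $\mathfrak{h}^*$. The rational Cherednik algebra $\mathbb{H}$ is the $F$-algebra generated by $F[x_1,\dots,x_n]$, $F[y_1,\dots,y_n]$ and $FW$ with relations $t_wx=(wx)t_w$, $t_wy=(wy)t_w$ ($w\in W,x\in\mathfrak{h}^*,y\in\mathfrak{h}$), $$y_ix_j=x_jy_i+c_0\sum_{l=0}^{r-1}\zeta^{-l}t_{\zeta_i^ls_{ij}\zeta_i^{-l}}\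 (i\ne j),$$ $$y_ix_i=x_iy_i+\kappa-\sum_{j=0}^{r-1}(d_j-d_{j-1})e_{ij}-c_0\sum_{j\ne i}\sum_{l=0}^{r-1}t_{\zeta_i^ls_{ij}\zeta_i^{-l}},$$ where $e_{ij}=\frac1r\sum_{l=0}^{r-1}\zeta^{-lj}t_{\zeta_i^l}$. Put $z_i=y_ix_i+c_0\phi_i$ with $\phi_i=\sum_{1\le j<i}\sum_{l=0}^{r-1}t_{\zeta_i^ls_{ij}\zeta_i^{-l}}$. $\mathfrak{t}\subseteq\mathbb{H}$ is the commutative subalgebra generated by $z_1,\dots,z_n,t_{\zeta_1},\dots,t_{\zeta_n}$. The standard module is $M(\lambda)=\mathrm{Ind}_{FW\otimes F[y_1,\dots,y_n]}^{\mathbb{H}}S^\lambda$ (scalars of $S^\lambda$ extended to $F$, each $y_i$ acting on $S^\lambda$ by $0$); as a vector space $M(\lambda)\simeq F[x_1,\dots,x_n]\otimes_FS^\lambda$, with basis the elements $x^\mu v_T^\mu$. For each $(\mu,T)$, $f_{\mu,T}\in M(\lambda)$ is the unique $\mathfrak{t}$-eigenvector equal to $x^\mu v_T^\mu$ plus an $F$-linear combination of elements $x^\nu v_S^\nu$ with $\nu<\mu$. **Contravariant form.** Extend complex conjugation to the automorphism of $F$ fixing $\kappa,c_0$ and all $d_j$; Hermitian forms are with respect to this automorphism. Let $\langle\cdot,\cdot\rangle_0$ be the positive definite $W$-invariant Hermitian form on $S^\lambda$ with $\langle v_T,v_T\rangle_0=1$ for all $T\in\mathrm{SYT}(\lambda)$.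 For $x=\sum k_ix_i\in\mathfrak{h}^*$, $y=\sum l_iy_i\in\mathfrak{h}$ put $x^*=\sum\overline{k_i}y_i$, $y^*=\sum\overline{l_i}x_i$. The contravariant form $\langle\cdot,\cdot\rangle$ on $M(\lambda)$ is the unique Hermitian form extending $\langle\cdot,\cdot\rangle_0$ on $S^\lambda\subseteq M(\lambda)$ with $\langle t_w.f,t_w.g\rangle=\langle f,g\rangle$, $\langle x.f,g\rangle=\langle f,x^*.g\rangle$, $\langle y.f,g\rangle=\langle f,y^*.g\rangle$ for $f,g\in M(\lambda)$, $w\in W$, $x\in\mathfrak{h}^*$, $y\in\mathfrak{h}$. *)

theory Defs
  imports
    Complex_Main
    "HOL-Library.Poly_Mapping"
    "HOL-Library.Cardinality"
    "HOL-Library.FuncSet"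
    "HOL-Computational_Algebra.Fraction_Field"
    "HOL-Number_Theory.Cong"
    "HOL-Combinatorics.Transposition"
    "HOL-Algebra.Ideal"
    "Jordan_Normal_Form.Matrix"
begin

section \<open>The field of parameters\<close>

text \<open>
  The number \<open>r\<close> is \<open>CARD('r)\<close> for a finite type \<open>'r\<close>, so that the field
  \<open>F = \<complex>(\<kappa>, c\<^sub>0, d\<^sub>1, \<dots>, d\<^sub>r\<^sub>-\<^sub>1)\<close> is a type.  Its \<open>r + 1\<close> variables are indexed by
  \<open>{0..r}\<close>: index 0 is \<open>\<kappa>\<close>, index 1 is \<open>c\<^sub>0\<close>, index \<open>j + 1\<close> is \<open>d\<^sub>j\<close> for \<open>1 \<le> j < r\<close>.
\<close>

typedef 'r param = "{0..CARD('r)}" by auto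

setup_lifting type_definition_param

instantiation param :: (type) linorder
begin
lift_definition less_eq_param :: "'a param \<Rightarrow> 'a param \<Rightarrow> bool" is "(\<le>)" .
lift_definition less_param :: "'a param \<Rightarrow> 'a param \<Rightarrow> bool" is "(<)" .
instance by standard (transfer; auto)+
end

type_synonym 'r param_poly = "('r param \<Rightarrow>\<^sub>0 nat) \<Rightarrow>\<^sub>0 complex"
type_synonym 'r ratfun = "'r param_poly fract"

definition param_var :: "nat \<Rightarrow> 'r ratfun" where
  "param_var k = Fraction_Field.Fract (Poly_Mapping.single (Poly_Mapping.single (Abs_param k) 1) 1) 1"

definition cconst :: "complex \<Rightarrow> 'r ratfun" where
  "cconst c = Fraction_Field.Fract (Poly_Mapping.single 0 c) 1"

definition kappa :: "'r ratfun" where "kappa = param_var 0"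
definition c0 :: "'r ratfun" where "c0 = param_var 1"

definition d :: "int \<Rightarrow> 'r ratfun" where
  "d i = (let j = nat (i mod int CARD('r)) in
     if j = 0 then - (\<Sum>k = 1..<CARD('r). param_var (k + 1)) else param_var (j + 1))"

definition cnj_poly :: "'r param_poly \<Rightarrow> 'r param_poly" where
  "cnj_poly p = Poly_Mapping.map cnj p"

lemma lookup_cnj_poly: "Poly_Mapping.lookup (cnj_poly p) k = cnj (Poly_Mapping.lookup p k)"
  unfolding cnj_poly_def by transfer (auto simp: when_def)

lemma cnj_Sum_any: "cnj (Sum_any g) = Sum_any (\<lambda>x. cnj (g x))"
  by (simp add: Sum_any.expand_set)

lemma cnj_poly_mult: "cnj_poly (p * q) = cnj_poly p * cnj_poly q"
  by (rule poly_mapping_eqI)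
    (simp add: lookup_cnj_poly lookup_mult cnj_Sum_any when_def if_distrib[of cnj] cong: if_cong)

lemma cnj_poly_eq_0_iff: "cnj_poly p = 0 \<longleftrightarrow> p = 0"
  by (simp add: poly_mapping_eq_iff fun_eq_iff lookup_cnj_poly)

text \<open>Complex conjugation extended to \<open>F\<close>, fixing the parameters.\<close>

lift_definition cnj_ratfun :: "'r ratfun \<Rightarrow> 'r ratfun"
  is "\<lambda>q. (cnj_poly (fst q), cnj_poly (snd q))"
  by (simp add: fractrel_def cnj_poly_eq_0_iff flip: cnj_poly_mult)

lemma cnj_ratfun_Fract: "b \<noteq> 0 \<Longrightarrow> cnj_ratfun (Fraction_Field.Fract a b) = Fraction_Field.Fract (cnj_poly a) (cnj_poly b)"
  by transfer (auto simp: fractrel_def cnj_poly_eq_0_iff)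


section \<open>The group \<open>G(r,1,n)\<close>\<close>

text \<open>
  Indices run over \<open>{1..n}\<close>; position \<open>(i, j)\<close> of a matrix is the
  library entry \<open>(i - 1, j - 1)\<close>.
\<close>

definition entry :: "complex mat \<Rightarrow> nat \<Rightarrow> nat \<Rightarrow> complex" where
  "entry A i j = A $$ (i - 1, j - 1)"

definition mat_of :: "nat \<Rightarrow> (nat \<Rightarrow> nat \<Rightarrow> complex) \<Rightarrow> complex mat" where
  "mat_of n g = mat n n (\<lambda>(i, j). g (i + 1) (j + 1))"

definition zeta :: "nat \<Rightarrow> complex" where
  "zeta r = exp (2 * of_real pi * \<i> / of_nat r)"

definition monomial_group :: "nat \<Rightarrow> nat \<Rightarrow> complex mat set" where
  "monomial_group r n = {A \<in> carrier_mat n n.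
     (\<forall>i\<in>{1..n}. \<exists>!j. j \<in> {1..n} \<and> entry A i j \<noteq> 0) \<and>
     (\<forall>j\<in>{1..n}. \<exists>!i. i \<in> {1..n} \<and> entry A i j \<noteq> 0) \<and>
     (\<forall>i\<in>{1..n}. \<forall>j\<in>{1..n}. entry A i j \<noteq> 0 \<longrightarrow> entry A i j ^ r = 1)}"

definition zeta_mat :: "nat \<Rightarrow> nat \<Rightarrow> nat \<Rightarrow> int \<Rightarrow> complex mat" where
  \<comment> \<open>the power \<open>\<zeta>\<^sub>i\<^sup>l\<close>\<close>
  "zeta_mat r n i l = mat_of n (\<lambda>p q. if p = q then (if p = i then zeta r powi l else 1) else 0)"

definition perm_mat :: "nat \<Rightarrow> (nat \<Rightarrow> nat) \<Rightarrow> complex mat" where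
  "perm_mat n w = mat_of n (\<lambda>p q. if p = w q then 1 else 0)"

definition refl_mat :: "nat \<Rightarrow> nat \<Rightarrow> nat \<Rightarrow> nat \<Rightarrow> nat \<Rightarrow> complex mat" where
  \<comment> \<open>\<open>\<zeta>\<^sub>i\<^sup>l s\<^sub>i\<^sub>j \<zeta>\<^sub>i\<^sup>-\<^sup>l\<close>\<close>
  "refl_mat r n i j l =
     zeta_mat r n i (int l) * perm_mat n (Transposition.transpose i j) * zeta_mat r n i (- int l)"


section \<open>Multipartitions and standard tableaux\<close>

definition is_partition :: "nat list \<Rightarrow> bool" where
  "is_partition p \<longleftrightarrow> sorted_wrt (\<ge>) p \<and> 0 \<notin> set p"

definition is_multipartition :: "nat \<Rightarrow> nat \<Rightarrow> nat list list \<Rightarrow> bool" where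
  "is_multipartition r n lam \<longleftrightarrow>
     length lam = r \<and> (\<forall>p\<in>set lam. is_partition p) \<and> (\<Sum>p\<leftarrow>lam. sum_list p) = n"

text \<open>A box \<open>(l, p, q)\<close> lies in component \<open>l\<close>, row \<open>p\<close>, column \<open>q\<close>, with rows and columns
  counted from 0 (contents do not depend on this).\<close>

type_synonym box = "nat \<times> nat \<times> nat"
type_synonym tableau = "nat \<Rightarrow> box"

definition boxes :: "nat list list \<Rightarrow> box set" where
  "boxes lam = {(l, p, q). l < length lam \<and> p < length (lam ! l) \<and> q < lam ! l ! p}"

fun beta :: "box \<Rightarrow> nat" where "beta (l, p, q) = l"
fun row :: "box \<Rightarrow> nat" where "row (l, p, q) = p"
fun column :: "box \<Rightarrow> nat" where "column (l, p, q) = q"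

definition ct :: "box \<Rightarrow> int" where
  "ct b = int (column b) - int (row b)"

definition SYT :: "nat \<Rightarrow> nat list list \<Rightarrow> tableau set" where
  "SYT n lam = {T \<in> extensional {1..n}. bij_betw T {1..n} (boxes lam) \<and>
     (\<forall>i\<in>{1..n}. \<forall>j\<in>{1..n}. beta (T i) = beta (T j) \<and>
        (row (T i) = row (T j) \<and> column (T i) < column (T j) \<or>
         column (T i) = column (T j) \<and> row (T i) < row (T j)) \<longrightarrow> i < j)}"

definition swap_entries :: "nat \<Rightarrow> tableau \<Rightarrow> tableau" where
  "swap_entries i T = T \<circ> Transposition.transpose i (i + 1)"


section \<open>The Specht module and its invariant form\<close>

text \<open>
  \<open>S\<^sup>\<lambda>\<close> has basis \<open>v\<^sub>T\<close> (\<open>Poly_Mapping.single T 1\<close>).  The \<open>\<zeta>\<^sub>i\<close> and the \<open>s\<^sub>i\<close> generate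
  the group, and its action is given through them.
\<close>

type_synonym specht = "tableau \<Rightarrow>\<^sub>0 complex"

definition Specht :: "nat \<Rightarrow> nat list list \<Rightarrow> specht set" where
  "Specht n lam = {u. Poly_Mapping.keys u \<subseteq> SYT n lam}"

definition smul :: "complex \<Rightarrow> specht \<Rightarrow> specht" where
  "smul c u = Poly_Mapping.map ((*) c) u"

definition zeta_vec :: "nat \<Rightarrow> nat \<Rightarrow> tableau \<Rightarrow> specht" where
  \<comment> \<open>\<open>t\<^bsub>\<zeta>\<^sub>i\<^esub> v\<^sub>T\<close>\<close>
  "zeta_vec r i T = Poly_Mapping.single T (zeta r ^ beta (T i))"

definition s_vec :: "nat \<Rightarrow> nat list list \<Rightarrow> nat \<Rightarrow> tableau \<Rightarrow> specht" where
  \<comment> \<open>\<open>t\<^bsub>s\<^sub>i\<^esub> v\<^sub>T\<close>\<close>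
  "s_vec n lam i T =
     (if beta (T i) \<noteq> beta (T (i + 1)) then Poly_Mapping.single (swap_entries i T) 1
      else let a = ct (T (i + 1)) - ct (T i) in
        Poly_Mapping.single T (1 / of_int a) +
        (if swap_entries i T \<in> SYT n lam
         then Poly_Mapping.single (swap_entries i T) (of_real (sqrt (1 - 1 / (of_int a)\<^sup>2)))
         else 0))"

definition lin_ext :: "(tableau \<Rightarrow> specht) \<Rightarrow> specht \<Rightarrow> specht" where
  "lin_ext g u = (\<Sum>T\<in>Poly_Mapping.keys u. smul (Poly_Mapping.lookup u T) (g T))"

definition is_specht_form ::
    "nat \<Rightarrow> nat \<Rightarrow> nat list list \<Rightarrow> (specht \<Rightarrow> specht \<Rightarrow> complex) \<Rightarrow> bool" where
  "is_specht_form r n lam B0 \<longleftrightarrow>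
     (\<forall>u\<in>Specht n lam. \<forall>v\<in>Specht n lam. \<forall>w\<in>Specht n lam. B0 (u + v) w = B0 u w + B0 v w) \<and>
     (\<forall>c. \<forall>u\<in>Specht n lam. \<forall>v\<in>Specht n lam. B0 (smul c u) v = c * B0 u v) \<and>
     (\<forall>u\<in>Specht n lam. \<forall>v\<in>Specht n lam. B0 v u = cnj (B0 u v)) \<and>
     (\<forall>u\<in>Specht n lam. u \<noteq> 0 \<longrightarrow> Re (B0 u u) > 0) \<and>
     (\<forall>i\<in>{1..n}. \<forall>u\<in>Specht n lam. \<forall>v\<in>Specht n lam.
        B0 (lin_ext (zeta_vec r i) u) (lin_ext (zeta_vec r i) v) = B0 u v) \<and>
     (\<forall>i\<in>{1..<n}. \<forall>u\<in>Specht n lam. \<forall>v\<in>Specht n lam.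
        B0 (lin_ext (s_vec n lam i) u) (lin_ext (s_vec n lam i) v) = B0 u v) \<and>
     (\<forall>T\<in>SYT n lam. B0 (Poly_Mapping.single T 1) (Poly_Mapping.single T 1) = 1)"


section \<open>Compositions and their order\<close>

definition compositions :: "nat \<Rightarrow> (nat \<Rightarrow> nat) set" where
  "compositions n = {mu. \<forall>i. i \<notin> {1..n} \<longrightarrow> mu i = 0}"

definition nonincr :: "nat \<Rightarrow> (nat \<Rightarrow> nat) \<Rightarrow> nat \<Rightarrow> nat" where
  \<comment> \<open>\<open>\<mu>\<^sup>+\<close>\<close>
  "nonincr n mu i = (if i \<in> {1..n} then rev (sort (map mu [1..<n+1])) ! (i - 1) else 0)"

definition w_comp :: "nat \<Rightarrow> (nat \<Rightarrow> nat) \<Rightarrow> nat \<Rightarrow> nat" where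
  \<comment> \<open>\<open>w\<^sub>\<mu>\<close>, extended by the identity outside \<open>{1..n}\<close>\<close>
  "w_comp n mu i =
     (if i \<in> {1..n} then card {j \<in> {1..<i}. mu j < mu i} + card {j \<in> {i..n}. mu j \<le> mu i} else i)"

definition dom_less :: "nat \<Rightarrow> (nat \<Rightarrow> nat) \<Rightarrow> (nat \<Rightarrow> nat) \<Rightarrow> bool" where
  "dom_less n nu mu \<longleftrightarrow> nu \<noteq> mu \<and> (\<exists>k :: nat \<Rightarrow> int. (\<forall>i. k i \<ge> 0) \<and>
     (\<forall>p\<in>{1..n}. int (mu p) - int (nu p) =
        (\<Sum>i = 1..<n. k i * ((if p = i then 1 else 0) - (if p = i + 1 then 1 else 0)))))"

definition perm_length :: "nat \<Rightarrow> (nat \<Rightarrow> nat) \<Rightarrow> nat" where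
  "perm_length n w = card {(i, j). 1 \<le> i \<and> i < j \<and> j \<le> n \<and> w i > w j}"

definition bruhat_less :: "nat \<Rightarrow> (nat \<Rightarrow> nat) \<Rightarrow> (nat \<Rightarrow> nat) \<Rightarrow> bool" where
  "bruhat_less n = (\<lambda>u v. \<exists>i\<in>{1..n}. \<exists>j\<in>{1..n}.
     v = u \<circ> Transposition.transpose i j \<and> perm_length n u < perm_length n v)\<^sup>+\<^sup>+"

definition comp_less :: "nat \<Rightarrow> (nat \<Rightarrow> nat) \<Rightarrow> (nat \<Rightarrow> nat) \<Rightarrow> bool" where
  "comp_less n mu nu \<longleftrightarrow> dom_less n (nonincr n mu) (nonincr n nu) \<or>
     nonincr n mu = nonincr n nu \<and> bruhat_less n (w_comp n mu) (w_comp n nu)"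


section \<open>The rational Cherednik algebra\<close>

text \<open>
  The algebra is the quotient of the free \<open>F\<close>-algebra on letters \<open>x\<^sub>i\<close>, \<open>y\<^sub>i\<close>
  (\<open>1 \<le> i \<le> n\<close>) and \<open>t\<^sub>w\<close> (\<open>w\<close> in the group) by the two-sided ideal of the defining relations.
  The free algebra is the monoid algebra of the monoid of words, with the convolution
  product of \<^typ>\<open>'a \<Rightarrow>\<^sub>0 'b\<close>; monoids are written additively there.
\<close>

datatype 'g word = Word (letters: "'g list")

instantiation word :: (type) monoid_add
begin
definition zero_word :: "'a word" where "zero_word = Word []"
definition plus_word :: "'a word \<Rightarrow> 'a word \<Rightarrow> 'a word" where
  "plus_word u v = Word (letters u @ letters v)"
instance by standard (simp_all add: zero_word_def plus_word_def)
end

datatype gen = Xgen nat | Ygen nat | Tgen "complex mat"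

type_synonym 'r free_alg = "gen word \<Rightarrow>\<^sub>0 'r ratfun"

definition gens :: "nat \<Rightarrow> nat \<Rightarrow> gen set" where
  "gens r n = Xgen ` {1..n} \<union> Ygen ` {1..n} \<union> Tgen ` monomial_group r n"

definition free_carrier :: "nat \<Rightarrow> 'r free_alg set" where
  "free_carrier n = {a. \<forall>u\<in>Poly_Mapping.keys a. set (letters u) \<subseteq> gens CARD('r) n}"

definition free_ring :: "nat \<Rightarrow> 'r free_alg ring" where
  "free_ring n = \<lparr>carrier = free_carrier n, mult = (*), one = 1, zero = 0, add = (+)\<rparr>"

definition scal :: "'r ratfun \<Rightarrow> 'r free_alg" where "scal c = Poly_Mapping.single 0 c"
definition x_el :: "nat \<Rightarrow> 'r free_alg" where "x_el i = Poly_Mapping.single (Word [Xgen i]) 1"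
definition y_el :: "nat \<Rightarrow> 'r free_alg" where "y_el i = Poly_Mapping.single (Word [Ygen i]) 1"
definition t_el :: "complex mat \<Rightarrow> 'r free_alg" where "t_el w = Poly_Mapping.single (Word [Tgen w]) 1"

definition e_el :: "nat \<Rightarrow> nat \<Rightarrow> nat \<Rightarrow> 'r free_alg" where
  "e_el n i j = scal (1 / of_nat CARD('r)) *
     (\<Sum>l<CARD('r). scal (cconst (zeta CARD('r) powi (- int (l * j)))) *
        t_el (zeta_mat CARD('r) n i (int l)))"

text \<open>
  In \<open>t_x\<close> below, \<open>v = w\<^sup>-\<^sup>1\<close>: on the dual basis \<open>w x\<^sub>j = \<Sum>\<^sub>i (w\<^sup>-\<^sup>1)\<^sub>j\<^sub>i x\<^sub>i\<close>.
\<close>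

inductive_set cherednik_relations :: "nat \<Rightarrow> 'r free_alg set" for n :: nat where
  t_one: "t_el (1\<^sub>m n) - 1 \<in> cherednik_relations n"
| t_mult: "w \<in> monomial_group CARD('r) n \<Longrightarrow> v \<in> monomial_group CARD('r) n \<Longrightarrow>
    t_el w * t_el v - t_el (w * v) \<in> cherednik_relations n"
| x_x: "i \<in> {1..n} \<Longrightarrow> j \<in> {1..n} \<Longrightarrow> x_el i * x_el j - x_el j * x_el i \<in> cherednik_relations n"
| y_y: "i \<in> {1..n} \<Longrightarrow> j \<in> {1..n} \<Longrightarrow> y_el i * y_el j - y_el j * y_el i \<in> cherednik_relations n"
| t_x: "w \<in> monomial_group CARD('r) n \<Longrightarrow> v \<in> monomial_group CARD('r) n \<Longrightarrow> w * v = 1\<^sub>m n \<Longrightarrow>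
    j \<in> {1..n} \<Longrightarrow>
    t_el w * x_el j - (\<Sum>i = 1..n. scal (cconst (entry v j i)) * x_el i) * t_el w
      \<in> cherednik_relations n"
| t_y: "w \<in> monomial_group CARD('r) n \<Longrightarrow> j \<in> {1..n} \<Longrightarrow>
    t_el w * y_el j - (\<Sum>i = 1..n. scal (cconst (entry w i j)) * y_el i) * t_el w
      \<in> cherednik_relations n"
| y_x_distinct: "i \<in> {1..n} \<Longrightarrow> j \<in> {1..n} \<Longrightarrow> i \<noteq> j \<Longrightarrow>
    y_el i * x_el j -
      (x_el j * y_el i + scal c0 * (\<Sum>l<CARD('r).
         scal (cconst (zeta CARD('r) powi (- int l))) * t_el (refl_mat CARD('r) n i j l)))
      \<in> cherednik_relations n"
| y_x_same: "i \<in> {1..n} \<Longrightarrow>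
    y_el i * x_el i -
      (x_el i * y_el i + scal kappa
        - (\<Sum>j<CARD('r). scal (d (int j) - d (int j - 1)) * e_el n i j)
        - scal c0 * (\<Sum>j\<in>{1..n} - {i}. \<Sum>l<CARD('r). t_el (refl_mat CARD('r) n i j l)))
      \<in> cherednik_relations n"

definition cherednik_ideal :: "nat \<Rightarrow> 'r free_alg set" where
  "cherednik_ideal n = genideal (free_ring n) (cherednik_relations n)"

definition phi_el :: "nat \<Rightarrow> nat \<Rightarrow> 'r free_alg" where
  "phi_el n i = (\<Sum>j = 1..<i. \<Sum>l<CARD('r). t_el (refl_mat CARD('r) n i j l))"

definition z_el :: "nat \<Rightarrow> nat \<Rightarrow> 'r free_alg" where
  "z_el n i = y_el i * x_el i + scal c0 * phi_el n i"

text \<open>Representatives in the free algebra of the elements of the subalgebra \<open>\<tt>\<close>.\<close>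

inductive_set t_subalgebra :: "nat \<Rightarrow> 'r free_alg set" for n :: nat where
  "scal c \<in> t_subalgebra n"
| "i \<in> {1..n} \<Longrightarrow> z_el n i \<in> t_subalgebra n"
| "i \<in> {1..n} \<Longrightarrow> t_el (zeta_mat CARD('r) n i 1) \<in> t_subalgebra n"
| "a \<in> t_subalgebra n \<Longrightarrow> b \<in> t_subalgebra n \<Longrightarrow> a + b \<in> t_subalgebra n"
| "a \<in> t_subalgebra n \<Longrightarrow> b \<in> t_subalgebra n \<Longrightarrow> a * b \<in> t_subalgebra n"


section \<open>The standard module\<close>

text \<open>
  The induced module, i.e. the tensor product of the algebra with \<open>S\<^sup>\<lambda>\<close> over the subalgebra
  generated by the group and the \<open>y\<^sub>i\<close>, is the quotient of the free left
  module on symbols \<open>1 \<otimes> v\<^sub>T\<close> (\<open>Poly_Mapping.single T 1\<close>) over the free algebra by the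
  submodule generated by \<open>p \<otimes> v\<^sub>T\<close> for \<open>p\<close> in the ideal of relations and by
  \<open>b \<otimes> v\<^sub>T - 1 \<otimes> b v\<^sub>T\<close> for \<open>b\<close> among the generators \<open>t\<^bsub>\<zeta>\<^sub>i\<^esub>\<close>, \<open>t\<^bsub>s\<^sub>i\<^esub>\<close>, \<open>y\<^sub>i\<close> of
  that subalgebra.
\<close>

type_synonym 'r free_module = "tableau \<Rightarrow>\<^sub>0 'r free_alg"

definition module_carrier :: "nat \<Rightarrow> nat list list \<Rightarrow> 'r free_module set" where
  "module_carrier n lam =
     {u. Poly_Mapping.keys u \<subseteq> SYT n lam \<and> (\<forall>T. Poly_Mapping.lookup u T \<in> free_carrier n)}"

definition lmult :: "'r free_alg \<Rightarrow> 'r free_module \<Rightarrow> 'r free_module" where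
  "lmult a u = Poly_Mapping.map ((*) a) u"

definition one_tensor :: "specht \<Rightarrow> 'r free_module" where
  "one_tensor u = Poly_Mapping.map (\<lambda>c. scal (cconst c)) u"

inductive_set standard_relations :: "nat \<Rightarrow> nat list list \<Rightarrow> 'r free_module set"
  for n :: nat and lam :: "nat list list" where
  zero: "0 \<in> standard_relations n lam"
| ideal: "p \<in> cherednik_ideal n \<Longrightarrow> T \<in> SYT n lam \<Longrightarrow>
    Poly_Mapping.single T p \<in> standard_relations n lam"
| zeta: "i \<in> {1..n} \<Longrightarrow> T \<in> SYT n lam \<Longrightarrow>
    Poly_Mapping.single T (t_el (zeta_mat CARD('r) n i 1)) - one_tensor (zeta_vec CARD('r) i T)
      \<in> standard_relations n lam"
| s: "i \<in> {1..<n} \<Longrightarrow> T \<in> SYT n lam \<Longrightarrow>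
    Poly_Mapping.single T (t_el (perm_mat n (Transposition.transpose i (i + 1)))) -
      one_tensor (s_vec n lam i T) \<in> standard_relations n lam"
| y: "i \<in> {1..n} \<Longrightarrow> T \<in> SYT n lam \<Longrightarrow> Poly_Mapping.single T (y_el i) \<in> standard_relations n lam"
| add: "u \<in> standard_relations n lam \<Longrightarrow> v \<in> standard_relations n lam \<Longrightarrow>
    u + v \<in> standard_relations n lam"
| lmult: "a \<in> free_carrier n \<Longrightarrow> u \<in> standard_relations n lam \<Longrightarrow>
    lmult a u \<in> standard_relations n lam"

definition standard_eq :: "nat \<Rightarrow> nat list list \<Rightarrow> 'r free_module rel" where
  "standard_eq n lam = {(u, v). u \<in> module_carrier n lam \<and> v \<in> module_carrier n lam \<and>
     u - v \<in> standard_relations n lam}"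

definition standard_module :: "nat \<Rightarrow> nat list list \<Rightarrow> 'r free_module set set" where
  "standard_module n lam = module_carrier n lam // standard_eq n lam"

definition cls :: "nat \<Rightarrow> nat list list \<Rightarrow> 'r free_module \<Rightarrow> 'r free_module set" where
  "cls n lam u = standard_eq n lam `` {u}"

definition M_add ::
    "nat \<Rightarrow> nat list list \<Rightarrow> 'r free_module set \<Rightarrow> 'r free_module set \<Rightarrow> 'r free_module set" where
  "M_add n lam f g = (\<Union>u\<in>f. \<Union>v\<in>g. cls n lam (u + v))"

definition M_act ::
    "nat \<Rightarrow> nat list list \<Rightarrow> 'r free_alg \<Rightarrow> 'r free_module set \<Rightarrow> 'r free_module set" where
  "M_act n lam a f = (\<Union>u\<in>f. cls n lam (lmult a u))"

definition x_monomial :: "nat \<Rightarrow> (nat \<Rightarrow> nat) \<Rightarrow> 'r free_alg" where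
  "x_monomial n mu = (\<Prod>i\<leftarrow>[1..<n+1]. x_el i ^ mu i)"

definition xv :: "nat \<Rightarrow> (nat \<Rightarrow> nat) \<Rightarrow> tableau \<Rightarrow> 'r free_module" where
  \<comment> \<open>a representative of \<open>x\<^sup>\<mu> v\<^sub>T\<^sup>\<mu> = x\<^sup>\<mu> t\<^sub>w\<^sup>-\<^sup>1 v\<^sub>T\<close> with \<open>w = w\<^sub>\<mu>\<close>\<close>
  "xv n mu T =
     Poly_Mapping.single T (x_monomial n mu * t_el (perm_mat n (inv_into UNIV (w_comp n mu))))"

definition t_eigenvector :: "nat \<Rightarrow> nat list list \<Rightarrow> 'r free_module set \<Rightarrow> bool" where
  "t_eigenvector n lam f \<longleftrightarrow> f \<in> standard_module n lam \<and> f \<noteq> cls n lam 0 \<and>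
     (\<forall>a\<in>t_subalgebra n. \<exists>c. M_act n lam a f = M_act n lam (scal c) f)"

text \<open>The property that determines \<open>f\<^bsub>\<mu>,T\<^esub>\<close> uniquely.\<close>

definition is_f ::
    "nat \<Rightarrow> nat list list \<Rightarrow> (nat \<Rightarrow> nat) \<Rightarrow> tableau \<Rightarrow> 'r free_module set \<Rightarrow> bool" where
  "is_f n lam mu T f \<longleftrightarrow> t_eigenvector n lam f \<and>
     (\<exists>I c. finite I \<and> I \<subseteq> {nu \<in> compositions n. comp_less n nu mu} \<times> SYT n lam \<and>
        f = cls n lam (xv n mu T + (\<Sum>(nu, S)\<in>I. lmult (scal (c nu S)) (xv n nu S))))"


section \<open>The contravariant form\<close>

text \<open>
  Hermitian forms are linear in the first and conjugate linear in the second variable.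
  The star of \<open>\<Sum>\<^sub>i k\<^sub>i x\<^sub>i\<close> is \<open>\<Sum>\<^sub>i cnj k\<^sub>i y\<^sub>i\<close>, and vice versa.
\<close>

definition x_lin :: "nat \<Rightarrow> (nat \<Rightarrow> complex) \<Rightarrow> 'r free_alg" where
  "x_lin n k = (\<Sum>i = 1..n. scal (cconst (k i)) * x_el i)"

definition y_lin :: "nat \<Rightarrow> (nat \<Rightarrow> complex) \<Rightarrow> 'r free_alg" where
  "y_lin n k = (\<Sum>i = 1..n. scal (cconst (k i)) * y_el i)"

definition is_contravariant_form ::
    "nat \<Rightarrow> nat list list \<Rightarrow> (specht \<Rightarrow> specht \<Rightarrow> complex) \<Rightarrow>
     ('r free_module set \<Rightarrow> 'r free_module set \<Rightarrow> 'r ratfun) \<Rightarrow> bool" where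
  "is_contravariant_form n lam B0 B \<longleftrightarrow>
     (\<forall>f\<in>standard_module n lam. \<forall>g\<in>standard_module n lam. \<forall>h\<in>standard_module n lam.
        B (M_add n lam f g) h = B f h + B g h) \<and>
     (\<forall>f\<in>standard_module n lam. \<forall>g\<in>standard_module n lam.
        (\<forall>c. B (M_act n lam (scal c) f) g = c * B f g) \<and>
        B g f = cnj_ratfun (B f g) \<and>
        (\<forall>w\<in>monomial_group CARD('r) n. B (M_act n lam (t_el w) f) (M_act n lam (t_el w) g) = B f g) \<and>
        (\<forall>k. B (M_act n lam (x_lin n k) f) g = B f (M_act n lam (y_lin n (\<lambda>i. cnj (k i))) g)) \<and>
        (\<forall>k. B (M_act n lam (y_lin n k) f) g = B f (M_act n lam (x_lin n (\<lambda>i. cnj (k i))) g))) \<and>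
     (\<forall>u\<in>Specht n lam. \<forall>v\<in>Specht n lam.
        B (cls n lam (one_tensor u)) (cls n lam (one_tensor v)) = cconst (B0 u v))"

end

theory Submission
  imports Defs "HOL-Combinatorics.Permutations" "HOL-Library.Function_Algebras"
begin

text \<open>
  \<^bold>\<open>Two moves.\<close>  Every composition is reached from \<open>0\<close> by the moves
  \<open>(\<mu>\<^sub>1, \<dots>, \<mu>\<^sub>n) \<mapsto> (\<mu>\<^sub>2, \<dots>, \<mu>\<^sub>n, \<mu>\<^sub>1 + 1)\<close> and \<open>\<mu> \<mapsto> s\<^sub>i.\<mu>\<close> for \<open>\<mu>\<^sub>i < \<mu>\<^sub>i\<^sub>+\<^sub>1\<close>.  Both are realised by operators
  on the joint eigenvectors of the \<open>z\<^sub>i\<close> and \<open>\<zeta>\<^sub>i\<close>: the first by \<open>\<Phi> = x\<^sub>n t\<^sub>c\<close>, where \<open>c\<close> is the cycle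
  \<open>1 \<mapsto> n\<close>, \<open>i \<mapsto> i - 1\<close> (\<open>wt_Phi\<close>), the second by the intertwiner
  \<open>t\<^bsub>s\<^sub>i\<^esub> + c\<^sub>0 (z\<^sub>i - z\<^sub>i\<^sub>+\<^sub>1)\<^sup>-\<^sup>1 \<Sum>\<^sub>l t\<^bsub>\<zeta>\<^sub>i\<^esub>\<^sup>l t\<^bsub>\<zeta>\<^sub>i\<^sub>+\<^sub>1\<^esub>\<^sup>-\<^sup>l\<close> (\<open>wt_s\<close>).  As \<open>\<Phi>\<^sup>*\<Phi> = z\<^sub>1\<close>, the first move multiplies the norm by
  the eigenvalue of \<open>z\<^sub>1\<close> (\<open>H_Phi\<close>).  The \<open>z\<^sub>i\<close> are self-adjoint, so eigenvectors with different
  eigenvalues are orthogonal; it follows that the second move multiplies the norm by \<open>1 - g\<^sup>2\<close>, where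
  \<open>g\<close> is the scalar by which the second summand of the intertwiner acts (\<open>H_s\<close>).  The product formula
  changes by the same factors (\<open>norm_formula_phi_comp\<close>, \<open>norm_formula_s_perm\<close>).  At \<open>\<mu> = 0\<close> the vectors
  \<open>t\<^bsub>w\<^sub>0\<^esub>\<^sup>-\<^sup>1 v\<^sub>T\<close> have norm 1, and they are eigenvectors because the \<open>z\<^sub>i\<close> act on them by Jucys-Murphy
  elements (\<open>jm_v\<close>, \<open>eigenvector_zero\<close>).

  \<^bold>\<open>Comparison with \<open>f\<^bsub>\<mu>,T\<^esub>\<close>.\<close>  The vector constructed by the moves is \<open>x\<^sup>\<mu>v\<^sub>T\<^sup>\<mu>\<close> plus terms that are
  lower in the Bruhat order of the affine symmetric group, since both moves respect this order
  (\<open>step_phi_comp\<close>, \<open>steps_s_perm\<close>).  The given \<open>f\<^bsub>\<mu>,T\<^esub>\<close> is \<open>x\<^sup>\<mu>v\<^sub>T\<^sup>\<mu>\<close> plus terms that are lower in the order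
  \<open>comp_less\<close>, which the first move does not preserve.  Both orders are contained in one well-founded
  order \<open>height_less\<close>, and inverting the unitriangular relations shows that \<open>f\<^bsub>\<mu>,T\<^esub>\<close> is the
  constructed vector plus constructed vectors for lower \<open>\<nu>\<close>.  The eigenvalue of \<open>z\<^sub>i\<close> has
  \<open>\<kappa>\<close>-coefficient \<open>\<mu>\<^sub>i + 1\<close>, so these are orthogonal to the first one, whose norm is not zero; hence
  \<open>f\<^bsub>\<mu>,T\<^esub>\<close> has the same eigenvalues, is orthogonal to them too, and has the same norm as the constructed
  vector (\<open>norm_of_eigenvector\<close>).

  \<^bold>\<open>The module.\<close>  These arguments are carried out for operators on a subspace of a vector space
  (\<open>cherednik_module\<close>).  Vectors of the standard module enter as the functionals that the
  contravariant form associates with them (\<open>standard_form\<close>).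
\<close>

section \<open>The field of parameters\<close>

lemma cconst_0 [simp]: "cconst 0 = 0"
  by (simp add: cconst_def Zero_fract_def)

lemma cconst_1 [simp]: "cconst 1 = 1"
  by (simp add: cconst_def One_fract_def)

lemma cconst_add: "cconst (x + y) = cconst x + cconst y"
  by (simp add: cconst_def single_add)

lemma cconst_mult: "cconst (x * y) = cconst x * cconst y"
  by (simp add: cconst_def mult_single)

lemma cconst_uminus: "cconst (- x) = - cconst x"
  by (metis add.right_inverse add_eq_0_iff cconst_0 cconst_add)

lemma cconst_eq_0_iff [simp]: "cconst x = 0 \<longleftrightarrow> x = 0"
  by (simp add: cconst_def Zero_fract_def eq_fract) (metis lookup_single_eq single_zero lookup_zero)

lemma cconst_of_nat: "cconst (of_nat k) = of_nat k"
  by (induction k) (simp_all add: cconst_add)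

lemma cconst_of_int: "cconst (of_int k) = of_int k"
  by (cases k) (simp_all add: cconst_of_nat cconst_uminus cconst_add del: of_nat_Suc)

lemma cconst_inverse: "cconst (inverse x) = inverse (cconst x)"
  by (metis cconst_0 cconst_1 cconst_mult inverse_zero inverse_unique right_inverse)

lemma cconst_divide: "cconst (x / y) = cconst x / cconst y"
  by (simp add: divide_inverse cconst_mult cconst_inverse)

lemma of_nat_ratfun_eq_0_iff [simp]: "(of_nat k :: 'r ratfun) = 0 \<longleftrightarrow> k = 0"
  by (metis cconst_of_nat cconst_eq_0_iff of_nat_eq_0_iff)

lemma cconst_sum: "cconst (sum f A) = (\<Sum>i\<in>A. cconst (f i))"
  by (induction A rule: infinite_finite_induct) (simp_all add: cconst_add)

lemma cnj_poly_add: "cnj_poly (p + q) = cnj_poly p + cnj_poly q"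
  by (rule poly_mapping_eqI) (simp add: lookup_cnj_poly lookup_add)

lemma cnj_poly_single: "cnj_poly (Poly_Mapping.single m c) = Poly_Mapping.single m (cnj c)"
  by (rule poly_mapping_eqI) (simp add: lookup_cnj_poly lookup_single when_def)

lemma cnj_poly_one: "cnj_poly 1 = 1"
  by (rule poly_mapping_eqI) (simp add: lookup_cnj_poly lookup_one when_def)

lemma cnj_ratfun_add: "cnj_ratfun (x + y) = cnj_ratfun x + cnj_ratfun y"
  by (cases x; cases y) (simp add: cnj_ratfun_Fract cnj_poly_add cnj_poly_mult cnj_poly_eq_0_iff)

lemma cnj_ratfun_mult: "cnj_ratfun (x * y) = cnj_ratfun x * cnj_ratfun y"
  by (cases x; cases y) (simp add: cnj_ratfun_Fract cnj_poly_mult cnj_poly_eq_0_iff)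

lemma cnj_ratfun_0 [simp]: "cnj_ratfun 0 = 0"
  by (metis add_cancel_right_right cnj_ratfun_add)

lemma cnj_ratfun_cconst: "cnj_ratfun (cconst c) = cconst (cnj c)"
  by (simp add: cconst_def cnj_ratfun_Fract cnj_poly_single cnj_poly_one)

lemma cnj_ratfun_1 [simp]: "cnj_ratfun 1 = 1"
  by (metis cnj_ratfun_cconst cconst_1 complex_cnj_one)

lemma cnj_ratfun_uminus: "cnj_ratfun (- x) = - cnj_ratfun x"
  by (metis add.right_inverse add_eq_0_iff cnj_ratfun_0 cnj_ratfun_add)

lemma cnj_ratfun_diff: "cnj_ratfun (x - y) = cnj_ratfun x - cnj_ratfun y"
  by (metis cnj_ratfun_add cnj_ratfun_uminus diff_conv_add_uminus)

lemma cnj_ratfun_inverse: "cnj_ratfun (inverse x) = inverse (cnj_ratfun x)"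
  by (metis cnj_ratfun_0 cnj_ratfun_1 cnj_ratfun_mult inverse_unique inverse_zero right_inverse)

lemma cnj_ratfun_divide: "cnj_ratfun (x / y) = cnj_ratfun x / cnj_ratfun y"
  by (simp add: divide_inverse cnj_ratfun_mult cnj_ratfun_inverse)

lemma cnj_ratfun_of_nat [simp]: "cnj_ratfun (of_nat k) = of_nat k"
  by (induction k) (simp_all add: cnj_ratfun_add)

lemma cnj_ratfun_of_int [simp]: "cnj_ratfun (of_int k) = of_int k"
  by (cases k) (simp_all add: cnj_ratfun_uminus cnj_ratfun_add del: of_nat_Suc)

lemma cnj_ratfun_sum: "cnj_ratfun (sum f A) = (\<Sum>i\<in>A. cnj_ratfun (f i))"
  by (induction A rule: infinite_finite_induct) (simp_all add: cnj_ratfun_add)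

lemma cnj_param_var [simp]: "cnj_ratfun (param_var k) = param_var k"
  by (simp add: param_var_def cnj_ratfun_Fract cnj_poly_single cnj_poly_one)

lemma cnj_kappa [simp]: "cnj_ratfun kappa = kappa"
  by (simp add: kappa_def)

lemma cnj_c0 [simp]: "cnj_ratfun c0 = c0"
  by (simp add: c0_def)

lemma cnj_d [simp]: "cnj_ratfun (d i) = d i"
  by (simp add: d_def Let_def cnj_ratfun_uminus cnj_ratfun_sum)

lemma d_cong: "[i = j] (mod int CARD('r)) \<Longrightarrow> (d i :: 'r ratfun) = d j"
  by (simp add: d_def cong_def)

text \<open>
  The eigenvalues of the \<open>z\<^sub>i\<close> are linear in the parameters, and it is by their \<open>\<kappa>\<close>-coefficients that
  they are told apart.
\<close>

definition has_kappa_coeff :: "'r ratfun \<Rightarrow> complex \<Rightarrow> bool" where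
  "has_kappa_coeff x p \<longleftrightarrow> (\<exists>P. x = Fraction_Field.Fract P 1 \<and>
     Poly_Mapping.lookup P (Poly_Mapping.single (Abs_param 0) 1) = p)"

lemma has_kappa_coeff_add:
  "has_kappa_coeff x p \<Longrightarrow> has_kappa_coeff y q \<Longrightarrow> has_kappa_coeff (x + y) (p + q)"
  unfolding has_kappa_coeff_def by (metis (no_types, lifting) add_fract lookup_add mult.right_neutral one_neq_zero)

lemma has_kappa_coeff_cconst_mult:
  assumes "has_kappa_coeff x p" shows "has_kappa_coeff (cconst c * x) (c * p)"
proof -
  obtain P where P: "x = Fraction_Field.Fract P 1"
      "Poly_Mapping.lookup P (Poly_Mapping.single (Abs_param 0) 1) = p"
    using assms by (auto simp: has_kappa_coeff_def)
  have "cconst c * x = Fraction_Field.Fract (Poly_Mapping.single 0 c * P) 1"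
    by (simp add: P cconst_def)
  moreover have "Poly_Mapping.lookup (Poly_Mapping.single 0 c * P) m = c * Poly_Mapping.lookup P m" for m
    by (simp add: Poly_Mapping.map.rep_eq when_def flip: mult_map_scale_conv_mult)
  ultimately show ?thesis
    using P(2) by (auto simp: has_kappa_coeff_def)
qed

lemma has_kappa_coeff_uminus: "has_kappa_coeff x p \<Longrightarrow> has_kappa_coeff (- x) (- p)"
  using has_kappa_coeff_cconst_mult[of x p "-1"] by (simp add: cconst_uminus)

lemma has_kappa_coeff_diff:
  "has_kappa_coeff x p \<Longrightarrow> has_kappa_coeff y q \<Longrightarrow> has_kappa_coeff (x - y) (p - q)"
  using has_kappa_coeff_add[OF _ has_kappa_coeff_uminus] by fastforce

lemma has_kappa_coeff_0: "has_kappa_coeff 0 0"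
  by (auto simp: has_kappa_coeff_def Zero_fract_def)

lemma has_kappa_coeff_unique: "has_kappa_coeff x p \<Longrightarrow> has_kappa_coeff x q \<Longrightarrow> p = q"
  by (auto simp: has_kappa_coeff_def eq_fract)

lemma has_kappa_coeff_sum:
  "(\<And>i. i \<in> A \<Longrightarrow> has_kappa_coeff (f i) 0) \<Longrightarrow> has_kappa_coeff (sum f A) 0"
proof (induction A rule: infinite_finite_induct)
  case (insert x F)
  then show ?case
    using has_kappa_coeff_add[of "f x" 0 "sum f F" 0] by simp
qed (simp_all add: has_kappa_coeff_0)

lemma has_kappa_coeff_param_var:
  assumes "k \<le> CARD('r)"
  shows "has_kappa_coeff (param_var k :: 'r::finite ratfun) (if k = 0 then 1 else 0)"
proof -
  have "Abs_param k = (Abs_param 0 :: 'r param) \<longleftrightarrow> k = 0"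
    using assms by (subst Abs_param_inject) auto
  then have "Poly_Mapping.single (Abs_param k :: 'r param) (Suc 0) = Poly_Mapping.single (Abs_param 0) (Suc 0)
      \<longleftrightarrow> k = 0"
    by (metis lookup_single_eq lookup_single_not_eq n_not_Suc_n)
  then show ?thesis
    unfolding has_kappa_coeff_def param_var_def by (auto simp: lookup_single when_def)
qed

lemma has_kappa_coeff_kappa: "has_kappa_coeff (kappa :: 'r::finite ratfun) 1"
  using has_kappa_coeff_param_var[of 0, where 'r='r] by (simp add: kappa_def)

lemma has_kappa_coeff_c0: "has_kappa_coeff (c0 :: 'r::finite ratfun) 0"
  using has_kappa_coeff_param_var[of 1, where 'r='r] by (simp add: c0_def Suc_leI)

lemma has_kappa_coeff_d: "has_kappa_coeff (d i :: 'r::finite ratfun) 0"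
proof -
  have *: "has_kappa_coeff (param_var (k + 1) :: 'r ratfun) 0" if "k < CARD('r)" for k
    using has_kappa_coeff_param_var[of "k + 1", where 'r='r] that by simp
  have "has_kappa_coeff (\<Sum>k = 1..<CARD('r). param_var (k + 1) :: 'r ratfun) 0"
    by (intro has_kappa_coeff_sum *) simp
  from has_kappa_coeff_uminus[OF this]
  have "has_kappa_coeff (- (\<Sum>k = 1..<CARD('r). param_var (k + 1)) :: 'r ratfun) 0"
    by simp
  moreover have "nat (i mod int CARD('r)) < CARD('r)"
    by (simp add: nat_less_iff)
  ultimately show ?thesis
    unfolding d_def Let_def using * by simp
qed

lemma has_kappa_coeff_c0_mult: 
  "has_kappa_coeff (c0 * of_nat k * of_int a :: 'r::finite ratfun) 0"
  using has_kappa_coeff_cconst_mult[OF has_kappa_coeff_c0[where 'r='r], of "of_nat k * of_int a"]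
  by (simp add: cconst_mult cconst_of_nat cconst_of_int mult_ac)

lemma has_kappa_coeff_affine:
  "has_kappa_coeff (kappa * of_nat k - (d i - d j) - c0 * of_nat m * of_int a :: 'r::finite ratfun)
     (of_nat k)"
proof -
  have "has_kappa_coeff (kappa * of_nat k :: 'r ratfun) (of_nat k)"
    using has_kappa_coeff_cconst_mult[OF has_kappa_coeff_kappa[where 'r='r], of "of_nat k"]
    by (simp add: cconst_of_nat mult_ac)
  then show ?thesis
    using has_kappa_coeff_diff[OF has_kappa_coeff_diff[OF _ has_kappa_coeff_diff[OF has_kappa_coeff_d has_kappa_coeff_d]] has_kappa_coeff_c0_mult]
    by fastforce
qed

section \<open>Roots of unity\<close>

lemma zeta_nz [simp]: "zeta r \<noteq> 0"
  by (simp add: zeta_def)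

lemma zeta_powi_eq_1_iff:
  assumes "r > 0" shows "zeta r powi k = 1 \<longleftrightarrow> int r dvd k"
proof -
  have "zeta r powi k = exp (of_int k * (2 * of_real pi * \<i> / of_nat r))"
    unfolding zeta_def by (metis exp_power_int)
  also have "\<dots> = cis (real_of_int k * (2 * pi / real r))"
    by (simp add: cis_conv_exp mult_ac)
  also have "\<dots> = 1 \<longleftrightarrow> cos (real_of_int k * (2 * pi / real r)) = 1"
    by (auto simp: complex_eq_iff dest: cos_one_sin_zero)
  also have "\<dots> \<longleftrightarrow> (\<exists>m::int. real_of_int k * (2 * pi / real r) = of_int m * 2 * pi)"
    by (rule cos_one_2pi_int)
  also have "\<dots> \<longleftrightarrow> (\<exists>m::int. real_of_int k = of_int m * real r)"
    using assms by (intro arg_cong[where f = Ex] ext) (auto simp: field_simps)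
  also have "\<dots> \<longleftrightarrow> (\<exists>m. k = m * int r)"
    by (metis of_int_eq_iff of_int_mult of_int_of_nat_eq)
  also have "\<dots> \<longleftrightarrow> int r dvd k"
    by (auto simp: dvd_def mult.commute)
  finally show ?thesis .
qed

lemma sum_zeta_powi:
  assumes "r > 0"
  shows "(\<Sum>l<r. zeta r powi (int l * k)) = (if int r dvd k then of_nat r else 0)"
proof -
  have *: "(\<Sum>l<r. zeta r powi (int l * k)) = (\<Sum>l<r. (zeta r powi k) ^ l)"
    by (simp add: power_int_mult mult.commute flip: power_int_of_nat)
  show ?thesis
  proof (cases "int r dvd k")
    case False
    then have "zeta r powi k \<noteq> 1" using assms by (simp add: zeta_powi_eq_1_iff)
    moreover have "(zeta r powi k) ^ r = 1"
      using zeta_powi_eq_1_iff[OF assms, of "k * int r"] by (simp add: power_int_mult flip: power_int_of_nat)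
    ultimately show ?thesis using False * by (simp add: geometric_sum)
  next
    case True
    then have "zeta r powi k = 1" using assms by (simp add: zeta_powi_eq_1_iff)
    then show ?thesis using True * by simp
  qed
qed

section \<open>Monomial matrices\<close>

definition mono_mat :: "nat \<Rightarrow> (nat \<Rightarrow> nat) \<Rightarrow> (nat \<Rightarrow> complex) \<Rightarrow> complex mat" where
  "mono_mat n w f = mat_of n (\<lambda>p q. if p = w q then f q else 0)"

lemma entry_mat_of: "i \<in> {1..n} \<Longrightarrow> j \<in> {1..n} \<Longrightarrow> entry (mat_of n g) i j = g i j"
  by (auto simp: entry_def mat_of_def)

lemma entry_mono_mat:
  "i \<in> {1..n} \<Longrightarrow> j \<in> {1..n} \<Longrightarrow> entry (mono_mat n w f) i j = (if i = w j then f j else 0)"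
  by (simp add: mono_mat_def entry_mat_of)

lemma mat_of_carrier [simp]: "mat_of n g \<in> carrier_mat n n"
  by (simp add: mat_of_def)

lemma mat_of_eqI:
  assumes "A \<in> carrier_mat n n" "\<And>i j. i \<in> {1..n} \<Longrightarrow> j \<in> {1..n} \<Longrightarrow> entry A i j = g i j"
  shows "A = mat_of n g"
proof (rule eq_matI)
  fix i j assume "i < dim_row (mat_of n g)" "j < dim_col (mat_of n g)"
  then show "A $$ (i, j) = mat_of n g $$ (i, j)"
    using assms(2)[of "i + 1" "j + 1"] by (auto simp: mat_of_def entry_def)
qed (use assms in \<open>auto simp: mat_of_def\<close>)

lemma mat_of_cong:
  "(\<And>i j. i \<in> {1..n} \<Longrightarrow> j \<in> {1..n} \<Longrightarrow> g i j = h i j) \<Longrightarrow> mat_of n g = mat_of n h"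
  by (rule mat_of_eqI) (simp_all add: entry_mat_of)

lemma perm_mat_eq: "perm_mat n w = mono_mat n w (\<lambda>_. 1)"
  by (simp add: perm_mat_def mono_mat_def)

lemma zeta_mat_eq: "zeta_mat r n i l = mono_mat n id (\<lambda>q. if q = i then zeta r powi l else 1)"
  unfolding zeta_mat_def mono_mat_def by (intro mat_of_cong) auto

lemma one_mat_eq: "1\<^sub>m n = mono_mat n id (\<lambda>_. 1)"
  unfolding mono_mat_def by (intro mat_of_eqI) (auto simp: entry_def)

lemma entry_times:
  assumes "A \<in> carrier_mat n n" "B \<in> carrier_mat n n" "i \<in> {1..n}" "j \<in> {1..n}"
  shows "entry (A * B) i j = (\<Sum>k = 1..n. entry A i k * entry B k j)"
proof -
  have "entry (A * B) i j = (\<Sum>k = 0..<n. A $$ (i - 1, k) * B $$ (k, j - 1))"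
    using assms by (auto simp: entry_def scalar_prod_def)
  also have "\<dots> = (\<Sum>k = 1..n. entry A i k * entry B k j)"
    unfolding entry_def
    by (rule sum.reindex_bij_witness[of _ "\<lambda>k. k - 1" "\<lambda>k. k + 1"]) auto
  finally show ?thesis .
qed

lemma mono_mat_times:
  assumes "v permutes {1..n}"
  shows "mono_mat n w f * mono_mat n v g = mono_mat n (w \<circ> v) (\<lambda>q. f (v q) * g q)"
  unfolding mono_mat_def[of n "w \<circ> v"]
proof (rule mat_of_eqI)
  fix i j assume ij: "i \<in> {1..n}" "j \<in> {1..n}"
  have "v j \<in> {1..n}" using assms ij permutes_in_image by metis
  have "entry (mono_mat n w f * mono_mat n v g) i j =
      (\<Sum>k = 1..n. (if i = w k then f k else 0) * (if k = v j then g j else 0))"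
    using ij by (subst entry_times[of _ n]) (auto simp: entry_mono_mat mono_mat_def entry_mat_of intro!: sum.cong)
  also have "\<dots> = (\<Sum>k = 1..n. if k = v j then (if i = w k then f k else 0) * g j else 0)"
    by (intro sum.cong) auto
  also have "\<dots> = (if i = (w \<circ> v) j then f (v j) * g j else 0)"
    using \<open>v j \<in> {1..n}\<close> by (auto simp: sum.delta)
  finally show "entry (mono_mat n w f * mono_mat n v g) i j = (if i = (w \<circ> v) j then f (v j) * g j else 0)" .
qed (use mult_carrier_mat mat_of_carrier in \<open>unfold mono_mat_def, blast\<close>)

lemma mono_mat_cong:
  "(\<And>q. q \<in> {1..n} \<Longrightarrow> w q = v q) \<Longrightarrow> (\<And>q. q \<in> {1..n} \<Longrightarrow> f q = g q) \<Longrightarrow>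
    mono_mat n w f = mono_mat n v g"
  unfolding mono_mat_def by (intro mat_of_cong) auto

lemma mono_mat_in_monomial_group:
  assumes w: "w permutes {1..n}" and f: "\<And>q. q \<in> {1..n} \<Longrightarrow> f q ^ r = 1" and "r > 0"
  shows "mono_mat n w f \<in> monomial_group r n"
proof -
  have nz: "f q \<noteq> 0" if "q \<in> {1..n}" for q
    using f[OF that] \<open>r > 0\<close> by (metis power_0_left zero_neq_one less_irrefl)
  have iff: "entry (mono_mat n w f) i j \<noteq> 0 \<longleftrightarrow> i = w j" if "i \<in> {1..n}" "j \<in> {1..n}" for i j
    using that nz by (simp add: entry_mono_mat)
  have "\<exists>!j. j \<in> {1..n} \<and> entry (mono_mat n w f) i j \<noteq> 0" if "i \<in> {1..n}" for i
  proof (rule ex1I[of _ "inv_into UNIV w i"])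
    show "inv_into UNIV w i \<in> {1..n} \<and> entry (mono_mat n w f) i (inv_into UNIV w i) \<noteq> 0"
      using that iff[of i "inv_into UNIV w i"] permutes_in_image[OF permutes_inv[OF w], of i]
        permutes_inverses(1)[OF w, of i] by simp
  qed (use that w iff in \<open>auto simp: permutes_inverses\<close>)
  moreover have "\<exists>!i. i \<in> {1..n} \<and> entry (mono_mat n w f) i j \<noteq> 0" if "j \<in> {1..n}" for j
    using that w iff by (metis permutes_in_image)
  ultimately show ?thesis
    using f unfolding monomial_group_def by (auto simp: entry_mono_mat) (auto simp: mono_mat_def)
qed

lemma perm_mat_in_group: "w permutes {1..n} \<Longrightarrow> r > 0 \<Longrightarrow> perm_mat n w \<in> monomial_group r n"
  by (simp add: perm_mat_eq mono_mat_in_monomial_group)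

lemma zeta_powi_pow_r: "r > 0 \<Longrightarrow> (zeta r powi l) ^ r = 1"
  using zeta_powi_eq_1_iff[of r "l * int r"] by (simp add: power_int_mult flip: power_int_of_nat)

lemma zeta_mat_in_group: "r > 0 \<Longrightarrow> zeta_mat r n i l \<in> monomial_group r n"
  unfolding zeta_mat_eq by (rule mono_mat_in_monomial_group) (auto simp: zeta_powi_pow_r permutes_id)

lemma perm_mat_times:
  "v permutes {1..n} \<Longrightarrow> perm_mat n w * perm_mat n v = perm_mat n (w \<circ> v)"
  by (simp add: perm_mat_eq mono_mat_times)

lemma zeta_mat_times: "zeta_mat r n i l * zeta_mat r n i m = zeta_mat r n i (l + m)"
  unfolding zeta_mat_eq mono_mat_times[OF permutes_id]
  by (intro mono_mat_cong) (simp_all add: power_int_add)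

lemma zeta_mat_0: "zeta_mat r n i 0 = 1\<^sub>m n"
  by (simp add: zeta_mat_eq one_mat_eq cong: if_cong)

lemma perm_mat_id: "perm_mat n id = 1\<^sub>m n"
  by (simp add: perm_mat_eq one_mat_eq)

lemma perm_mat_zeta_mat:
  assumes w: "w permutes {1..n}"
  shows "perm_mat n w * zeta_mat r n i l = zeta_mat r n (w i) l * perm_mat n w"
  unfolding zeta_mat_eq perm_mat_eq
  using w by (simp add: mono_mat_times permutes_id) (intro mono_mat_cong, auto dest: permutes_inj[THEN injD])

lemma perm_zeta_mat_in_group:
  assumes w: "w permutes {1..n}" and "r > 0"
  shows "perm_mat n w * zeta_mat r n i l \<in> monomial_group r n"
  unfolding zeta_mat_eq perm_mat_eq
  using assms by (simp add: mono_mat_times permutes_id) (intro mono_mat_in_monomial_group, auto simp: zeta_powi_pow_r)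

lemma refl_mat_in_group:
  assumes "i \<in> {1..n}" "j \<in> {1..n}" "r > 0"
  shows "refl_mat r n i j l \<in> monomial_group r n"
proof -
  have p: "Transposition.transpose i j permutes {1..n}"
    using assms by (intro permutes_swap_id) auto
  then show ?thesis
    unfolding refl_mat_def zeta_mat_eq perm_mat_eq using assms
    by (simp add: mono_mat_times permutes_id)
      (intro mono_mat_in_monomial_group, auto simp: zeta_powi_pow_r zeta_powi_pow_r[of r "int l", simplified] power_mult_distrib)
qed

lemma refl_mat_assoc:
  "refl_mat r n i j l = zeta_mat r n i (int l) * (perm_mat n (Transposition.transpose i j) * zeta_mat r n i (- int l))"
  unfolding refl_mat_def
  by (rule assoc_mult_mat[of _ n n _ n _ n]) (auto simp: zeta_mat_def perm_mat_def)

lemma mono_mat_inverse_mult: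
  "w permutes {1..n} \<Longrightarrow> perm_mat n w * perm_mat n (inv_into UNIV w) = 1\<^sub>m n"
  by (simp add: perm_mat_times permutes_inv permutes_inv_o perm_mat_id[symmetric])

section \<open>The permutations \<open>w\<^sub>\<mu>\<close>\<close>

text \<open>
  \<open>w\<^sub>\<mu>(i)\<close> is the rank of \<open>i\<close> when the positions are ordered by their values, equal values from
  right to left.  All properties of \<open>w\<^sub>\<mu>\<close> below come from this total order.
\<close>

lemma w_comp_eq_card:
  assumes "i \<in> {1..n}"
  shows "w_comp n mu i = card {j \<in> {1..n}. mu j < mu i \<or> mu j = mu i \<and> i \<le> j}"
proof -
  have "{j \<in> {1..n}. mu j < mu i \<or> mu j = mu i \<and> i \<le> j} =
      {j \<in> {1..<i}. mu j < mu i} \<union> {j \<in> {i..n}. mu j \<le> mu i}"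
    using assms by auto
  then show ?thesis
    using assms by (simp add: w_comp_def card_Un_disjoint disjoint_iff)
qed

lemma w_comp_less:
  assumes "i \<in> {1..n}" "j \<in> {1..n}" "mu i < mu j \<or> mu i = mu j \<and> j < i"
  shows "w_comp n mu i < w_comp n mu j"
  unfolding w_comp_eq_card[OF assms(1)] w_comp_eq_card[OF assms(2)]
proof (rule psubset_card_mono)
  show "{p \<in> {1..n}. mu p < mu i \<or> mu p = mu i \<and> i \<le> p} \<subset> {p \<in> {1..n}. mu p < mu j \<or> mu p = mu j \<and> j \<le> p}"
    (is "?A \<subset> ?B")
  proof (rule psubsetI)
    show "?A \<subseteq> ?B" using assms by auto
    have "j \<in> ?B" "j \<notin> ?A" using assms by auto
    then show "?A \<noteq> ?B" by blast
  qed
qed simp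

lemma w_comp_less_iff:
  assumes "i \<in> {1..n}" "j \<in> {1..n}"
  shows "w_comp n mu i < w_comp n mu j \<longleftrightarrow> mu i < mu j \<or> mu i = mu j \<and> j < i"
  using w_comp_less[OF assms, of mu] w_comp_less[OF assms(2,1), of mu]
  by (cases i j rule: linorder_cases; cases "mu i" "mu j" rule: linorder_cases) auto

lemma w_comp_permutes: "w_comp n mu permutes {1..n}"
proof (rule bij_imp_permutes)
  have inj: "inj_on (w_comp n mu) {1..n}"
  proof (rule inj_onI)
    fix i j assume "i \<in> {1..n}" "j \<in> {1..n}" "w_comp n mu i = w_comp n mu j"
    then show "i = j"
      using w_comp_less[of i n j mu] w_comp_less[of j n i mu] by (cases i j rule: linorder_cases) fastforce+
  qed
  have "w_comp n mu ` {1..n} \<subseteq> {1..n}"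
  proof clarify
    fix i assume i: "i \<in> {1..n}"
    let ?A = "{j \<in> {1..n}. mu j < mu i \<or> mu j = mu i \<and> i \<le> j}"
    have "i \<in> ?A" "finite ?A" using i by auto
    then have "card ?A > 0" using card_gt_0_iff by blast
    moreover have "card ?A \<le> card {1..n}" by (rule card_mono) auto
    ultimately show "w_comp n mu i \<in> {1..n}"
      using i by (simp add: w_comp_eq_card)
  qed
  with inj show "bij_betw (w_comp n mu) {1..n} {1..n}"
    by (simp add: bij_betw_def endo_inj_surj)
qed (auto simp: w_comp_def)

text \<open>
  A relabelling of the positions that preserves their total order carries one rank function to
  the other; both moves on compositions are of this kind.
\<close>

lemma w_comp_reindex:
  assumes c: "c permutes {1..n}"
    and ord: "\<And>p q. p \<in> {1..n} \<Longrightarrow> q \<in> {1..n} \<Longrightarrow>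
      (nu (c p) < nu (c q) \<or> nu (c p) = nu (c q) \<and> c q \<le> c p) \<longleftrightarrow>
      (mu p < mu q \<or> mu p = mu q \<and> q \<le> p)"
  shows "w_comp n nu \<circ> c = w_comp n mu"
proof
  fix q
  show "(w_comp n nu \<circ> c) q = w_comp n mu q"
  proof (cases "q \<in> {1..n}")
    case True
    then have cq: "c q \<in> {1..n}" using permutes_in_image[OF c, of q] by blast
    let ?A = "{p \<in> {1..n}. mu p < mu q \<or> mu p = mu q \<and> q \<le> p}"
    have "{j \<in> {1..n}. nu j < nu (c q) \<or> nu j = nu (c q) \<and> c q \<le> j} = c ` ?A" (is "?B = _")
    proof
      show "?B \<subseteq> c ` ?A"
      proof
        fix j assume j: "j \<in> ?B"
        then obtain p where "p \<in> {1..n}" "j = c p"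
          using permutes_image[OF c] by blast
        then show "j \<in> c ` ?A" using j ord[of p q] True by blast
      qed
      show "c ` ?A \<subseteq> ?B"
        using ord True permutes_in_image[OF c] by blast
    qed
    then show ?thesis
      using True cq c by (simp add: w_comp_eq_card card_image permutes_inj_on)
  next
    case False
    then have "c q = q" using permutes_not_in[OF c] by blast
    then show ?thesis using False by (auto simp: w_comp_def)
  qed
qed

definition s_perm :: "nat \<Rightarrow> nat \<Rightarrow> nat" where
  "s_perm i = Transposition.transpose i (i + 1)"

lemma s_perm_permutes: "i \<in> {1..<n} \<Longrightarrow> s_perm i permutes {1..n}"
  unfolding s_perm_def by (intro permutes_swap_id) auto

lemma s_perm_involutory [simp]: "s_perm i (s_perm i j) = j"
  by (simp add: s_perm_def)

lemma s_perm_comp [simp]: "s_perm i \<circ> s_perm i = id"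
  by (auto simp: fun_eq_iff)

lemma inv_s_perm: "inv_into UNIV (s_perm i) = s_perm i"
  by (rule inv_equality) auto

lemma s_perm_less_iff:
  "\<not> (p = i \<and> q = i + 1) \<Longrightarrow> \<not> (p = i + 1 \<and> q = i) \<Longrightarrow> s_perm i p < s_perm i q \<longleftrightarrow> p < q"
  by (auto simp: s_perm_def transpose_def)

lemma w_comp_s_perm:
  assumes i: "i \<in> {1..<n}" and ne: "mu i \<noteq> mu (i + 1)"
  shows "w_comp n (mu \<circ> s_perm i) = w_comp n mu \<circ> s_perm i"
proof -
  have "w_comp n (mu \<circ> s_perm i) \<circ> s_perm i = w_comp n mu"
  proof (rule w_comp_reindex[OF s_perm_permutes[OF i]])
    fix p q
    have "s_perm i p < s_perm i q \<longleftrightarrow> p < q" if "mu p = mu q"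
      by (rule s_perm_less_iff) (use ne that in auto)
    then show "((mu \<circ> s_perm i) (s_perm i p) < (mu \<circ> s_perm i) (s_perm i q) \<or>
            (mu \<circ> s_perm i) (s_perm i p) = (mu \<circ> s_perm i) (s_perm i q) \<and> s_perm i q \<le> s_perm i p) =
           (mu p < mu q \<or> mu p = mu q \<and> q \<le> p)"
      by (auto simp flip: linorder_not_less)
  qed
  then have "w_comp n (mu \<circ> s_perm i) \<circ> (s_perm i \<circ> s_perm i) = w_comp n mu \<circ> s_perm i"
    by (simp only: o_assoc)
  then show ?thesis by (simp only: s_perm_comp comp_id)
qed

lemma w_comp_adjacent_equal:
  assumes i: "i \<in> {1..<n}" and eq: "mu i = mu (i + 1)"
  shows "w_comp n mu i = w_comp n mu (i + 1) + 1"
proof -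
  have "{j \<in> {1..n}. mu j < mu i \<or> mu j = mu i \<and> i \<le> j} =
      insert i {j \<in> {1..n}. mu j < mu (i+1) \<or> mu j = mu (i+1) \<and> i + 1 \<le> j}"
    using assms by (auto simp: not_less_eq_eq[symmetric])
  moreover have "i \<notin> {j \<in> {1..n}. mu j < mu (i+1) \<or> mu j = mu (i+1) \<and> i + 1 \<le> j}"
    using eq by auto
  ultimately show ?thesis
    using i by (simp add: w_comp_eq_card)
qed

text \<open>
  \<open>phi_comp n\<close> is the map \<open>(\<mu>\<^sub>1, \<dots>, \<mu>\<^sub>n) \<mapsto> (\<mu>\<^sub>2, \<dots>, \<mu>\<^sub>n, \<mu>\<^sub>1 + 1)\<close>.  Together with the adjacent
  transpositions it reaches every composition from \<open>0\<close>.
\<close>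

definition rot :: "nat \<Rightarrow> nat \<Rightarrow> nat" where
  "rot n i = (if i = 1 then n else if i \<in> {1..n} then i - 1 else i)"

definition unrot :: "nat \<Rightarrow> nat \<Rightarrow> nat" where
  "unrot n i = (if i = n then 1 else if i \<in> {1..n} then i + 1 else i)"

definition phi_comp :: "nat \<Rightarrow> (nat \<Rightarrow> nat) \<Rightarrow> nat \<Rightarrow> nat" where
  "phi_comp n mu = (mu \<circ> unrot n)(n := mu 1 + 1)"

lemma rot_unrot: "n \<ge> 1 \<Longrightarrow> rot n (unrot n i) = i"
  by (auto simp: rot_def unrot_def)

lemma unrot_rot: "n \<ge> 1 \<Longrightarrow> unrot n (rot n i) = i"
  by (auto simp: rot_def unrot_def)

lemma rot_permutes: "n \<ge> 1 \<Longrightarrow> rot n permutes {1..n}"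
  by (rule bij_imp_permutes, rule bij_betwI[where g = "unrot n"])
    (auto simp: rot_unrot unrot_rot, auto simp: rot_def unrot_def)

lemma inv_rot: "n \<ge> 1 \<Longrightarrow> inv_into UNIV (rot n) = unrot n"
  by (rule inv_equality) (auto simp: rot_unrot unrot_rot)

lemma unrot_permutes: "n \<ge> 1 \<Longrightarrow> unrot n permutes {1..n}"
  using permutes_inv[OF rot_permutes] by (simp add: inv_rot)

lemma phi_comp_rot:
  "n \<ge> 1 \<Longrightarrow> phi_comp n mu (rot n i) = (if i = 1 then mu 1 + 1 else mu i)"
  using unrot_rot[of n i] by (auto simp: phi_comp_def rot_def split: if_splits)

lemma w_comp_phi_comp:
  assumes n: "n \<ge> 1"
  shows "w_comp n (phi_comp n mu) = w_comp n mu \<circ> unrot n"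
proof -
  have "w_comp n (phi_comp n mu) \<circ> rot n = w_comp n mu"
  proof (rule w_comp_reindex[OF rot_permutes[OF n]])
    fix p q assume pq: "p \<in> {1..n}" "q \<in> {1..n}"
    show "(phi_comp n mu (rot n p) < phi_comp n mu (rot n q) \<or>
            phi_comp n mu (rot n p) = phi_comp n mu (rot n q) \<and> rot n q \<le> rot n p) =
           (mu p < mu q \<or> mu p = mu q \<and> q \<le> p)"
      using pq unfolding phi_comp_rot[OF n] by (auto simp: rot_def)
  qed
  then have "w_comp n (phi_comp n mu) \<circ> (rot n \<circ> unrot n) = w_comp n mu \<circ> unrot n"
    by (simp only: o_assoc)
  moreover have "rot n \<circ> unrot n = id" using rot_unrot[OF n] by auto
  ultimately show ?thesis by (simp only: comp_id)
qed

lemma comp_perm_in: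
  "s permutes {1..n} \<Longrightarrow> mu \<in> compositions n \<Longrightarrow> mu \<circ> s \<in> compositions n"
  by (auto simp: compositions_def permutes_not_in)

lemma phi_comp_unrot: 
  assumes "n \<ge> 1" "mu n > 0"
  shows "mu = phi_comp n ((mu(n := mu n - 1)) \<circ> rot n)"
  using assms rot_unrot[of n] by (auto simp: phi_comp_def fun_eq_iff rot_def)

section \<open>Two orders on compositions\<close>

text \<open>
  Extend \<open>\<mu>\<close> to all integer positions by \<open>\<mu>\<^bsub>i + n\<^esub> = \<mu>\<^sub>i + 1\<close>; then \<open>phi_comp\<close> is a shift of positions.
  A \<open>step\<close> sorts a descent between the positions \<open>i\<close> and \<open>j + k n\<close>: it is a reflection of the affine
  symmetric group that lowers \<open>\<mu>\<close> in its Bruhat order.  The order \<open>comp_less\<close> is not preserved by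
  \<open>phi_comp\<close>, but the order generated by the steps is.
\<close>

definition step :: "nat \<Rightarrow> (nat \<Rightarrow> nat) \<Rightarrow> (nat \<Rightarrow> nat) \<Rightarrow> bool" where
  "step n nu mu \<longleftrightarrow> (\<exists>i\<in>{1..n}. \<exists>j\<in>{1..n}. \<exists>k. i \<noteq> j \<and> (i < j \<or> k \<ge> 1) \<and> mu j + k < mu i \<and>
     nu = mu(i := mu j + k, j := mu i - k))"

lemma step_in: "step n nu mu \<Longrightarrow> mu \<in> compositions n \<Longrightarrow> nu \<in> compositions n"
  by (auto simp: step_def compositions_def)

lemma step_phi_comp:
  assumes n: "n \<ge> 1" and st: "step n nu mu"
  shows "step n (phi_comp n nu) (phi_comp n mu)"
proof -
  obtain i j k where ij: "i \<in> {1..n}" "j \<in> {1..n}" "i \<noteq> j" "i < j \<or> k \<ge> 1" "mu j + k < mu i"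
    and nu: "nu = mu(i := mu j + k, j := mu i - k)"
    using st unfolding step_def by blast
  \<comment> \<open>Position 1 is sent to \<open>n\<close> instead of \<open>0\<close>, which shifts the period \<open>k\<close> by one.\<close>
  define k' where "k' = (if i = 1 then k + 1 else if j = 1 then k - 1 else k)"
  have "rot n i \<in> {1..n}" "rot n j \<in> {1..n}"
    using ij permutes_in_image[OF rot_permutes[OF n]] by auto
  moreover have "rot n i \<noteq> rot n j" using ij by (metis unrot_rot[OF n])
  moreover have "rot n i < rot n j \<or> k' \<ge> 1"
    using ij by (auto simp: rot_def k'_def)
  moreover have "phi_comp n mu (rot n j) + k' < phi_comp n mu (rot n i)"
    using ij unfolding phi_comp_rot[OF n] by (auto simp: k'_def)
  moreover have "phi_comp n nu =
      (phi_comp n mu)(rot n i := phi_comp n mu (rot n j) + k', rot n j := phi_comp n mu (rot n i) - k')"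
  proof
    fix p
    obtain q where q: "p = rot n q" by (metis rot_unrot[OF n])
    have inj: "rot n a = rot n b \<longleftrightarrow> a = b" for a b by (metis unrot_rot[OF n])
    show "phi_comp n nu p =
      ((phi_comp n mu)(rot n i := phi_comp n mu (rot n j) + k', rot n j := phi_comp n mu (rot n i) - k')) p"
      unfolding q phi_comp_rot[OF n] fun_upd_apply inj using ij
      by (auto simp: nu k'_def)
  qed
  ultimately show ?thesis unfolding step_def by blast
qed

lemma step_s_perm:
  assumes m: "m \<in> {1..<n}" and st: "step n nu mu"
  shows "step n (nu \<circ> s_perm m) (mu \<circ> s_perm m) \<or> nu \<circ> s_perm m = mu"
proof -
  let ?s = "s_perm m"
  obtain i j k where ij: "i \<in> {1..n}" "j \<in> {1..n}" "i \<noteq> j" "i < j \<or> k \<ge> 1" "mu j + k < mu i"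
    and nu: "nu = mu(i := mu j + k, j := mu i - k)"
    using st unfolding step_def by blast
  show ?thesis
  proof (cases "?s i < ?s j \<or> k \<ge> 1")
    case True
    have "?s i \<in> {1..n}" "?s j \<in> {1..n}"
      using ij permutes_in_image[OF s_perm_permutes[OF m]] by auto
    moreover have "?s i \<noteq> ?s j" using ij by (metis s_perm_involutory)
    moreover have "nu \<circ> ?s = (mu \<circ> ?s)(?s i := (mu \<circ> ?s) (?s j) + k, ?s j := (mu \<circ> ?s) (?s i) - k)"
      by (auto simp: nu fun_eq_iff)
    moreover have "(mu \<circ> ?s) (?s j) + k < (mu \<circ> ?s) (?s i)" using ij by simp
    ultimately show ?thesis using True unfolding step_def by blast
  next
    case False
    then have "k = 0" "i < j" "\<not> ?s i < ?s j" using ij by auto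
    then have "i = m" "j = m + 1" using s_perm_less_iff[of i m j] by auto
    then have "nu \<circ> ?s = mu"
      using \<open>k = 0\<close> by (auto simp: nu fun_eq_iff s_perm_def transpose_def)
    then show ?thesis by simp
  qed
qed

lemma steps_phi_comp:
  assumes n: "n \<ge> 1" and st: "(step n)\<^sup>+\<^sup>+ nu mu"
  shows "(step n)\<^sup>+\<^sup>+ (phi_comp n nu) (phi_comp n mu)"
  using st
proof (induction rule: tranclp_induct)
  case (base mu)
  then show ?case using step_phi_comp[OF n] by blast
next
  case (step mu mu')
  then show ?case using step_phi_comp[OF n step(2)] by (rule_tac tranclp.trancl_into_trancl)
qed

text \<open>
  The lifting property of Bruhat orders: a simple reflection takes every step of a chain to a step,
  except a step by this reflection itself, where the new chain joins the old one.
\<close>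

lemma steps_s_perm:
  assumes m: "m \<in> {1..<n}" and st: "(step n)\<^sup>*\<^sup>* nu mu"
  shows "(step n)\<^sup>*\<^sup>* (nu \<circ> s_perm m) (mu \<circ> s_perm m) \<or> (step n)\<^sup>*\<^sup>* (nu \<circ> s_perm m) mu"
  using st
proof (induction rule: converse_rtranclp_induct)
  case (step nu nu')
  then show ?case using step_s_perm[OF m step(1)] by (metis converse_rtranclp_into_rtranclp)
qed simp

lemma step_up_s_perm:
  assumes m: "m \<in> {1..<n}" and lt: "mu m < mu (m + 1)"
  shows "step n mu (mu \<circ> s_perm m)"
proof -
  have "mu = (mu \<circ> s_perm m)(m := (mu \<circ> s_perm m) (m + 1) + 0, m + 1 := (mu \<circ> s_perm m) m - 0)"
    by (auto simp: fun_eq_iff s_perm_def transpose_def)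
  then show ?thesis
    unfolding step_def using m lt
    by (intro bexI[of _ m] bexI[of _ "m + 1"] exI[of _ 0]) (auto simp: s_perm_def)
qed

text \<open>
  Both \<open>step\<close> and \<open>comp_less\<close> increase the pair consisting of the sum of squares and the number of
  weak inversions lexicographically, the latter number being the length of \<open>w\<^sub>\<mu>\<close>.  Triangularity with
  respect to the two orders is compared in this well-founded order, which contains both.
\<close>

definition inversions :: "nat \<Rightarrow> (nat \<Rightarrow> nat) \<Rightarrow> (nat \<times> nat) set" where
  "inversions n mu = {(p, q). 1 \<le> p \<and> p < q \<and> q \<le> n \<and> mu q \<le> mu p}"

definition height_less :: "nat \<Rightarrow> (nat \<Rightarrow> nat) \<Rightarrow> (nat \<Rightarrow> nat) \<Rightarrow> bool" where
  "height_less n nu mu \<longleftrightarrow> ((\<Sum>i = 1..n. (nu i)\<^sup>2, card (inversions n nu)), (\<Sum>i = 1..n. (mu i)\<^sup>2, card (inversions n mu)))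
     \<in> less_than <*lex*> less_than"

lemma height_less_alt:
  "height_less n nu mu \<longleftrightarrow> (\<Sum>i = 1..n. (nu i)\<^sup>2) < (\<Sum>i = 1..n. (mu i)\<^sup>2) \<or>
     (\<Sum>i = 1..n. (nu i)\<^sup>2) = (\<Sum>i = 1..n. (mu i)\<^sup>2) \<and> card (inversions n nu) < card (inversions n mu)"
  by (auto simp: height_less_def)

lemma height_less_trans: "height_less n a b \<Longrightarrow> height_less n b c \<Longrightarrow> height_less n a c"
  by (auto simp: height_less_alt)

lemma height_less_irrefl: "\<not> height_less n a a"
  by (auto simp: height_less_alt)

lemma wfp_height_less: "wfp (height_less n)"
  unfolding wfp_def height_less_def
  by (rule wf_subset[OF wf_inv_image[of "less_than <*lex*> less_than"
        "\<lambda>mu. (\<Sum>i = 1..n. (mu i)\<^sup>2, card (inversions n mu))"]])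
     (auto simp: inv_image_def)

lemma finite_inversions [simp]: "finite (inversions n mu)"
  by (rule finite_subset[of _ "{1..n} \<times> {1..n}"]) (auto simp: inversions_def)

text \<open>
  Inversions of the swapped sequence are sent to inversions of \<open>\<mu>\<close> by applying the transposition
  where this preserves the order of the two positions, and by doing nothing elsewhere.  This is
  injective and misses \<open>(i, j)\<close>.
\<close>

lemma card_inversions_swap:
  assumes ij: "i \<in> {1..n}" "j \<in> {1..n}" "i < j" "mu j < mu i"
  shows "card (inversions n (mu \<circ> Transposition.transpose i j)) < card (inversions n mu)"
proof -
  let ?s = "Transposition.transpose i j" and ?nu = "mu \<circ> Transposition.transpose i j"
  define F where "F = (\<lambda>(p, q). if ?s p < ?s q then (?s p, ?s q) else (p, q))"
  have sp: "?s permutes {1..n}" using ij by (intro permutes_swap_id) auto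
  have inj: "?s a = ?s b \<longleftrightarrow> a = b" for a b by (metis transpose_involutory)
  have "F ` inversions n ?nu \<subseteq> inversions n mu - {(i, j)}"
  proof (rule image_subsetI)
    fix x assume x: "x \<in> inversions n ?nu"
    obtain p q where pq: "x = (p, q)" by (cases x)
    have b: "p \<in> {1..n}" "q \<in> {1..n}" "p < q" "mu (?s q) \<le> mu (?s p)"
      using x pq by (auto simp: inversions_def)
    have "F (p, q) \<in> inversions n mu - {(i, j)}"
    proof (cases "?s p < ?s q")
      case True
      have "?s p \<in> {1..n}" "?s q \<in> {1..n}" by (simp_all only: permutes_in_image[OF sp] b)
      moreover have "(?s p, ?s q) \<noteq> (i, j)"
        using b ij by (auto simp: transpose_def split: if_splits)
      ultimately show ?thesis using True b by (auto simp: F_def inversions_def)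
    next
      case False
      then have "(p = i \<and> q < j) \<or> (q = j \<and> i < p) \<or> (p = i \<and> q = j)"
        using b ij by (auto simp: transpose_def split: if_splits)
      then show ?thesis
        using False b ij by (auto simp: F_def inversions_def)
    qed
    then show "F x \<in> inversions n mu - {(i, j)}" by (simp add: pq)
  qed
  moreover have "inj_on F (inversions n ?nu)"
  proof (rule inj_onI)
    fix x y assume x: "x \<in> inversions n ?nu" and y: "y \<in> inversions n ?nu" and F: "F x = F y"
    obtain p q p' q' where xy: "x = (p, q)" "y = (p', q')" by (cases x, cases y)
    have "p < q" "p' < q'" using x y xy by (auto simp: inversions_def)
    then show "x = y"
      using F inj unfolding xy F_def by (auto split: if_splits)
  qed
  ultimately have "card (inversions n ?nu) \<le> card (inversions n mu - {(i, j)})"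
    by (intro card_inj_on_le) auto
  also have "\<dots> < card (inversions n mu)"
    by (rule card_Diff1_less[OF finite_inversions]) (use ij in \<open>auto simp: inversions_def\<close>)
  finally show ?thesis .
qed

lemma sum_two_points:
  fixes f g :: "nat \<Rightarrow> nat"
  assumes "i \<in> {1..n}" "j \<in> {1..n}" "i \<noteq> j"
  shows "(\<Sum>p = 1..n. f p) = f i + f j + (\<Sum>p\<in>{1..n} - {i, j}. f p)"
proof -
  have "{1..n} = insert i (insert j ({1..n} - {i, j}))" using assms by auto
  then have "(\<Sum>p = 1..n. f p) = (\<Sum>p\<in>insert i (insert j ({1..n} - {i, j})). f p)" by simp
  then show ?thesis using assms by simp
qed

lemma step_height_less:
  assumes "step n nu mu" shows "height_less n nu mu"
proof -
  obtain i j k where ij: "i \<in> {1..n}" "j \<in> {1..n}" "i \<noteq> j" "i < j \<or> k \<ge> 1" "mu j + k < mu i"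
    and nu: "nu = mu(i := mu j + k, j := mu i - k)"
    using assms unfolding step_def by blast
  show ?thesis
  proof (cases "k = 0")
    case True
    then have "nu = mu \<circ> Transposition.transpose i j" "i < j"
      using ij by (auto simp: nu fun_eq_iff transpose_def)
    moreover have "(\<Sum>p = 1..n. (mu (Transposition.transpose i j p))\<^sup>2) = (\<Sum>p = 1..n. (mu p)\<^sup>2)"
      using sum.permute[OF permutes_swap_id[of i "{1..n}" j], of "\<lambda>p. (mu p)\<^sup>2"] ij by (simp add: o_def)
    ultimately show ?thesis
      using card_inversions_swap[of i n j mu] ij True by (auto simp: height_less_alt)
  next
    case False
    define e where "e = mu i - (mu j + k)"
    have e: "mu i = mu j + k + e" "e > 0" using ij by (simp_all add: e_def)
    have rest: "(\<Sum>p\<in>{1..n} - {i, j}. (nu p)\<^sup>2) = (\<Sum>p\<in>{1..n} - {i, j}. (mu p)\<^sup>2)"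
      by (rule sum.cong) (auto simp: nu)
    have "nu i = mu j + k" "nu j = mu j + e" using ij(3) e(1) by (auto simp: nu)
    then have "(\<Sum>p = 1..n. (nu p)\<^sup>2) = (mu j + k)\<^sup>2 + (mu j + e)\<^sup>2 + (\<Sum>p\<in>{1..n} - {i, j}. (mu p)\<^sup>2)"
      unfolding sum_two_points[OF ij(1-3)] rest by simp
    moreover have "(\<Sum>p = 1..n. (mu p)\<^sup>2) = (mu j + k + e)\<^sup>2 + (mu j)\<^sup>2 + (\<Sum>p\<in>{1..n} - {i, j}. (mu p)\<^sup>2)"
      unfolding sum_two_points[OF ij(1-3)] e(1) ..
    moreover have "(mu j + k)\<^sup>2 + (mu j + e)\<^sup>2 < (mu j + k + e)\<^sup>2 + (mu j)\<^sup>2"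
      using False e by (simp add: power2_eq_square algebra_simps)
    ultimately show ?thesis by (simp add: height_less_alt)
  qed
qed

lemma steps_height_less: "(step n)\<^sup>+\<^sup>+ nu mu \<Longrightarrow> height_less n nu mu"
  by (induction rule: tranclp_induct) (blast intro: step_height_less height_less_trans)+

lemma perm_length_w_comp: "perm_length n (w_comp n mu) = card (inversions n mu)"
proof -
  have "{(i, j). 1 \<le> i \<and> i < j \<and> j \<le> n \<and> w_comp n mu i > w_comp n mu j} = inversions n mu"
    unfolding inversions_def by (intro Collect_cong) (auto simp: w_comp_less_iff)
  then show ?thesis by (simp add: perm_length_def)
qed

lemma bruhat_less_length: "bruhat_less n u v \<Longrightarrow> perm_length n u < perm_length n v"
  unfolding bruhat_less_def by (induction rule: tranclp_induct) auto

lemma sum_nonincr: "(\<Sum>i = 1..n. f (nonincr n mu i)) = (\<Sum>i = 1..n. f (mu i))"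
proof -
  let ?l = "rev (sort (map mu [1..<n+1]))"
  have "(\<Sum>i = 1..n. f (nonincr n mu i)) = (\<Sum>i<n. f (?l ! i))"
    by (rule sum.reindex_bij_witness[of _ "\<lambda>i. i + 1" "\<lambda>i. i - 1"]) (auto simp: nonincr_def)
  also have "\<dots> = sum_list (map f ?l)"
    by (simp only: sum_list_sum_nth length_map length_rev length_sort length_upt lessThan_atLeast0
        add_diff_cancel_right') (rule sum.cong, simp_all)
  also have "\<dots> = sum_list (map f (map mu [1..<n+1]))"
    by (simp only: sum_mset_sum_list[symmetric] mset_map mset_rev mset_sort)
  also have "\<dots> = (\<Sum>i = 1..n. f (mu i))"
    by (simp only: map_map o_def sum_list_distinct_conv_sum_set[OF distinct_upt] set_upt
        Suc_eq_plus1[symmetric] atLeastLessThanSuc_atLeastAtMost)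
  finally show ?thesis .
qed

lemma nonincr_antimono:
  assumes "1 \<le> i" "i < n" shows "nonincr n mu (i + 1) \<le> nonincr n mu i"
proof -
  have "sorted_wrt (\<ge>) (rev (sort (map mu [1..<n+1])))"
    by (simp add: sorted_wrt_rev)
  then have "rev (sort (map mu [1..<n+1])) ! i \<le> rev (sort (map mu [1..<n+1])) ! (i - 1)"
    by (rule sorted_wrt_nth_less[where P="\<lambda>a b. b \<le> a", simplified]) (use assms in auto)
  then show ?thesis using assms by (simp add: nonincr_def)
qed

text \<open>
  If \<open>\<mu>\<^sup>+ - \<nu>\<^sup>+ = \<delta>\<close> then the sums of squares differ by \<open>\<Sum>\<delta>\<^sup>2 + 2\<Sum>\<nu>\<^sup>+\<delta>\<close>, and the cross term is
  \<open>2\<Sum>\<^sub>i k\<^sub>i (\<nu>\<^sup>+\<^sub>i - \<nu>\<^sup>+\<^sub>i\<^sub>+\<^sub>1) \<ge> 0\<close> because \<open>\<nu>\<^sup>+\<close> is non-increasing.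
\<close>

lemma dom_less_squares:
  assumes "dom_less n (nonincr n nu) (nonincr n mu)"
  shows "(\<Sum>i = 1..n. (nu i)\<^sup>2) < (\<Sum>i = 1..n. (mu i)\<^sup>2)"
proof -
  let ?N = "\<lambda>p. int (nonincr n nu p)" and ?P = "\<lambda>p. int (nonincr n mu p)"
  obtain k :: "nat \<Rightarrow> int" where k: "\<And>i. k i \<ge> 0" and
    D: "\<And>p. p \<in> {1..n} \<Longrightarrow> ?P p - ?N p = (\<Sum>i = 1..<n. k i * ((if p = i then 1 else 0) - (if p = i + 1 then 1 else 0)))"
    and ne: "nonincr n nu \<noteq> nonincr n mu"
    using assms unfolding dom_less_def by blast
  have "(\<Sum>p = 1..n. ?N p * (?P p - ?N p)) =
      (\<Sum>p = 1..n. \<Sum>i = 1..<n. ?N p * (k i * ((if p = i then 1 else 0) - (if p = i + 1 then 1 else 0))))"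
    by (intro sum.cong) (simp_all add: D sum_distrib_left)
  also have "\<dots> = (\<Sum>i = 1..<n. \<Sum>p = 1..n. ?N p * (k i * ((if p = i then 1 else 0) - (if p = i + 1 then 1 else 0))))"
    by (rule sum.swap)
  also have "\<dots> = (\<Sum>i = 1..<n. k i * (?N i - ?N (i + 1)))"
  proof (rule sum.cong)
    fix i assume i: "i \<in> {1..<n}"
    have "(\<Sum>p = 1..n. ?N p * (k i * ((if p = i then 1 else 0) - (if p = i + 1 then 1 else 0)))) =
      (\<Sum>p = 1..n. (if p = i then k i * ?N i else 0) - (if p = i + 1 then k i * ?N (i + 1) else 0))"
      by (intro sum.cong) auto
    also have "\<dots> = k i * ?N i - k i * ?N (i + 1)"
      using i by (simp add: sum_subtractf)
    also have "\<dots> = k i * (?N i - ?N (i + 1))" by (simp add: right_diff_distrib)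
    finally show "(\<Sum>p = 1..n. ?N p * (k i * ((if p = i then 1 else 0) - (if p = i + 1 then 1 else 0)))) =
      k i * (?N i - ?N (i + 1))" .
  qed simp
  also have "\<dots> \<ge> 0"
    using k nonincr_antimono[of _ n nu] by (intro sum_nonneg mult_nonneg_nonneg) auto
  finally have cross: "(\<Sum>p = 1..n. ?N p * (?P p - ?N p)) \<ge> 0" .
  obtain p where p: "nonincr n nu p \<noteq> nonincr n mu p" using ne by auto
  then have "p \<in> {1..n}" by (auto simp: nonincr_def split: if_splits)
  with p have "(\<Sum>p = 1..n. (?P p - ?N p)\<^sup>2) > 0"
    by (intro sum_pos2[of _ p]) auto
  moreover have "(\<Sum>p = 1..n. (?P p)\<^sup>2) = (\<Sum>p = 1..n. (?N p)\<^sup>2) + (\<Sum>p = 1..n. (?P p - ?N p)\<^sup>2)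
      + 2 * (\<Sum>p = 1..n. ?N p * (?P p - ?N p))"
    unfolding sum_distrib_left sum.distrib[symmetric]
    by (intro sum.cong) (auto simp: power2_eq_square algebra_simps)
  ultimately have "(\<Sum>p = 1..n. (?N p)\<^sup>2) < (\<Sum>p = 1..n. (?P p)\<^sup>2)"
    using cross by linarith
  moreover have "(\<Sum>p = 1..n. (?N p)\<^sup>2) = int (\<Sum>i = 1..n. (nu i)\<^sup>2)"
    using sum_nonincr[of "\<lambda>x. (int x)\<^sup>2" n nu] by simp
  moreover have "(\<Sum>p = 1..n. (?P p)\<^sup>2) = int (\<Sum>i = 1..n. (mu i)\<^sup>2)"
    using sum_nonincr[of "\<lambda>x. (int x)\<^sup>2" n mu] by simp
  ultimately show ?thesis by linarith
qed

lemma comp_less_height_less: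
  assumes "comp_less n nu mu" shows "height_less n nu mu"
  using assms unfolding comp_less_def
proof
  assume "nonincr n nu = nonincr n mu \<and> bruhat_less n (w_comp n nu) (w_comp n mu)"
  then show ?thesis
    using bruhat_less_length[of n "w_comp n nu" "w_comp n mu"]
      sum_nonincr[of "\<lambda>x. x\<^sup>2" n nu] sum_nonincr[of "\<lambda>x. x\<^sup>2" n mu]
    by (simp add: perm_length_w_comp height_less_alt)
qed (use dom_less_squares in \<open>auto simp: height_less_alt\<close>)

section \<open>Standard tableaux\<close>

lemma boxes_down_closed:
  assumes "is_multipartition r n lam" "(l, p, q) \<in> boxes lam" "p' \<le> p" "q' \<le> q"
  shows "(l, p', q') \<in> boxes lam"
proof -
  have l: "l < length lam" and p: "p < length (lam ! l)" and q: "q < lam ! l ! p"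
    using assms(2) by (auto simp: boxes_def)
  have "sorted_wrt (\<ge>) (lam ! l)"
    using assms(1) l by (auto simp: is_multipartition_def is_partition_def)
  then have "lam ! l ! p \<le> lam ! l ! p'"
    using assms(3) p by (cases "p' = p") (auto simp: sorted_wrt_iff_nth_less)
  then show ?thesis using l p q assms(3,4) by (auto simp: boxes_def)
qed

lemma SYT_less:
  assumes "T \<in> SYT n lam" "i \<in> {1..n}" "j \<in> {1..n}" "T i = (l, p, q)" "T j = (l, p', q')"
    "p = p' \<and> q < q' \<or> q = q' \<and> p < p'"
  shows "i < j"
  using assms unfolding SYT_def by fastforce

lemma SYT_box:
  assumes "T \<in> SYT n lam" "b \<in> boxes lam"
  obtains j where "j \<in> {1..n}" "T j = b"
proof -
  have "b \<in> T ` {1..n}" using assms unfolding SYT_def bij_betw_def by blast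
  then show ?thesis using that by blast
qed

lemma SYT_in_boxes: "T \<in> SYT n lam \<Longrightarrow> i \<in> {1..n} \<Longrightarrow> T i \<in> boxes lam"
  unfolding SYT_def bij_betw_def by blast

lemma SYT_inj: "T \<in> SYT n lam \<Longrightarrow> i \<in> {1..n} \<Longrightarrow> j \<in> {1..n} \<Longrightarrow> T i = T j \<Longrightarrow> i = j"
  unfolding SYT_def bij_betw_def inj_on_def by blast

text \<open>A box with entry 1 has neither a left nor an upper neighbour, so it lies in a corner.\<close>

lemma ct_first:
  assumes lam: "is_multipartition r n lam" and T: "T \<in> SYT n lam" and n: "n \<ge> 1"
  shows "ct (T 1) = 0"
proof -
  obtain l p q where b: "T 1 = (l, p, q)" by (cases "T 1") auto
  have box: "(l, p, q) \<in> boxes lam" using SYT_in_boxes[OF T, of 1] n b by simp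
  have "q = 0"
  proof (rule ccontr)
    assume "q \<noteq> 0"
    have "(l, p, q - 1) \<in> boxes lam" by (rule boxes_down_closed[OF lam box]) auto
    then obtain j where j: "j \<in> {1..n}" "T j = (l, p, q - 1)" using SYT_box[OF T] by blast
    then have "j < 1" using SYT_less[OF T j(1) _ j(2) b] n \<open>q \<noteq> 0\<close> by simp
    then show False using j by simp
  qed
  moreover have "p = 0"
  proof (rule ccontr)
    assume "p \<noteq> 0"
    have "(l, p - 1, q) \<in> boxes lam" by (rule boxes_down_closed[OF lam box]) auto
    then obtain j where j: "j \<in> {1..n}" "T j = (l, p - 1, q)" using SYT_box[OF T] by blast
    then have "j < 1" using SYT_less[OF T j(1) _ j(2) b] n \<open>p \<noteq> 0\<close> by simp
    then show False using j by simp
  qed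
  ultimately show ?thesis by (simp add: b ct_def del: One_nat_def)
qed

text \<open>Two boxes on one diagonal have a further box between them, so their entries are not
  consecutive.\<close>

lemma ct_adjacent_neq:
  assumes lam: "is_multipartition r n lam" and T: "T \<in> SYT n lam" and i: "i \<in> {1..<n}"
    and beta: "beta (T i) = beta (T (i + 1))"
  shows "ct (T i) \<noteq> ct (T (i + 1))"
proof
  assume ct: "ct (T i) = ct (T (i + 1))"
  have i1: "i \<in> {1..n}" "i + 1 \<in> {1..n}" using i by auto
  obtain l p q where b: "T i = (l, p, q)" by (cases "T i") auto
  obtain p' q' where b': "T (i + 1) = (l, p', q')" using beta b by (cases "T (i + 1)") auto
  have diag: "int q - int p = int q' - int p'" using ct b b' by (simp add: ct_def)
  have box: "(l, p, q) \<in> boxes lam" "(l, p', q') \<in> boxes lam"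
    using SYT_in_boxes[OF T i1(1)] SYT_in_boxes[OF T i1(2)] b b' by auto
  consider "p = p'" | "p < p'" | "p' < p" by linarith
  then show False
  proof cases
    case 1
    then have "T i = T (i + 1)" using diag b b' by simp
    then show False using SYT_inj[OF T i1] by simp
  next
    case 2
    then have "q < q'" using diag by simp
    have "(l, p, q') \<in> boxes lam" by (rule boxes_down_closed[OF lam box(2)]) (use 2 in auto)
    then obtain j where j: "j \<in> {1..n}" "T j = (l, p, q')" using SYT_box[OF T] by blast
    have "i < j" using SYT_less[OF T i1(1) j(1) b j(2)] \<open>q < q'\<close> by simp
    moreover have "j < i + 1" using SYT_less[OF T j(1) i1(2) j(2) b'] 2 by simp
    ultimately show False by simp
  next
    case 3
    then have "q' < q" using diag by simp
    have "(l, p', q) \<in> boxes lam" by (rule boxes_down_closed[OF lam box(1)]) (use 3 in auto)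
    then obtain j where j: "j \<in> {1..n}" "T j = (l, p', q)" using SYT_box[OF T] by blast
    have "i + 1 < j" using SYT_less[OF T i1(2) j(1) b' j(2)] \<open>q' < q\<close> by simp
    moreover have "j < i" using SYT_less[OF T j(1) i1(1) j(2) b] 3 by simp
    ultimately show False by simp
  qed
qed

lemma swap_entries_SYT:
  assumes T: "T \<in> SYT n lam" and i: "i \<in> {1..<n}" and beta: "beta (T i) \<noteq> beta (T (i + 1))"
  shows "swap_entries i T \<in> SYT n lam"
proof -
  let ?s = "s_perm i"
  have s: "?s permutes {1..n}" by (rule s_perm_permutes[OF i])
  have eq: "swap_entries i T = T \<circ> ?s" by (simp add: swap_entries_def s_perm_def)
  have "T \<circ> ?s \<in> extensional {1..n}"
    using T permutes_not_in[OF s] by (auto simp: SYT_def extensional_def)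
  moreover have "bij_betw (T \<circ> ?s) {1..n} (boxes lam)"
    using T bij_betw_trans[OF permutes_imp_bij[OF s]] by (auto simp: SYT_def)
  moreover have "a < b" if ab: "a \<in> {1..n}" "b \<in> {1..n}" "beta ((T \<circ> ?s) a) = beta ((T \<circ> ?s) b)"
      "row ((T \<circ> ?s) a) = row ((T \<circ> ?s) b) \<and> column ((T \<circ> ?s) a) < column ((T \<circ> ?s) b) \<or>
       column ((T \<circ> ?s) a) = column ((T \<circ> ?s) b) \<and> row ((T \<circ> ?s) a) < row ((T \<circ> ?s) b)" for a b
  proof -
    have "?s a \<in> {1..n}" "?s b \<in> {1..n}" by (simp_all only: permutes_in_image[OF s] ab)
    then have lt: "?s a < ?s b" using T ab unfolding SYT_def o_def by blast
    have "\<not> (a = i \<and> b = i + 1)" "\<not> (a = i + 1 \<and> b = i)"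
      using ab(3) beta by (auto simp: s_perm_def)
    then show "a < b" using lt s_perm_less_iff by blast
  qed
  ultimately show ?thesis unfolding eq SYT_def by blast
qed

section \<open>The product formula under the two moves\<close>

definition lin_fac :: "(nat \<Rightarrow> int) \<Rightarrow> (nat \<Rightarrow> int) \<Rightarrow> nat \<Rightarrow> nat \<Rightarrow> nat \<Rightarrow> 'r::finite ratfun" where
  "lin_fac a b k i j = kappa * of_nat k - (d (b i) - d (b j)) - c0 * of_nat CARD('r) * of_int (a i - a j)"

definition pair_fac :: "(nat \<Rightarrow> int) \<Rightarrow> (nat \<Rightarrow> int) \<Rightarrow> nat \<Rightarrow> nat \<Rightarrow> nat \<Rightarrow> 'r::finite ratfun" where
  "pair_fac a b k i j =
    ((lin_fac a b k i j)\<^sup>2 - (c0 * of_nat CARD('r))\<^sup>2) / (lin_fac a b k i j)\<^sup>2"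

definition pair_prod :: "(nat \<Rightarrow> int) \<Rightarrow> (nat \<Rightarrow> int) \<Rightarrow> nat \<Rightarrow> nat \<Rightarrow> nat \<Rightarrow> 'r::finite ratfun" where
  "pair_prod a b m i j = (\<Prod>k | 1 \<le> k \<and> k \<le> m \<and> [int k = b i - b j] (mod int CARD('r)). pair_fac a b k i j)"

definition ev_fac :: "(nat \<Rightarrow> int) \<Rightarrow> (nat \<Rightarrow> int) \<Rightarrow> nat \<Rightarrow> nat \<Rightarrow> 'r::finite ratfun" where
  "ev_fac a b i k = kappa * of_nat k - (d (b i) - d (b i - int k)) - c0 * of_nat CARD('r) * of_int (a i)"

definition norm_formula :: "nat \<Rightarrow> (nat \<Rightarrow> nat) \<Rightarrow> (nat \<Rightarrow> int) \<Rightarrow> (nat \<Rightarrow> int) \<Rightarrow> 'r::finite ratfun" where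
  "norm_formula n mu a b =
     (\<Prod>i = 1..n. \<Prod>k = 1..mu i. ev_fac a b i k)
     * (\<Prod>(i, j) | 1 \<le> i \<and> i < j \<and> j \<le> n \<and> mu i > mu j. pair_prod a b (mu i - mu j) i j)
     * (\<Prod>(i, j) | 1 \<le> i \<and> i < j \<and> j \<le> n \<and> int (mu i) < int (mu j) - 1. pair_prod a b (mu j - mu i - 1) j i)"

text \<open>The natural subtraction gives the empty product 1 when \<open>\<mu>\<^sub>j - \<mu>\<^sub>i\<close> is 0 or 1.\<close>

definition pair_term :: "(nat \<Rightarrow> nat) \<Rightarrow> (nat \<Rightarrow> int) \<Rightarrow> (nat \<Rightarrow> int) \<Rightarrow> nat \<Rightarrow> nat \<Rightarrow> 'r::finite ratfun" where
  "pair_term mu a b i j =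
    (if mu i > mu j then pair_prod a b (mu i - mu j) i j else pair_prod a b (mu j - mu i - 1) j i)"

definition pairs :: "nat \<Rightarrow> (nat \<times> nat) set" where
  "pairs n = {(i, j). 1 \<le> i \<and> i < j \<and> j \<le> n}"

lemma finite_pairs [simp]: "finite (pairs n)"
  by (rule finite_subset[of _ "{1..n} \<times> {1..n}"]) (auto simp: pairs_def)

lemma pair_prod_0 [simp]: "(pair_prod a b 0 i j :: 'r::finite ratfun) = 1"
proof -
  have "{k. 1 \<le> k \<and> k \<le> 0 \<and> [int k = b i - b j] (mod int CARD('r))} = {}" by auto
  then show ?thesis unfolding pair_prod_def by (simp only: prod.empty)
qed

lemma pair_prod_Suc:
  "(pair_prod a b (Suc m) i j :: 'r::finite ratfun) =
     (if [int (Suc m) = b i - b j] (mod int CARD('r)) then pair_fac a b (Suc m) i j else 1) * pair_prod a b m i j"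
proof -
  let ?A = "{k. 1 \<le> k \<and> k \<le> m \<and> [int k = b i - b j] (mod int CARD('r))}"
  have fin: "finite ?A" by (rule finite_subset[of _ "{1..m}"]) auto
  have "{k. 1 \<le> k \<and> k \<le> Suc m \<and> [int k = b i - b j] (mod int CARD('r))} =
      (if [int (Suc m) = b i - b j] (mod int CARD('r)) then insert (Suc m) ?A else ?A)"
    by (auto simp: le_Suc_eq)
  then show ?thesis using fin by (auto simp: pair_prod_def)
qed

text \<open>
  The two products over pairs are disjoint: a pair not counted by either of them has an empty range
  of \<open>k\<close>.  So every pair contributes one term, and the terms can be permuted.
\<close>

lemma norm_formula_alt:
  "(norm_formula n mu a b :: 'r::finite ratfun) =
    (\<Prod>i = 1..n. \<Prod>k = 1..mu i. ev_fac a b i k) * (\<Prod>(i, j)\<in>pairs n. pair_term mu a b i j)"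
proof -
  have "(\<Prod>(i, j) | 1 \<le> i \<and> i < j \<and> j \<le> n \<and> mu i > mu j. pair_prod a b (mu i - mu j) i j :: 'r ratfun) =
      (\<Prod>(i, j)\<in>pairs n. if mu i > mu j then pair_prod a b (mu i - mu j) i j else 1)"
    by (rule prod.mono_neutral_cong_left) (auto simp: pairs_def[symmetric] split: if_splits, auto simp: pairs_def)
  moreover have "(\<Prod>(i, j) | 1 \<le> i \<and> i < j \<and> j \<le> n \<and> int (mu i) < int (mu j) - 1. pair_prod a b (mu j - mu i - 1) j i :: 'r ratfun) =
      (\<Prod>(i, j)\<in>pairs n. if int (mu i) < int (mu j) - 1 then pair_prod a b (mu j - mu i - 1) j i else 1)"
    by (rule prod.mono_neutral_cong_left) (auto simp: pairs_def[symmetric] split: if_splits, auto simp: pairs_def)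
  moreover have "(\<Prod>(i, j)\<in>pairs n. if mu i > mu j then pair_prod a b (mu i - mu j) i j else 1) *
      (\<Prod>(i, j)\<in>pairs n. if int (mu i) < int (mu j) - 1 then pair_prod a b (mu j - mu i - 1) j i else 1) =
      (\<Prod>(i, j)\<in>pairs n. pair_term mu a b i j :: 'r ratfun)"
    unfolding prod.distrib[symmetric]
  proof (rule prod.cong[OF refl], clarify)
    fix i j
    show "(if mu i > mu j then pair_prod a b (mu i - mu j) i j else 1) *
        (if int (mu i) < int (mu j) - 1 then pair_prod a b (mu j - mu i - 1) j i else 1) =
        (pair_term mu a b i j :: 'r ratfun)"
    proof (cases "mu i > mu j \<or> int (mu i) < int (mu j) - 1")
      case False
      then have "mu j - mu i - 1 = 0" by linarith
      then show ?thesis using False by (auto simp: pair_term_def)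
    qed (auto simp: pair_term_def)
  qed
  ultimately show ?thesis by (simp add: norm_formula_def mult.assoc)
qed

lemma norm_formula_zero: "norm_formula n (\<lambda>_. 0) a b = 1"
  by (simp add: norm_formula_alt pair_term_def)

text \<open>
  Only the pair \<open>(i, i + 1)\<close> is affected.  It passes to the product over \<open>\<mu>\<^sub>i > \<mu>\<^sub>j\<close>, where
  its range of \<open>k\<close> is longer than before by \<open>k = \<mu>\<^sub>i\<^sub>+\<^sub>1 - \<mu>\<^sub>i\<close>.
\<close>

lemma norm_formula_s_perm:
  assumes i: "i \<in> {1..<n}" and lt: "mu i < mu (i + 1)"
  shows "(norm_formula n (mu \<circ> s_perm i) (a \<circ> s_perm i) (b \<circ> s_perm i) :: 'r::finite ratfun) =
    (if [int (mu (i + 1) - mu i) = b (i + 1) - b i] (mod int CARD('r))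
     then pair_fac a b (mu (i + 1) - mu i) (i + 1) i else 1) * norm_formula n mu a b"
proof -
  let ?s = "s_perm i"
  let ?E = "\<lambda>(p, q). pair_term mu a b p q :: 'r ratfun"
  let ?E' = "\<lambda>(p, q). pair_term (mu \<circ> ?s) (a \<circ> ?s) (b \<circ> ?s) p q :: 'r ratfun"
  have pp: "pair_prod (a \<circ> ?s) (b \<circ> ?s) m p q = (pair_prod a b m (?s p) (?s q) :: 'r ratfun)" for m p q
    by (simp add: pair_prod_def pair_fac_def lin_fac_def)
  have E': "?E' (p, q) = ?E (?s p, ?s q)" for p q
    by (simp add: pair_term_def pp)
  have single: "(\<Prod>j = 1..n. \<Prod>k = 1..(mu \<circ> ?s) j. ev_fac (a \<circ> ?s) (b \<circ> ?s) j k) =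
      (\<Prod>j = 1..n. \<Prod>k = 1..mu j. ev_fac a b j k :: 'r ratfun)"
    using prod.permute[OF s_perm_permutes[OF i], of "\<lambda>j. \<Prod>k = 1..mu j. ev_fac a b j k :: 'r ratfun"]
    by (simp add: o_def ev_fac_def)
  have mem: "(i, i + 1) \<in> pairs n" using i by (auto simp: pairs_def)
  have rest: "prod ?E' (pairs n - {(i, i + 1)}) = prod ?E (pairs n - {(i, i + 1)})"
  proof (rule prod.reindex_bij_witness[of _ "\<lambda>(p, q). (?s p, ?s q)" "\<lambda>(p, q). (?s p, ?s q)"])
    fix x assume x: "x \<in> pairs n - {(i, i + 1)}"
    obtain p q where [simp]: "x = (p, q)" by (cases x)
    have pq: "p \<in> {1..n}" "q \<in> {1..n}" "p < q" "\<not> (p = i \<and> q = i + 1)" using x by (auto simp: pairs_def)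
    then have "?s p < ?s q" using s_perm_less_iff[of p i q] by simp
    moreover have "?s p \<in> {1..n}" "?s q \<in> {1..n}"
      by (simp_all only: permutes_in_image[OF s_perm_permutes[OF i]] pq)
    moreover have "\<not> (?s p = i \<and> ?s q = i + 1)"
      using pq by (auto simp: s_perm_def transpose_def split: if_splits)
    ultimately show "(case x of (p, q) \<Rightarrow> (?s p, ?s q)) \<in> pairs n - {(i, i + 1)}"
      by (auto simp: pairs_def)
    then show "(case x of (p, q) \<Rightarrow> (?s p, ?s q)) \<in> pairs n - {(i, i + 1)}" .
    show "?E (case x of (p, q) \<Rightarrow> (?s p, ?s q)) = ?E' x"
      using E' by simp
  qed auto
  have Suc: "Suc (mu (i + 1) - mu i - 1) = mu (i + 1) - mu i" using lt by simp
  have "?E' (i, i + 1) = ?E (i + 1, i)"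
    using E'[of i "i + 1"] by (simp add: s_perm_def)
  also have "\<dots> = pair_prod a b (Suc (mu (i + 1) - mu i - 1)) (i + 1) i"
    unfolding Suc using lt by (simp add: pair_term_def)
  also have "\<dots> = (if [int (mu (i + 1) - mu i) = b (i + 1) - b i] (mod int CARD('r))
     then pair_fac a b (mu (i + 1) - mu i) (i + 1) i else 1) * ?E (i, i + 1)"
    unfolding pair_prod_Suc unfolding Suc using lt by (simp add: pair_term_def)
  finally have spec: "?E' (i, i + 1) = \<dots>" .
  show ?thesis
    unfolding norm_formula_alt single prod.remove[OF finite_pairs mem, of ?E'] prod.remove[OF finite_pairs mem, of ?E]
      rest spec by (simp only: mult_ac)
qed

text \<open>
  A pair \<open>(1, j)\<close> becomes \<open>(j - 1, n)\<close>, and since the entry \<open>\<mu>\<^sub>1\<close> has grown by 1 on the way, its term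
  moves to the other product with the same range of \<open>k\<close>.  Only the linear factor with
  \<open>k = \<mu>\<^sub>1 + 1\<close> is new.
\<close>

lemma norm_formula_phi_comp:
  assumes n: "n \<ge> 1"
  shows "(norm_formula n (phi_comp n mu) (a \<circ> unrot n) (b \<circ> unrot n) :: 'r::finite ratfun) =
    ev_fac a b 1 (mu 1 + 1) * norm_formula n mu a b"
proof -
  let ?c = "rot n" and ?u = "unrot n"
  let ?E = "\<lambda>(p, q). pair_term mu a b p q :: 'r ratfun"
  let ?E' = "\<lambda>(p, q). pair_term (phi_comp n mu) (a \<circ> ?u) (b \<circ> ?u) p q :: 'r ratfun"
  have pp: "pair_prod (a \<circ> ?u) (b \<circ> ?u) m p q = (pair_prod a b m (?u p) (?u q) :: 'r ratfun)" for m p q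
    by (simp add: pair_prod_def pair_fac_def lin_fac_def)
  have "(\<Prod>j = 1..n. \<Prod>k = 1..phi_comp n mu j. ev_fac (a \<circ> ?u) (b \<circ> ?u) j k :: 'r ratfun) =
      (\<Prod>j = 1..n. \<Prod>k = 1..phi_comp n mu (?c j). ev_fac a b j k)"
    using prod.permute[OF rot_permutes[OF n], of "\<lambda>j. \<Prod>k = 1..phi_comp n mu j. ev_fac (a \<circ> ?u) (b \<circ> ?u) j k :: 'r ratfun"]
    by (simp add: o_def ev_fac_def unrot_rot[OF n])
  also have "\<dots> = (\<Prod>j = 1..n. (if j = 1 then ev_fac a b 1 (mu 1 + 1) else 1) * (\<Prod>k = 1..mu j. ev_fac a b j k))"
    by (intro prod.cong refl) (simp add: phi_comp_rot[OF n])
  also have "\<dots> = ev_fac a b 1 (mu 1 + 1) * (\<Prod>j = 1..n. \<Prod>k = 1..mu j. ev_fac a b j k)"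
    using n by (simp add: prod.distrib)
  finally have single: "(\<Prod>j = 1..n. \<Prod>k = 1..phi_comp n mu j. ev_fac (a \<circ> ?u) (b \<circ> ?u) j k :: 'r ratfun) = \<dots>" .
  have "prod ?E' (pairs n) = prod ?E (pairs n)"
  proof (rule prod.reindex_bij_witness[of _
        "\<lambda>(p, q). if p = 1 then (q - 1, n) else (p - 1, q - 1)"
        "\<lambda>(p, q). if q = n then (1, p + 1) else (p + 1, q + 1)"])
    fix x assume x: "x \<in> pairs n"
    obtain p q where [simp]: "x = (p, q)" by (cases x)
    have pq: "1 \<le> p" "p < q" "q \<le> n" using x by (auto simp: pairs_def)
    show "(case case x of (p, q) \<Rightarrow> if q = n then (1, p + 1) else (p + 1, q + 1) of
        (p, q) \<Rightarrow> if p = 1 then (q - 1, n) else (p - 1, q - 1)) = x" using pq by auto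
    show "(case x of (p, q) \<Rightarrow> if q = n then (1, p + 1) else (p + 1, q + 1)) \<in> pairs n"
      using pq by (auto simp: pairs_def)
    show "?E (case x of (p, q) \<Rightarrow> if q = n then (1, p + 1) else (p + 1, q + 1)) = ?E' x"
      using pq by (auto simp: pair_term_def pp phi_comp_def unrot_def)
  next
    fix x assume x: "x \<in> pairs n"
    obtain p q where [simp]: "x = (p, q)" by (cases x)
    have pq: "1 \<le> p" "p < q" "q \<le> n" using x by (auto simp: pairs_def)
    show "(case case x of (p, q) \<Rightarrow> if p = 1 then (q - 1, n) else (p - 1, q - 1) of
        (p, q) \<Rightarrow> if q = n then (1, p + 1) else (p + 1, q + 1)) = x" using pq by auto
    show "(case x of (p, q) \<Rightarrow> if p = 1 then (q - 1, n) else (p - 1, q - 1)) \<in> pairs n"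
      using pq by (auto simp: pairs_def)
  qed
  then show ?thesis unfolding norm_formula_alt single by (simp only: mult_ac)
qed

lemma ev_fac_kappa: "has_kappa_coeff (ev_fac a b i k :: 'r::finite ratfun) (of_nat k)"
  unfolding ev_fac_def by (rule has_kappa_coeff_affine)

lemma lin_fac_kappa: "has_kappa_coeff (lin_fac a b k i j :: 'r::finite ratfun) (of_nat k)"
  unfolding lin_fac_def by (rule has_kappa_coeff_affine)

lemma ev_fac_neq: "k \<noteq> l \<Longrightarrow> (ev_fac a b i k :: 'r::finite ratfun) \<noteq> ev_fac a' b' i' l"
  using has_kappa_coeff_unique[of "ev_fac a b i k :: 'r ratfun" "of_nat k" "of_nat l"]
    ev_fac_kappa[of a b i k, where 'r='r] ev_fac_kappa[of a' b' i' l, where 'r='r] by auto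

lemma cnj_ev_fac [simp]: "cnj_ratfun (ev_fac a b i k) = ev_fac a b i k"
  by (simp add: ev_fac_def cnj_ratfun_diff cnj_ratfun_mult)

lemma ev_fac_nz: "k \<noteq> 0 \<Longrightarrow> (ev_fac a b i k :: 'r::finite ratfun) \<noteq> 0"
  using has_kappa_coeff_unique[OF ev_fac_kappa[of a b i k, where 'r='r], of 0] has_kappa_coeff_0 by auto

lemma lin_fac_neq_c0:
  assumes "k \<noteq> 0"
  shows "(lin_fac a b k i j :: 'r::finite ratfun) \<noteq> 0"
    and "(lin_fac a b k i j :: 'r::finite ratfun)\<^sup>2 \<noteq> (c0 * of_nat m)\<^sup>2"
proof -
  have 0: "has_kappa_coeff (c0 * of_nat m :: 'r ratfun) 0"
    using has_kappa_coeff_c0_mult[of m 1, where 'r='r] by simp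
  have ne: "(lin_fac a b k i j :: 'r ratfun) \<noteq> x" if "has_kappa_coeff x 0" for x
    using that has_kappa_coeff_unique[OF lin_fac_kappa[of a b k i j, where 'r='r], of 0] assms by auto
  show "(lin_fac a b k i j :: 'r ratfun) \<noteq> 0" by (rule ne[OF has_kappa_coeff_0])
  show "(lin_fac a b k i j :: 'r ratfun)\<^sup>2 \<noteq> (c0 * of_nat m)\<^sup>2"
    using ne[OF 0] ne[OF has_kappa_coeff_uminus[OF 0, simplified]] by (auto simp: power2_eq_iff)
qed

lemma pair_fac_nz: "k \<noteq> 0 \<Longrightarrow> (pair_fac a b k i j :: 'r::finite ratfun) \<noteq> 0"
  using lin_fac_neq_c0[of k a b i j, where 'r='r] by (simp add: pair_fac_def)

lemma norm_formula_nz: "(norm_formula n mu a b :: 'r::finite ratfun) \<noteq> 0"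
proof -
  have pp: "(pair_prod a b m i j :: 'r ratfun) \<noteq> 0" for m i j
    by (induction m) (auto simp: pair_prod_Suc pair_fac_nz)
  then show ?thesis
    unfolding norm_formula_alt
    by (auto simp: ev_fac_nz pair_term_def prod_zero_iff[OF finite_pairs] split: if_splits)
qed

text \<open>
  The congruence makes the terms \<open>d\<^bsub>b - \<mu> - 1\<^esub>\<close> of the two eigenvalues cancel; what remains is the
  linear form that occurs in the pair products.
\<close>

lemma ev_fac_diff:
  assumes "mu i < mu j" "[b i - int (mu i) = b j - int (mu j)] (mod int CARD('r))"
  shows "(ev_fac a b i (mu i + 1) - ev_fac a b j (mu j + 1) :: 'r::finite ratfun) = - lin_fac a b (mu j - mu i) j i"
proof -
  have "[b i - int (mu i + 1) = b j - int (mu j + 1)] (mod int CARD('r))"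
    using cong_diff[OF assms(2) cong_refl[of 1]] by (simp add: algebra_simps)
  then have "(d (b i - int (mu i + 1)) :: 'r ratfun) = d (b j - int (mu j + 1))"
    by (rule d_cong)
  then show ?thesis
    using assms(1) by (simp add: ev_fac_def lin_fac_def of_nat_diff algebra_simps)
qed

(* The index conditions contain 1; rewriting it to Suc 0 would keep the rules below from matching. *)
declare One_nat_def [simp del]

section \<open>Modules with a contravariant form\<close>

text \<open>
  The structure that the computation uses: a subspace \<open>V\<close> of a vector space on which \<open>x\<^sub>i\<close>, \<open>y\<^sub>i\<close>, the
  permutation matrices (by \<open>S p\<close>) and the powers \<open>\<zeta>\<^sub>i\<^sup>l\<close> (by \<open>Z i l\<close>) act with the relations of the
  rational Cherednik algebra, a contravariant form on \<open>V\<close>, and vectors \<open>v T\<close> that transform like the basis of the Specht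
  module and are killed by the \<open>y\<^sub>i\<close>.  The operators are linear on the whole space, but the
  relations are required on \<open>V\<close> only.
\<close>

locale cherednik_module =
  fixes n :: nat and lam :: "nat list list"
    and V :: "'m::ab_group_add set"
    and sc :: "'r::finite ratfun \<Rightarrow> 'm \<Rightarrow> 'm"
    and X Y :: "nat \<Rightarrow> 'm \<Rightarrow> 'm"
    and S :: "(nat \<Rightarrow> nat) \<Rightarrow> 'm \<Rightarrow> 'm"
    and Z :: "nat \<Rightarrow> int \<Rightarrow> 'm \<Rightarrow> 'm"
    and H :: "'m \<Rightarrow> 'm \<Rightarrow> 'r ratfun"
    and v :: "tableau \<Rightarrow> 'm"
  assumes n_pos: "n \<ge> 1"
    and lam: "is_multipartition CARD('r) n lam"
    and vector_space_sc: "vector_space sc"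
    and V_0 [simp]: "0 \<in> V"
    and V_add [simp]: "u \<in> V \<Longrightarrow> w \<in> V \<Longrightarrow> u + w \<in> V"
    and V_sc [simp]: "u \<in> V \<Longrightarrow> sc c u \<in> V"
    and V_X [simp]: "i \<in> {1..n} \<Longrightarrow> u \<in> V \<Longrightarrow> X i u \<in> V"
    and V_Y [simp]: "i \<in> {1..n} \<Longrightarrow> u \<in> V \<Longrightarrow> Y i u \<in> V"
    and V_S [simp]: "p permutes {1..n} \<Longrightarrow> u \<in> V \<Longrightarrow> S p u \<in> V"
    and V_Z [simp]: "i \<in> {1..n} \<Longrightarrow> u \<in> V \<Longrightarrow> Z i l u \<in> V"
    and X_lin: "Vector_Spaces.linear sc sc (X i)"
    and Y_lin: "Vector_Spaces.linear sc sc (Y i)"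
    and S_lin: "Vector_Spaces.linear sc sc (S p)"
    and Z_lin: "Vector_Spaces.linear sc sc (Z i l)"
    and S_S: "p permutes {1..n} \<Longrightarrow> q permutes {1..n} \<Longrightarrow> u \<in> V \<Longrightarrow> S p (S q u) = S (p \<circ> q) u"
    and S_id: "u \<in> V \<Longrightarrow> S id u = u"
    and Z_Z: "i \<in> {1..n} \<Longrightarrow> u \<in> V \<Longrightarrow> Z i l (Z i m u) = Z i (l + m) u"
    and Z_0: "i \<in> {1..n} \<Longrightarrow> u \<in> V \<Longrightarrow> Z i 0 u = u"
    and S_Z: "p permutes {1..n} \<Longrightarrow> i \<in> {1..n} \<Longrightarrow> u \<in> V \<Longrightarrow> S p (Z i l u) = Z (p i) l (S p u)"
    and X_X: "i \<in> {1..n} \<Longrightarrow> j \<in> {1..n} \<Longrightarrow> u \<in> V \<Longrightarrow> X i (X j u) = X j (X i u)"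
    and S_X: "p permutes {1..n} \<Longrightarrow> i \<in> {1..n} \<Longrightarrow> u \<in> V \<Longrightarrow> S p (X i u) = X (p i) (S p u)"
    and S_Y: "p permutes {1..n} \<Longrightarrow> i \<in> {1..n} \<Longrightarrow> u \<in> V \<Longrightarrow> S p (Y i u) = Y (p i) (S p u)"
    and Z_X_same: "i \<in> {1..n} \<Longrightarrow> u \<in> V \<Longrightarrow>
      Z i l (X i u) = sc (cconst (zeta CARD('r) powi (- l))) (X i (Z i l u))"
    and Z_X_other: "i \<in> {1..n} \<Longrightarrow> j \<in> {1..n} \<Longrightarrow> i \<noteq> j \<Longrightarrow> u \<in> V \<Longrightarrow> Z i l (X j u) = X j (Z i l u)"
    and Y_X_other: "i \<in> {1..n} \<Longrightarrow> j \<in> {1..n} \<Longrightarrow> i \<noteq> j \<Longrightarrow> u \<in> V \<Longrightarrow>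
      Y i (X j u) = X j (Y i u) + sc c0 (\<Sum>l<CARD('r). sc (cconst (zeta CARD('r) powi (- int l)))
        (Z i (int l) (S (Transposition.transpose i j) (Z i (- int l) u))))"
    and Y_X_same: "i \<in> {1..n} \<Longrightarrow> u \<in> V \<Longrightarrow>
      Y i (X i u) = X i (Y i u) + sc kappa u
        - (\<Sum>j<CARD('r). sc (d (int j) - d (int j - 1)) (sc (1 / of_nat CARD('r))
            (\<Sum>l<CARD('r). sc (cconst (zeta CARD('r) powi (- int (l * j)))) (Z i (int l) u))))
        - sc c0 (\<Sum>j\<in>{1..n} - {i}. \<Sum>l<CARD('r).
            Z i (int l) (S (Transposition.transpose i j) (Z i (- int l) u)))"
    and H_add: "u \<in> V \<Longrightarrow> w \<in> V \<Longrightarrow> x \<in> V \<Longrightarrow> H (u + w) x = H u x + H w x"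
    and H_sc: "u \<in> V \<Longrightarrow> w \<in> V \<Longrightarrow> H (sc c u) w = c * H u w"
    and H_herm: "u \<in> V \<Longrightarrow> w \<in> V \<Longrightarrow> H w u = cnj_ratfun (H u w)"
    and H_X: "i \<in> {1..n} \<Longrightarrow> u \<in> V \<Longrightarrow> w \<in> V \<Longrightarrow> H (X i u) w = H u (Y i w)"
    and H_S: "p permutes {1..n} \<Longrightarrow> u \<in> V \<Longrightarrow> w \<in> V \<Longrightarrow> H (S p u) (S p w) = H u w"
    and H_Z: "i \<in> {1..n} \<Longrightarrow> u \<in> V \<Longrightarrow> w \<in> V \<Longrightarrow> H (Z i l u) (Z i l w) = H u w"
    and V_v [simp]: "T \<in> SYT n lam \<Longrightarrow> v T \<in> V"
    and H_v: "T \<in> SYT n lam \<Longrightarrow> H (v T) (v T) = 1"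
    and Y_v: "i \<in> {1..n} \<Longrightarrow> T \<in> SYT n lam \<Longrightarrow> Y i (v T) = 0"
    and Z_v: "i \<in> {1..n} \<Longrightarrow> T \<in> SYT n lam \<Longrightarrow>
      Z i 1 (v T) = sc (cconst (zeta CARD('r) ^ beta (T i))) (v T)"
    and S_v_diff: "i \<in> {1..<n} \<Longrightarrow> T \<in> SYT n lam \<Longrightarrow> beta (T i) \<noteq> beta (T (i + 1)) \<Longrightarrow>
      S (s_perm i) (v T) = v (swap_entries i T)"
    and S_v_same: "i \<in> {1..<n} \<Longrightarrow> T \<in> SYT n lam \<Longrightarrow> beta (T i) = beta (T (i + 1)) \<Longrightarrow>
      S (s_perm i) (v T) = sc (1 / of_int (ct (T (i + 1)) - ct (T i))) (v T) +
        (if swap_entries i T \<in> SYT n lam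
         then sc (cconst (of_real (sqrt (1 - 1 / (of_int (ct (T (i + 1)) - ct (T i)))\<^sup>2)))) (v (swap_entries i T))
         else 0)"
begin

sublocale vs: vector_space sc by (rule vector_space_sc)

abbreviation zt :: "int \<Rightarrow> 'r ratfun" where "zt l \<equiv> cconst (zeta CARD('r) powi l)"

lemma lin_simps:
  assumes "Vector_Spaces.linear sc sc f"
  shows "f (u + w) = f u + f w" "f (u - w) = f u - f w" "f (- u) = - f u" "f 0 = 0"
    "f (sc c u) = sc c (f u)" "f (sum g A) = (\<Sum>i\<in>A. f (g i))"
proof -
  interpret Vector_Spaces.linear sc sc f by fact
  show "f (u + w) = f u + f w" "f (u - w) = f u - f w" "f (- u) = - f u" "f 0 = 0"
    "f (sc c u) = sc c (f u)" "f (sum g A) = (\<Sum>i\<in>A. f (g i))"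
    by (simp_all add: add diff neg zero scale sum)
qed

lemmas X_simps = lin_simps[OF X_lin]
lemmas Y_simps = lin_simps[OF Y_lin]
lemmas S_simps = lin_simps[OF S_lin]
lemmas Z_simps = lin_simps[OF Z_lin]
lemmas op_simps = X_simps Y_simps S_simps Z_simps

lemma sc_simps [simp]: "sc 1 u = u" "sc 0 u = 0" "sc a (sc b u) = sc (a * b) u" "sc a 0 = 0"
  by simp_all

lemma V_uminus [simp]: "u \<in> V \<Longrightarrow> - u \<in> V"
  using V_sc[of u "-1"] by (simp add: vs.scale_minus_left)

lemma V_diff [simp]: "u \<in> V \<Longrightarrow> w \<in> V \<Longrightarrow> u - w \<in> V"
  using V_add[of u "- w"] by simp

lemma V_sum [simp]: "(\<And>i. i \<in> A \<Longrightarrow> f i \<in> V) \<Longrightarrow> sum f A \<in> V"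
  by (induction A rule: infinite_finite_induct) auto

lemma H_add_right: "u \<in> V \<Longrightarrow> w \<in> V \<Longrightarrow> x \<in> V \<Longrightarrow> H x (u + w) = H x u + H x w"
  using H_herm[of "u + w" x] H_herm[of u x] H_herm[of w x] by (simp add: H_add cnj_ratfun_add)

lemma H_sc_right: "u \<in> V \<Longrightarrow> w \<in> V \<Longrightarrow> H w (sc c u) = cnj_ratfun c * H w u"
  using H_herm[of "sc c u" w] H_herm[of u w] by (simp add: H_sc cnj_ratfun_mult)

lemma H_0_left: "w \<in> V \<Longrightarrow> H 0 w = 0"
  using H_sc[of 0 w 0] by simp

lemma H_0_right: "w \<in> V \<Longrightarrow> H w 0 = 0"
  using H_sc_right[of 0 w 0] by simp

lemma H_sum_left: "(\<And>i. i \<in> A \<Longrightarrow> f i \<in> V) \<Longrightarrow> w \<in> V \<Longrightarrow> H (sum f A) w = (\<Sum>i\<in>A. H (f i) w)"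
  by (induction A rule: infinite_finite_induct) (auto simp: H_add H_0_left)

lemma H_sum_right: "(\<And>i. i \<in> A \<Longrightarrow> f i \<in> V) \<Longrightarrow> w \<in> V \<Longrightarrow> H w (sum f A) = (\<Sum>i\<in>A. H w (f i))"
  by (induction A rule: infinite_finite_induct) (auto simp: H_add_right H_0_right)

lemma H_Y: "i \<in> {1..n} \<Longrightarrow> u \<in> V \<Longrightarrow> w \<in> V \<Longrightarrow> H (Y i u) w = H u (X i w)"
  using H_X[of i w u] H_herm[of "X i w" u] H_herm[of w "Y i u"] by simp

lemma H_Z_adj: "i \<in> {1..n} \<Longrightarrow> u \<in> V \<Longrightarrow> w \<in> V \<Longrightarrow> H (Z i l u) w = H u (Z i (- l) w)"
  using H_Z[of i u "Z i (- l) w" l] by (simp add: Z_Z Z_0)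

text \<open>
  \<open>R i j l\<close> is the reflection \<open>\<zeta>\<^sub>i\<^sup>l s\<^sub>i\<^sub>j \<zeta>\<^sub>i\<^sup>-\<^sup>l\<close>, \<open>jm i\<close> is the element \<open>\<phi>\<^sub>i\<close> and \<open>z i\<close> is \<open>z\<^sub>i\<close>.
\<close>

definition R :: "nat \<Rightarrow> nat \<Rightarrow> nat \<Rightarrow> 'm \<Rightarrow> 'm" where
  "R i j l u = Z i (int l) (S (Transposition.transpose i j) (Z i (- int l) u))"

definition RR :: "nat \<Rightarrow> nat \<Rightarrow> 'm \<Rightarrow> 'm" where
  "RR i j u = (\<Sum>l<CARD('r). R i j l u)"

definition jm :: "nat \<Rightarrow> 'm \<Rightarrow> 'm" where
  "jm i u = (\<Sum>j = 1..<i. RR i j u)"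

definition z :: "nat \<Rightarrow> 'm \<Rightarrow> 'm" where
  "z i u = Y i (X i u) + sc c0 (jm i u)"

lemma R_simps:
  "R i j l (u + w) = R i j l u + R i j l w" "R i j l (sc c u) = sc c (R i j l u)"
  by (simp_all add: R_def op_simps)

lemma RR_simps: "RR i j (u + w) = RR i j u + RR i j w" "RR i j (sc c u) = sc c (RR i j u)"
  by (simp_all add: RR_def R_simps sum.distrib vs.scale_sum_right)

lemma jm_simps: "jm i (u + w) = jm i u + jm i w" "jm i (sc c u) = sc c (jm i u)"
  by (simp_all add: jm_def RR_simps sum.distrib vs.scale_sum_right)

lemma z_simps: "z i (u + w) = z i u + z i w" "z i (sc c u) = sc c (z i u)"
  by (simp_all add: z_def jm_simps op_simps vs.scale_right_distrib mult.commute)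

lemma transpose_permutes: "i \<in> {1..n} \<Longrightarrow> j \<in> {1..n} \<Longrightarrow> Transposition.transpose i j permutes {1..n}"
  by (rule permutes_swap_id)

lemma V_R [simp]: "i \<in> {1..n} \<Longrightarrow> j \<in> {1..n} \<Longrightarrow> u \<in> V \<Longrightarrow> R i j l u \<in> V"
  by (simp add: R_def transpose_permutes)

lemma V_RR [simp]: "i \<in> {1..n} \<Longrightarrow> j \<in> {1..n} \<Longrightarrow> u \<in> V \<Longrightarrow> RR i j u \<in> V"
  unfolding RR_def by (intro V_sum V_R)

lemma V_jm [simp]: "i \<in> {1..n} \<Longrightarrow> u \<in> V \<Longrightarrow> jm i u \<in> V"
  unfolding jm_def by (intro V_sum V_RR) auto

lemma V_z [simp]: "i \<in> {1..n} \<Longrightarrow> u \<in> V \<Longrightarrow> z i u \<in> V"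
  unfolding z_def by (intro V_add V_sc V_Y V_X V_jm)

lemma H_R: "i \<in> {1..n} \<Longrightarrow> j \<in> {1..n} \<Longrightarrow> u \<in> V \<Longrightarrow> w \<in> V \<Longrightarrow> H (R i j l u) w = H u (R i j l w)"
  using H_S[OF transpose_permutes[of i j], of "Z i (- int l) u" "S (Transposition.transpose i j) (Z i (- int l) w)"]
  by (simp add: R_def H_Z_adj transpose_permutes S_S S_id)

lemma H_jm:
  assumes "i \<in> {1..n}" "u \<in> V" "w \<in> V" shows "H (jm i u) w = H u (jm i w)"
proof -
  have "H (RR i j u) w = H u (RR i j w)" if "j \<in> {1..<i}" for j
    unfolding RR_def using assms that by (simp add: H_sum_left H_sum_right H_R)
  then show ?thesis
    unfolding jm_def using assms by (subst H_sum_left, auto, subst H_sum_right, auto)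
qed

lemma H_z: "i \<in> {1..n} \<Longrightarrow> u \<in> V \<Longrightarrow> w \<in> V \<Longrightarrow> H (z i u) w = H u (z i w)"
  by (simp add: z_def H_add H_add_right H_sc H_sc_right H_jm H_Y H_X)

lemma S_R:
  assumes p: "p permutes {1..n}" and ij: "i \<in> {1..n}" "j \<in> {1..n}" and u: "u \<in> V"
  shows "S p (R i j l u) = R (p i) (p j) l (S p u)"
proof -
  have pij: "p i \<in> {1..n}" "p j \<in> {1..n}" using permutes_in_image[OF p] ij by blast+
  have "p \<circ> Transposition.transpose i j = Transposition.transpose (p i) (p j) \<circ> p"
    using permutes_inj[OF p] by (auto simp: fun_eq_iff transpose_def dest: injD)
  then show ?thesis
    unfolding R_def using p ij pij u transpose_permutes[of i j] transpose_permutes[of "p i" "p j"]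
    by (simp add: S_Z S_S)
qed

lemma S_RR:
  assumes p: "p permutes {1..n}" and ij: "i \<in> {1..n}" "j \<in> {1..n}" and u: "u \<in> V"
  shows "S p (RR i j u) = RR (p i) (p j) (S p u)"
  unfolding RR_def by (simp add: S_simps S_R[OF assms])

lemma R_X_other:
  assumes "i \<in> {1..n}" "j \<in> {1..n}" "k \<in> {1..n}" "k \<noteq> i" "k \<noteq> j" "u \<in> V"
  shows "R i j l (X k u) = X k (R i j l u)"
proof -
  have "Transposition.transpose i j k = k" using assms by (auto simp: transpose_def)
  then show ?thesis
    unfolding R_def using assms transpose_permutes[of i j]
    by (simp add: Z_X_other S_X)
qed

lemma R_X_left:
  assumes "i \<in> {1..n}" "j \<in> {1..n}" "i \<noteq> j" "u \<in> V"
  shows "R i j l (X i u) = sc (zt (int l)) (X j (R i j l u))"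
  unfolding R_def using assms transpose_permutes[of i j]
  by (simp add: Z_X_same Z_X_other S_X op_simps)

lemma RR_X_other:
  assumes "i \<in> {1..n}" "j \<in> {1..n}" "k \<in> {1..n}" "k \<noteq> i" "k \<noteq> j" "u \<in> V"
  shows "RR i j (X k u) = X k (RR i j u)"
  unfolding RR_def by (simp add: R_X_other[OF assms] X_simps)

subsection \<open>Weight vectors\<close>

text \<open>The \<open>d\<close>-part \<open>\<Sum>\<^sub>j (d\<^sub>j - d\<^sub>j\<^sub>-\<^sub>1) e\<^sub>i\<^sub>j\<close> of the commutator of \<open>y\<^sub>i\<close> and \<open>x\<^sub>i\<close>.\<close>

definition D :: "nat \<Rightarrow> 'm \<Rightarrow> 'm" where
  "D i u = (\<Sum>j<CARD('r). sc (d (int j) - d (int j - 1)) (sc (1 / of_nat CARD('r))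
            (\<Sum>l<CARD('r). sc (zt (- int (l * j))) (Z i (int l) u))))"

lemma zt_add: "zt k * zt l = zt (k + l)"
  by (simp add: power_int_add flip: cconst_mult)

lemma zt_minus_eq: "zt (- k) = inverse (zt k)"
  by (simp add: power_int_minus cconst_inverse)

lemma sum_zt: "(\<Sum>l<CARD('r). zt (int l * k)) = (if int CARD('r) dvd k then of_nat CARD('r) else 0)"
  using arg_cong[OF sum_zeta_powi[of "CARD('r)" k], of "cconst :: complex \<Rightarrow> 'r ratfun"]
  by (simp add: cconst_sum cconst_of_nat split: if_splits)

text \<open>
  On a vector on which \<open>\<zeta>\<^sub>i\<close> acts by \<open>\<zeta>\<^sup>m\<close>, the idempotent \<open>e\<^sub>i\<^sub>j\<close> is 1 if \<open>j = m\<close> modulo \<open>r\<close>, and 0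
  otherwise.
\<close>

lemma D_weight:
  assumes "\<And>l. Z i l u = sc (zt (l * m)) u"
  shows "D i u = sc (d m - d (m - 1)) u"
proof -
  define j0 where "j0 = nat (m mod int CARD('r))"
  have j0: "j0 < CARD('r)" "[int j0 = m] (mod int CARD('r))"
    by (auto simp: j0_def nat_less_iff cong_def)
  have inner: "(\<Sum>l<CARD('r). sc (zt (- int (l * j))) (Z i (int l) u)) =
      sc (if j = j0 then of_nat CARD('r) else 0) u" if "j < CARD('r)" for j
  proof -
    have "(\<Sum>l<CARD('r). sc (zt (- int (l * j))) (Z i (int l) u)) = (\<Sum>l<CARD('r). sc (zt (int l * (m - int j))) u)"
      unfolding assms sc_simps zt_add by (simp add: algebra_simps)
    also have "\<dots> = sc (if int CARD('r) dvd m - int j then of_nat CARD('r) else 0) u"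
      by (simp only: sum_zt flip: vs.scale_sum_left)
    also have "int CARD('r) dvd m - int j \<longleftrightarrow> j = j0"
    proof
      assume "int CARD('r) dvd m - int j"
      then have "[m = int j] (mod int CARD('r))" by (simp only: cong_iff_dvd_diff)
      from cong_trans[OF cong_sym[OF this] cong_sym[OF j0(2)]]
      have "[int j = int j0] (mod int CARD('r))" .
      then show "j = j0" using that j0(1) by (simp add: cong_def)
    qed (use j0(2) in \<open>simp add: cong_iff_dvd_diff dvd_diff_commute\<close>)
    finally show ?thesis .
  qed
  have "D i u = (\<Sum>j<CARD('r). if j = j0 then sc (d (int j0) - d (int j0 - 1)) u else 0)"
    unfolding D_def by (rule sum.cong) (simp_all only: inner lessThan_iff, simp)
  also have "\<dots> = sc (d (int j0) - d (int j0 - 1)) u" using j0(1) by simp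
  also have "(d (int j0) :: 'r ratfun) = d m" using j0(2) by (rule d_cong)
  also have "(d (int j0 - 1) :: 'r ratfun) = d (m - 1)" by (rule d_cong) (use j0(2) in \<open>intro cong_diff cong_refl\<close>)
  finally show ?thesis .
qed

text \<open>
  The action of \<open>\<zeta>\<^sub>i\<close> is recorded by an exponent, which matters only modulo \<open>r\<close>.
\<close>

definition wt :: "'m \<Rightarrow> (nat \<Rightarrow> 'r ratfun) \<Rightarrow> (nat \<Rightarrow> int) \<Rightarrow> bool" where
  "wt u ev m \<longleftrightarrow> u \<in> V \<and> (\<forall>i\<in>{1..n}. z i u = sc (ev i) u) \<and>
     (\<forall>i\<in>{1..n}. \<forall>l. Z i l u = sc (zt (l * m i)) u)"

subsection \<open>The operator \<open>\<Phi>\<close>\<close>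

definition Phi :: "'m \<Rightarrow> 'm" where
  "Phi u = X n (S (rot n) u)"

declare n_pos [simp]

lemma n_in: "n \<in> {1..n}" "1 \<in> {1..n}"
  by auto

lemma rot_perm [simp]: "rot n permutes {1..n}"
  by (rule rot_permutes[OF n_pos])

lemma rot_1: "rot n 1 = n"
  by (simp add: rot_def)

lemma S_rot_YX: "u \<in> V \<Longrightarrow> S (rot n) (Y 1 (X 1 u)) = Y n (X n (S (rot n) u))"
  using S_Y[OF rot_perm n_in(2), of "X 1 u"] S_X[OF rot_perm n_in(2), of u] by (simp add: rot_1)

lemma Phi_simps: "Phi (u + w) = Phi u + Phi w" "Phi (sc c u) = sc c (Phi u)"
  by (simp_all add: Phi_def op_simps)

lemma V_Phi [simp]: "u \<in> V \<Longrightarrow> Phi u \<in> V"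
  unfolding Phi_def by (intro V_X V_S n_in rot_perm)

text \<open>
  Moving \<open>y\<^sub>i\<close> past \<open>x\<^sub>n\<close> produces the sum of reflections in the positions \<open>i\<close> and \<open>n\<close>, which is the
  one summand of the conjugate of \<open>\<phi>\<^sub>i\<^sub>+\<^sub>1\<close> that is missing in \<open>\<phi>\<^sub>i\<close>.
\<close>

lemma z_Phi:
  assumes i: "i \<in> {1..<n}" and u: "u \<in> V"
  shows "z i (Phi u) = Phi (z (i + 1) u)"
proof -
  let ?w = "S (rot n) u"
  have in1: "i \<in> {1..n}" "i + 1 \<in> {1..n}" "i \<noteq> n" using i by auto
  have w: "?w \<in> V" using u by simp
  have rot_i: "rot n (i + 1) = i" using i by (simp add: rot_def)
  have "Y i (X i (X n ?w)) = Y i (X n (X i ?w))"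
    using in1 w by (simp add: X_X)
  also have "\<dots> = X n (Y i (X i ?w)) + sc c0 (\<Sum>l<CARD('r). sc (zt (- int l)) (R i n l (X i ?w)))"
    unfolding R_def using in1 w by (subst Y_X_other) (auto intro!: V_X)
  also have "(\<Sum>l<CARD('r). sc (zt (- int l)) (R i n l (X i ?w))) = X n (RR i n ?w)"
    unfolding RR_def X_simps
    by (intro sum.cong refl) (simp add: R_X_left[OF in1(1) n_in(1) in1(3) w] zt_minus_eq)
  finally have 1: "Y i (X i (X n ?w)) = X n (Y i (X i ?w)) + sc c0 (X n (RR i n ?w))" .
  have 2: "jm i (X n ?w) = X n (jm i ?w)"
    unfolding jm_def X_simps
    by (intro sum.cong refl RR_X_other) (use i w in auto)
  have "S (rot n) (jm (i + 1) u) = (\<Sum>j = 1..<i + 1. RR i (rot n j) ?w)"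
    unfolding jm_def S_simps
    by (intro sum.cong refl, subst S_RR) (use i u rot_i in auto)
  also have "\<dots> = RR i (rot n 1) ?w + (\<Sum>j = 2..<i + 1. RR i (rot n j) ?w)"
    using i by (subst sum.atLeast_Suc_lessThan) (auto simp: numeral_2_eq_2 One_nat_def)
  also have "(\<Sum>j = 2..<i + 1. RR i (rot n j) ?w) = (\<Sum>j = 1..<i. RR i j ?w)"
    by (rule sum.reindex_bij_witness[of _ "\<lambda>j. j + 1" "\<lambda>j. j - 1"]) (use i in \<open>auto simp: rot_def\<close>)
  finally have 3: "S (rot n) (jm (i + 1) u) = RR i n ?w + jm i ?w"
    by (simp only: jm_def[of i] rot_1)
  have 4: "S (rot n) (Y (i + 1) (X (i + 1) u)) = Y i (X i ?w)"
    using S_Y[OF rot_perm in1(2)] S_X[OF rot_perm in1(2)] in1 u by (simp only: rot_i V_X)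
  show ?thesis
    unfolding z_def Phi_def 1 2 op_simps 3 4 by (simp add: vs.scale_right_distrib)
qed

text \<open>For \<open>i = n\<close> the sum over \<open>j \<noteq> i\<close> in the commutator of \<open>y\<^sub>i\<close> and \<open>x\<^sub>i\<close> cancels against \<open>\<phi>\<^sub>n\<close>.\<close>

lemma z_n_Phi:
  assumes u: "u \<in> V"
  shows "z n (Phi u) = Phi (z 1 u) + sc kappa (Phi u) - D n (Phi u)"
proof -
  let ?w = "S (rot n) u"
  have w: "?w \<in> V" using u by simp
  have "{1..n} - {n} = {1..<n}" by auto
  then have "Y n (X n (X n ?w)) = X n (Y n (X n ?w)) + sc kappa (X n ?w) - D n (X n ?w) - sc c0 (jm n (X n ?w))"
    using Y_X_same[OF n_in(1) V_X[OF n_in(1) w]] unfolding D_def jm_def RR_def R_def by simp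
  then show ?thesis
    unfolding z_def Phi_def by (simp add: jm_def S_rot_YX[OF u])
qed

lemma wt_Phi:
  assumes wt: "wt u ev m"
  shows "wt (Phi u) (\<lambda>i. if i < n then ev (i + 1) else ev 1 + kappa - (d (m 1 - 1) - d (m 1 - 2)))
    (\<lambda>i. if i < n then m (i + 1) else m 1 - 1)"
proof -
  have u: "u \<in> V" and ev: "\<And>i. i \<in> {1..n} \<Longrightarrow> z i u = sc (ev i) u"
    and Zu: "\<And>i l. i \<in> {1..n} \<Longrightarrow> Z i l u = sc (zt (l * m i)) u"
    using wt by (auto simp: wt_def)
  let ?w = "S (rot n) u"
  have w: "?w \<in> V" using u by simp
  have Z1: "Z i l (Phi u) = sc (zt (l * m (i + 1))) (Phi u)" if i: "i \<in> {1..n}" "i < n" for i l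
  proof -
    have i1: "i + 1 \<in> {1..n}" and "rot n (i + 1) = i" using i by (auto simp: rot_def)
    then have "Z i l ?w = sc (zt (l * m (i + 1))) ?w"
      using S_Z[OF rot_perm i1 u, of l] Zu[OF i1] by (simp add: op_simps)
    then show ?thesis
      unfolding Phi_def using i w Z_X_other[of i n ?w l] by (simp add: op_simps)
  qed
  have Zn: "Z n l (Phi u) = sc (zt (l * (m 1 - 1))) (Phi u)" for l
  proof -
    have "rot n 1 = n" by (simp add: rot_def)
    then have "Z n l ?w = sc (zt (l * m 1)) ?w"
      using S_Z[OF rot_perm n_in(2) u, of l] Zu[OF n_in(2)] by (simp add: op_simps)
    then show ?thesis
      unfolding Phi_def using w by (simp add: Z_X_same op_simps zt_add algebra_simps)
  qed
  have "z n (Phi u) = sc (ev 1 + kappa - (d (m 1 - 1) - d (m 1 - 2))) (Phi u)"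
    unfolding z_n_Phi[OF u] D_weight[of n, OF Zn] ev[OF n_in(2)] Phi_simps
    by (simp add: vs.scale_left_distrib vs.scale_left_diff_distrib)
  moreover have "z i (Phi u) = sc (ev (i + 1)) (Phi u)" if "i \<in> {1..n}" "i < n" for i
    using z_Phi[of i u] ev[of "i + 1"] that u by (simp add: Phi_simps)
  ultimately show ?thesis
    unfolding wt_def using u Z1 Zn by (auto simp: not_less dest: le_antisym)
qed

text \<open>The adjoint of \<open>\<Phi>\<close> is \<open>y\<^sub>1\<close> times a permutation, and \<open>\<Phi>\<^sup>*\<Phi> = y\<^sub>1x\<^sub>1 = z\<^sub>1\<close>.\<close>

lemma H_Phi:
  assumes "wt u ev m" "cnj_ratfun (ev 1) = ev 1"
  shows "H (Phi u) (Phi u) = ev 1 * H u u"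
proof -
  have u: "u \<in> V" and ev: "z 1 u = sc (ev 1) u" using assms(1) by (auto simp: wt_def)
  have w: "S (rot n) u \<in> V" using u by simp
  have "H (Phi u) (Phi u) = H (S (rot n) u) (Y n (X n (S (rot n) u)))"
    unfolding Phi_def using w by (intro H_X) (auto intro: V_X)
  also have "Y n (X n (S (rot n) u)) = S (rot n) (Y 1 (X 1 u))"
    by (simp only: S_rot_YX[OF u])
  also have "H (S (rot n) u) (S (rot n) (Y 1 (X 1 u))) = H u (Y 1 (X 1 u))"
    using u by (intro H_S) auto
  also have "Y 1 (X 1 u) = sc (ev 1) u"
    using ev by (simp add: z_def jm_def)
  finally show ?thesis using u assms(2) by (simp add: H_sc_right)
qed

subsection \<open>The intertwiners of the adjacent transpositions\<close>

lemma s_perm_perm [simp]: "i \<in> {1..<n} \<Longrightarrow> s_perm i permutes {1..n}"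
  by (rule s_perm_permutes)

lemma S_s_S_s: "i \<in> {1..<n} \<Longrightarrow> u \<in> V \<Longrightarrow> S (s_perm i) (S (s_perm i) u) = u"
  using S_S[OF s_perm_perm s_perm_perm, of i i u] by (simp add: S_id)

lemma s_perm_simps [simp]: "s_perm i i = i + 1" "s_perm i (i + 1) = i"
  by (simp_all add: s_perm_def)

lemma s_perm_other: "j \<noteq> i \<Longrightarrow> j \<noteq> i + 1 \<Longrightarrow> s_perm i j = j"
  by (simp add: s_perm_def transpose_def)

lemma S_jm_s:
  assumes i: "i \<in> {1..<n}" and u: "u \<in> V"
  shows "S (s_perm i) (jm i u) = jm (i + 1) (S (s_perm i) u) - RR (i + 1) i (S (s_perm i) u)"
proof -
  have "S (s_perm i) (jm i u) = (\<Sum>j = 1..<i. RR (i + 1) j (S (s_perm i) u))"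
    unfolding jm_def S_simps
    by (intro sum.cong refl, subst S_RR) (use i u in \<open>auto simp: s_perm_other\<close>)
  moreover have "{1..<i + 1} = insert i {1..<i}" using i by auto
  ultimately show ?thesis by (simp add: jm_def)
qed

lemma S_jm_other:
  assumes i: "i \<in> {1..<n}" and u: "u \<in> V" and j: "j \<in> {1..n}" "j \<noteq> i" "j \<noteq> i + 1"
  shows "S (s_perm i) (jm j u) = jm j (S (s_perm i) u)"
proof -
  have "S (s_perm i) (jm j u) = (\<Sum>k = 1..<j. RR j (s_perm i k) (S (s_perm i) u))"
    unfolding jm_def S_simps
    by (intro sum.cong refl, subst S_RR) (use i u j in \<open>auto simp: s_perm_other\<close>)
  also have "\<dots> = (\<Sum>k = 1..<j. RR j k (S (s_perm i) u))"
    by (rule sum.reindex_bij_witness[of _ "s_perm i" "s_perm i"])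
      (use i j in \<open>auto simp: s_perm_def transpose_def\<close>)
  finally show ?thesis by (simp add: jm_def)
qed

lemma S_YX:
  assumes i: "i \<in> {1..<n}" and u: "u \<in> V" and j: "j \<in> {1..n}"
  shows "S (s_perm i) (Y j (X j u)) = Y (s_perm i j) (X (s_perm i j) (S (s_perm i) u))"
  using S_Y[OF s_perm_perm[OF i] j] S_X[OF s_perm_perm[OF i] j] u j by (simp only: V_X)

text \<open>
  Conjugation by \<open>s\<^sub>i\<close> exchanges \<open>z\<^sub>i\<close> and \<open>z\<^sub>i\<^sub>+\<^sub>1\<close> up to the summand of \<open>\<phi>\<^sub>i\<^sub>+\<^sub>1\<close> for the pair
  \<open>(i + 1, i)\<close>.
\<close>

lemma z_s:
  assumes i: "i \<in> {1..<n}" and u: "u \<in> V"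
  shows "z (i + 1) (S (s_perm i) u) = S (s_perm i) (z i u) + sc c0 (RR (i + 1) i (S (s_perm i) u))"
    and "z i (S (s_perm i) u) = S (s_perm i) (z (i + 1) u) - sc c0 (S (s_perm i) (RR (i + 1) i u))"
    and "j \<in> {1..n} \<Longrightarrow> j \<noteq> i \<Longrightarrow> j \<noteq> i + 1 \<Longrightarrow> z j (S (s_perm i) u) = S (s_perm i) (z j u)"
proof -
  have in1: "i \<in> {1..n}" "i + 1 \<in> {1..n}" using i by auto
  have 1: "z (i + 1) (S (s_perm i) u) = S (s_perm i) (z i u) + sc c0 (RR (i + 1) i (S (s_perm i) u))" if "u \<in> V" for u
    unfolding z_def S_simps S_jm_s[OF i that] S_YX[OF i that in1(1)]
    by (simp add: vs.scale_right_diff_distrib)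
  from 1[OF u] show "z (i + 1) (S (s_perm i) u) = S (s_perm i) (z i u) + sc c0 (RR (i + 1) i (S (s_perm i) u))" .
  show "z i (S (s_perm i) u) = S (s_perm i) (z (i + 1) u) - sc c0 (S (s_perm i) (RR (i + 1) i u))"
    using arg_cong[OF 1[of "S (s_perm i) u"], of "S (s_perm i)"] i in1 u
    by (simp add: S_s_S_s op_simps)
  show "z j (S (s_perm i) u) = S (s_perm i) (z j u)" if "j \<in> {1..n}" "j \<noteq> i" "j \<noteq> i + 1"
    unfolding z_def S_simps S_jm_other[OF i u that] S_YX[OF i u that(1)] s_perm_other[OF that(2,3)] ..
qed

lemma R_s:
  assumes i: "i \<in> {1..<n}" and u: "u \<in> V"
  shows "R (i + 1) i l (S (s_perm i) u) = Z (i + 1) (int l) (Z i (- int l) u)"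
proof -
  have in1: "i \<in> {1..n}" "i + 1 \<in> {1..n}" using i by auto
  have "Z (i + 1) (- int l) (S (s_perm i) u) = S (s_perm i) (Z i (- int l) u)"
    using S_Z[OF s_perm_perm[OF i] in1(1) u] by simp
  then show ?thesis
    unfolding R_def using in1 u i S_s_S_s[OF i, of "Z i (- int l) u"]
    by (simp add: s_perm_def transpose_commute[of "i + 1" i])
qed

text \<open>The scalar by which \<open>\<Sum>\<^sub>l t\<^bsub>\<zeta>\<^sub>i\<^esub>\<^sup>l t\<^bsub>\<zeta>\<^sub>j\<^esub>\<^sup>-\<^sup>l\<close> acts where \<open>\<zeta>\<^sub>i\<close> and \<open>\<zeta>\<^sub>j\<close> have exponents \<open>a\<close> and \<open>b\<close>.\<close>

definition rho :: "int \<Rightarrow> int \<Rightarrow> 'r ratfun" where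
  "rho a b = (if [a = b] (mod int CARD('r)) then of_nat CARD('r) else 0)"

lemma RR_s_weight:
  assumes i: "i \<in> {1..<n}" and u: "u \<in> V"
    and Zu: "\<And>i l. i \<in> {1..n} \<Longrightarrow> Z i l u = sc (zt (l * m i)) u"
  shows "RR (i + 1) i (S (s_perm i) u) = sc (rho (m i) (m (i + 1))) u"
proof -
  have in1: "i \<in> {1..n}" "i + 1 \<in> {1..n}" using i by auto
  have "RR (i + 1) i (S (s_perm i) u) = (\<Sum>l<CARD('r). sc (zt (int l * (m (i + 1) - m i))) u)"
    unfolding RR_def R_s[OF i u] Zu[OF in1(1)] Z_simps Zu[OF in1(2)] sc_simps zt_add
    by (simp add: algebra_simps)
  also have "\<dots> = sc (\<Sum>l<CARD('r). zt (int l * (m (i + 1) - m i))) u"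
    by (simp only: vs.scale_sum_left)
  finally show ?thesis
    by (simp add: sum_zt rho_def cong_iff_dvd_diff dvd_diff_commute)
qed

lemma S_RR_weight:
  assumes i: "i \<in> {1..<n}" and u: "u \<in> V"
    and Zu: "\<And>i l. i \<in> {1..n} \<Longrightarrow> Z i l u = sc (zt (l * m i)) u"
  shows "S (s_perm i) (RR (i + 1) i u) = sc (rho (m i) (m (i + 1))) u"
proof -
  have in1: "i \<in> {1..n}" "i + 1 \<in> {1..n}" using i by auto
  have *: "S (s_perm i) (R (i + 1) i l u) = sc (zt (int l * (m i - m (i + 1)))) u" for l
  proof -
    have "R (i + 1) i l u = Z (i + 1) (int l) (S (s_perm i) (sc (zt (- int l * m (i + 1))) u))"
      unfolding R_def Zu[OF in1(2)] by (simp add: s_perm_def transpose_commute[of "i + 1" i])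
    also have "S (s_perm i) \<dots> = sc (zt (- int l * m (i + 1))) (Z i (int l) u)"
      using S_Z[OF s_perm_perm[OF i] in1(2), of "S (s_perm i) (sc (zt (- int l * m (i + 1))) u)" "int l"] i u
        S_s_S_s[OF i, of "sc (zt (- int l * m (i + 1))) u"]
      by (simp add: op_simps)
    finally show ?thesis
      unfolding Zu[OF in1(1)] sc_simps zt_add by (simp add: algebra_simps)
  qed
  have "S (s_perm i) (RR (i + 1) i u) = sc (\<Sum>l<CARD('r). zt (int l * (m i - m (i + 1)))) u"
    unfolding RR_def S_simps * by (simp only: vs.scale_sum_left)
  then show ?thesis
    by (simp add: sum_zt rho_def cong_iff_dvd_diff)
qed

text \<open>
  The intertwiner \<open>t\<^bsub>s\<^sub>i\<^esub> + c\<^sub>0 (z\<^sub>i - z\<^sub>i\<^sub>+\<^sub>1)\<^sup>-\<^sup>1 \<Sum>\<^sub>l t\<^bsub>\<zeta>\<^sub>i\<^esub>\<^sup>l t\<^bsub>\<zeta>\<^sub>i\<^sub>+\<^sub>1\<^esub>\<^sup>-\<^sup>l\<close>, evaluated on a weight vector.  If the second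
  summand does not vanish then \<open>\<zeta>\<^sub>i\<close> and \<open>\<zeta>\<^sub>i\<^sub>+\<^sub>1\<close> have the same eigenvalue, so adding it does not
  disturb the weight for the \<open>\<zeta>\<^sub>j\<close>.
\<close>

lemma wt_s:
  assumes i: "i \<in> {1..<n}" and wt: "wt u ev m" and ne: "ev i \<noteq> ev (i + 1)"
    and g: "g = c0 * rho (m i) (m (i + 1)) / (ev i - ev (i + 1))"
  shows "wt (S (s_perm i) u + sc g u) (ev \<circ> s_perm i) (m \<circ> s_perm i)"
proof -
  have in1: "i \<in> {1..n}" "i + 1 \<in> {1..n}" using i by auto
  have u: "u \<in> V" and ev: "\<And>i. i \<in> {1..n} \<Longrightarrow> z i u = sc (ev i) u"
    and Zu: "\<And>i l. i \<in> {1..n} \<Longrightarrow> Z i l u = sc (zt (l * m i)) u"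
    using wt by (auto simp: wt_def)
  let ?u = "S (s_perm i) u + sc g u"
  have S_RR: "S (s_perm i) (RR (i + 1) i u) = sc (rho (m i) (m (i + 1))) u"
    by (rule S_RR_weight[OF i u]) (rule Zu)
  have RR_s: "RR (i + 1) i (S (s_perm i) u) = sc (rho (m i) (m (i + 1))) u"
    by (rule RR_s_weight[OF i u]) (rule Zu)
  have g_eq: "c0 * rho (m i) (m (i + 1)) = g * ev i - g * ev (i + 1)"
  proof -
    have "g * (ev i - ev (i + 1)) = c0 * rho (m i) (m (i + 1))" using ne by (simp add: g)
    then show ?thesis by (simp add: right_diff_distrib)
  qed
  have "z j ?u = sc (ev (s_perm i j)) ?u" if j: "j \<in> {1..n}" for j
  proof -
    consider "j = i" | "j = i + 1" | "j \<noteq> i" "j \<noteq> i + 1" by blast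
    then show ?thesis
    proof cases
      case 1
      show ?thesis
        unfolding 1 z_simps z_s(2)[OF i u] ev[OF in1(1)] ev[OF in1(2)] S_RR
          op_simps s_perm_simps sc_simps vs.scale_right_distrib g_eq
        by (simp add: vs.scale_left_diff_distrib mult.commute)
    next
      case 2
      show ?thesis
        unfolding 2 z_simps z_s(1)[OF i u] ev[OF in1(1)] ev[OF in1(2)] RR_s
          op_simps s_perm_simps sc_simps vs.scale_right_distrib g_eq
        by (simp add: vs.scale_left_diff_distrib mult.commute)
    next
      case 3
      show ?thesis
        unfolding z_simps z_s(3)[OF i u j 3] ev[OF j] s_perm_other[OF 3] op_simps
        by (simp add: vs.scale_right_distrib mult.commute)
    qed
  qed
  moreover have "Z j l ?u = sc (zt (l * m (s_perm i j))) ?u" if j: "j \<in> {1..n}" for j l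
  proof -
    have sj: "s_perm i j \<in> {1..n}" using j permutes_in_image[OF s_perm_perm[OF i]] by blast
    have "Z j l (S (s_perm i) u) = S (s_perm i) (Z (s_perm i j) l u)"
      using S_Z[OF s_perm_perm[OF i] sj u, of l] by simp
    moreover have "sc g (Z j l u) = sc g (sc (zt (l * m (s_perm i j))) u)"
    proof (cases "g = 0")
      case False
      then have "[m i = m (i + 1)] (mod int CARD('r))"
        using g by (auto simp: rho_def split: if_splits)
      then have "[m j = m (s_perm i j)] (mod int CARD('r))"
        by (cases "j = i \<or> j = i + 1") (auto simp: s_perm_other cong_sym)
      then have "int CARD('r) dvd l * m j - l * m (s_perm i j)"
        unfolding cong_iff_dvd_diff by (simp flip: right_diff_distrib)
      then have "zt (l * m j - l * m (s_perm i j)) = 1"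
        using zeta_powi_eq_1_iff[of "CARD('r)" "l * m j - l * m (s_perm i j)"] by (simp only: cconst_1) simp
      then have "zt (l * m j) = zt (l * m (s_perm i j))"
        using zt_add[of "l * m j - l * m (s_perm i j)" "l * m (s_perm i j)"] by simp
      then show ?thesis by (simp add: Zu[OF j])
    qed simp
    ultimately show ?thesis
      by (simp add: op_simps Zu[OF sj] vs.scale_right_distrib mult.commute)
  qed
  ultimately show ?thesis
    unfolding wt_def using i u by auto
qed

lemma H_orthogonal:
  assumes "i \<in> {1..n}" "u \<in> V" "w \<in> V" "z i u = sc a u" "z i w = sc b w" "cnj_ratfun b = b" "a \<noteq> b"
  shows "H u w = 0"
  using H_z[of i u w] assms by (simp add: H_sc H_sc_right)

text \<open>
  The new vector has another \<open>z\<^sub>i\<close>-eigenvalue than \<open>u\<close>, so it is orthogonal to \<open>u\<close>.  This gives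
  \<open>\<langle>t\<^bsub>s\<^sub>i\<^esub>u, u\<rangle> = - g\<langle>u, u\<rangle>\<close>, and the norm follows because \<open>t\<^bsub>s\<^sub>i\<^esub>\<close> is unitary.
\<close>

lemma H_s:
  assumes i: "i \<in> {1..<n}" and wt: "wt u ev m" and ne: "ev i \<noteq> ev (i + 1)"
    and g: "g = c0 * rho (m i) (m (i + 1)) / (ev i - ev (i + 1))"
    and real: "\<And>j. cnj_ratfun (ev j) = ev j"
  shows "H (S (s_perm i) u + sc g u) (S (s_perm i) u + sc g u) = (1 - g\<^sup>2) * H u u"
proof -
  let ?s = "S (s_perm i) u"
  have in1: "i \<in> {1..n}" using i by auto
  have u: "u \<in> V" "?s \<in> V" using wt i by (auto simp: wt_def)
  have g_real: "cnj_ratfun g = g"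
    by (simp add: g cnj_ratfun_divide cnj_ratfun_mult cnj_ratfun_diff real rho_def)
  have "z i (?s + sc g u) = sc (ev (i + 1)) (?s + sc g u)"
    using wt_s[OF i wt ne g] in1 by (auto simp: wt_def)
  moreover have "z i u = sc (ev i) u" using wt in1 by (auto simp: wt_def)
  ultimately have "H (?s + sc g u) u = 0"
    using ne by (intro H_orthogonal[OF in1 _ u(1), of "?s + sc g u" "ev (i + 1)" "ev i"] real V_add V_sc u) auto
  then have 1: "H ?s u = - g * H u u"
    using u by (simp add: H_add H_sc add_eq_0_iff2)
  have "H u u = cnj_ratfun (H u u)" by (rule H_herm[OF u(1) u(1)])
  then have 2: "H u ?s = - g * H u u"
    using H_herm[OF u(2,1)] 1 g_real by (simp add: cnj_ratfun_mult cnj_ratfun_uminus)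
  have 3: "H ?s ?s = H u u" using H_S[OF s_perm_perm[OF i] u(1) u(1)] .
  show ?thesis
    using u by (simp add: H_add H_add_right H_sc H_sc_right 1 2 3 g_real) (simp add: power2_eq_square algebra_simps)
qed

end

section \<open>The Jucys-Murphy elements\<close>

context cherednik_module
begin

lemma Z_v_all:
  assumes i: "i \<in> {1..n}" and T: "T \<in> SYT n lam"
  shows "Z i l (v T) = sc (zt (l * int (beta (T i)))) (v T)"
proof -
  have pos: "Z i (int k) (v T) = sc (zt (int k * int (beta (T i)))) (v T)" for k
  proof (induction k)
    case (Suc k)
    have "Z i (int (Suc k)) (v T) = Z i 1 (Z i (int k) (v T))"
      using i T by (simp add: Z_Z)
    also have "\<dots> = sc (zt (int k * int (beta (T i))) * zt (int (beta (T i)))) (v T)"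
      unfolding Suc.IH Z_simps Z_v[OF i T] sc_simps by (simp add: power_int_of_nat)
    finally show ?case unfolding zt_add by (simp add: algebra_simps)
  qed (use i T in \<open>simp add: Z_0\<close>)
  show ?thesis
  proof (cases "l \<ge> 0")
    case True
    then show ?thesis using pos[of "nat l"] by simp
  next
    case False
    define k where "k = nat (- l)"
    have l: "l = - int k" using False by (simp add: k_def)
    have "v T = Z i l (Z i (int k) (v T))" using i T by (simp add: Z_Z Z_0 l)
    then have "v T = sc (zt (int k * int (beta (T i)))) (Z i l (v T))"
      unfolding pos Z_simps .
    then have "sc (zt (l * int (beta (T i)))) (v T) =
        sc (zt (l * int (beta (T i)))) (sc (zt (int k * int (beta (T i)))) (Z i l (v T)))" by simp
    then show ?thesis unfolding sc_simps zt_add by (simp add: l)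
  qed
qed

lemma beta_less: "T \<in> SYT n lam \<Longrightarrow> i \<in> {1..n} \<Longrightarrow> beta (T i) < CARD('r)"
  using SYT_in_boxes[of T n lam i] lam by (auto simp: boxes_def is_multipartition_def)

lemma rho_beta:
  assumes "T \<in> SYT n lam" "i \<in> {1..n}" "j \<in> {1..n}"
  shows "rho (int (beta (T i))) (int (beta (T j))) = (if beta (T i) = beta (T j) then of_nat CARD('r) else 0)"
  using beta_less[OF assms(1,2)] beta_less[OF assms(1,3)] by (auto simp: rho_def cong_def)

text \<open>
  The Jucys-Murphy elements satisfy \<open>\<phi>\<^sub>i\<^sub>+\<^sub>1 = t\<^bsub>s\<^sub>i\<^esub>\<phi>\<^sub>it\<^bsub>s\<^sub>i\<^esub> + \<pi>\<close>, where \<open>\<pi>\<close> is the sum of reflections in the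
  positions \<open>i\<close> and \<open>i + 1\<close>.  Hence \<open>t\<^bsub>s\<^sub>i\<^esub>\<phi>\<^sub>i\<^sub>+\<^sub>1v\<^sub>T\<close> is \<open>\<phi>\<^sub>it\<^bsub>s\<^sub>i\<^esub>v\<^sub>T\<close> plus a multiple of
  \<open>v\<^sub>T\<close>, and \<open>\<phi>\<^sub>i\<close> is known on \<open>t\<^bsub>s\<^sub>i\<^esub>v\<^sub>T\<close> by induction.
\<close>

lemma jm_v:
  assumes "i \<in> {1..n}" "T \<in> SYT n lam"
  shows "jm i (v T) = sc (of_nat CARD('r) * of_int (ct (T i))) (v T)"
  using assms
proof (induction i arbitrary: T)
  case (Suc i)
  show ?case
  proof (cases "i = 0")
    case True
    then show ?thesis using ct_first[OF lam Suc.prems(2) n_pos] by (simp add: jm_def flip: One_nat_def)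
  next
    case False
    then have i: "i \<in> {1..<n}" and i1: "i \<in> {1..n}" "i + 1 \<in> {1..n}" using Suc.prems by auto
    have T: "T \<in> SYT n lam" by fact
    let ?s = "S (s_perm i)" and ?c = "of_nat CARD('r) * of_int (ct (T (i + 1))) :: 'r ratfun"
    have vT: "v T \<in> V" "?s (v T) \<in> V" using T i by simp_all
    have "?s (jm i (?s (v T))) = jm (i + 1) (v T) - RR (i + 1) i (v T)"
      using S_jm_s[OF i vT(2)] S_s_S_s[OF i vT(1)] by simp
    from arg_cong[OF this, of ?s]
    have "jm i (?s (v T)) = ?s (jm (i + 1) (v T)) - ?s (RR (i + 1) i (v T))"
      unfolding S_s_S_s[OF i V_jm[OF i1(1) vT(2)]] S_simps .
    moreover have "?s (RR (i + 1) i (v T)) = sc (rho (int (beta (T i))) (int (beta (T (i + 1))))) (v T)"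
      by (rule S_RR_weight[OF i vT(1)]) (rule Z_v_all[OF _ T])
    ultimately have key: "?s (jm (i + 1) (v T)) =
        jm i (?s (v T)) + sc (if beta (T i) = beta (T (i + 1)) then of_nat CARD('r) else 0) (v T)"
      using rho_beta[OF T i1] by simp
    have swap_i: "swap_entries i T i = T (i + 1)" by (simp add: swap_entries_def)
    have IH: "jm i (v (swap_entries i T)) = sc ?c (v (swap_entries i T))" if "swap_entries i T \<in> SYT n lam"
      using Suc.IH[OF i1(1) that] by (simp add: swap_i)
    have "?s (jm (i + 1) (v T)) = sc ?c (?s (v T))"
    proof (cases "beta (T i) = beta (T (i + 1))")
      case False
      then show ?thesis
        using key IH[OF swap_entries_SYT[OF T i False]] S_v_diff[OF i T False] by simp
    next
      case True
      define a where "a = ct (T (i + 1)) - ct (T i)"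
      have "a \<noteq> 0" using ct_adjacent_neq[OF lam T i True] by (simp add: a_def)
      obtain x where s: "?s (v T) = sc (1 / of_int a) (v T) + x" and x: "jm i x = sc ?c x"
      proof (cases "swap_entries i T \<in> SYT n lam")
        case True
        show ?thesis
          by (rule that[OF S_v_same[OF i T \<open>beta (T i) = _\<close>, folded a_def, unfolded if_P[OF True]]])
            (simp add: jm_simps IH[OF True] mult.commute)
      next
        case False
        show ?thesis
          by (rule that[OF S_v_same[OF i T \<open>beta (T i) = _\<close>, folded a_def, unfolded if_not_P[OF False]]])
            (use jm_simps(2)[of i 0 0] in simp)
      qed
      have "(of_int a :: 'r ratfun) \<noteq> 0"
        using \<open>a \<noteq> 0\<close> cconst_eq_0_iff[of "of_int a", where 'a='r] by (simp add: cconst_of_int)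
      then have coeff: "of_nat CARD('r) * of_int (ct (T i)) * (1 / of_int a) + of_nat CARD('r) = ?c * (1 / of_int a)"
        by (simp add: field_simps) (simp add: a_def algebra_simps)
      have "?s (jm (i + 1) (v T)) =
          sc (of_nat CARD('r) * of_int (ct (T i)) * (1 / of_int a) + of_nat CARD('r)) (v T) + sc ?c x"
        unfolding key s jm_simps Suc.IH[OF i1(1) T] x using True
        by (simp add: vs.scale_left_distrib mult.commute)
      then show ?thesis unfolding coeff s by (simp add: vs.scale_right_distrib)
    qed
    note eq = this
    have s1: "?s (?s (jm (i + 1) (v T))) = jm (i + 1) (v T)"
      by (rule S_s_S_s[OF i V_jm[OF i1(2) vT(1)]])
    have s2: "?s (?s (v T)) = v T" by (rule S_s_S_s[OF i vT(1)])
    have "?s (?s (jm (i + 1) (v T))) = ?s (sc ?c (?s (v T)))" unfolding eq ..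
    then have "jm (i + 1) (v T) = ?s (sc ?c (?s (v T)))" unfolding s1 .
    then have "jm (i + 1) (v T) = sc ?c (v T)" unfolding S_simps s2 .
    then show ?thesis unfolding Suc_eq_plus1 .
  qed
qed simp

section \<open>The spanning vectors \<open>x\<^sup>\<mu> v\<^sub>T\<^sup>\<mu>\<close>\<close>

definition XL :: "nat list \<Rightarrow> (nat \<Rightarrow> nat) \<Rightarrow> 'm \<Rightarrow> 'm" where
  "XL xs mu u = foldr (\<lambda>i. X i ^^ mu i) xs u"

definition XM :: "(nat \<Rightarrow> nat) \<Rightarrow> 'm \<Rightarrow> 'm" where
  "XM mu = XL [1..<n + 1] mu"

lemma XL_simps [simp]: "XL [] mu u = u" "XL (i # xs) mu u = (X i ^^ mu i) (XL xs mu u)"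
  by (simp_all add: XL_def)

lemma V_X_pow [simp]: "i \<in> {1..n} \<Longrightarrow> u \<in> V \<Longrightarrow> (X i ^^ k) u \<in> V"
  by (induction k) (simp_all del: atLeastAtMost_iff)

lemma V_XL [simp]: "set xs \<subseteq> {1..n} \<Longrightarrow> u \<in> V \<Longrightarrow> XL xs mu u \<in> V"
  by (induction xs) (simp_all del: atLeastAtMost_iff)

lemma X_pow_comm:
  "i \<in> {1..n} \<Longrightarrow> j \<in> {1..n} \<Longrightarrow> u \<in> V \<Longrightarrow> X j ((X i ^^ k) u) = (X i ^^ k) (X j u)"
  by (induction k) (simp_all add: X_X[of j i] del: atLeastAtMost_iff)

lemma X_XL_notin:
  "j \<notin> set xs \<Longrightarrow> XL xs (mu(j := k)) u = XL xs mu u"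
  by (induction xs) auto

lemma X_XL:
  "distinct xs \<Longrightarrow> set xs \<subseteq> {1..n} \<Longrightarrow> j \<in> set xs \<Longrightarrow> u \<in> V \<Longrightarrow>
    X j (XL xs mu u) = XL xs (mu(j := Suc (mu j))) u"
proof (induction xs)
  case (Cons i xs)
  let ?mu = "mu(j := Suc (mu j))"
  have i: "i \<in> {1..n}" and xs: "set xs \<subseteq> {1..n}" "distinct xs" and u: "u \<in> V"
    using Cons.prems by simp_all
  show ?case
  proof (cases "i = j")
    case True
    have "XL xs ?mu u = XL xs mu u" using Cons.prems(1) True by (intro X_XL_notin) simp
    then have "XL (i # xs) ?mu u = (X j ^^ Suc (mu j)) (XL xs mu u)"
      by (simp only: XL_simps True fun_upd_same)
    then show ?thesis by (simp only: XL_simps True funpow.simps o_apply)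
  next
    case False
    then have "j \<in> set xs" and j: "j \<in> {1..n}" using Cons.prems by auto
    have "X j (XL (i # xs) mu u) = (X i ^^ mu i) (X j (XL xs mu u))"
      using X_pow_comm[OF i j V_XL[OF xs(1) u]] by simp
    also have "\<dots> = (X i ^^ mu i) (XL xs ?mu u)"
      using Cons.IH[OF xs(2,1) \<open>j \<in> set xs\<close> u] by (simp only:)
    finally show ?thesis unfolding XL_simps fun_upd_other[OF False] .
  qed
qed simp

lemma set_idx: "set [1..<n + 1] = {1..n}"
  by auto

lemma V_XM [simp]: "u \<in> V \<Longrightarrow> XM mu u \<in> V"
  unfolding XM_def by (rule V_XL) (simp_all only: set_idx subset_refl)

lemma X_XM: "j \<in> {1..n} \<Longrightarrow> u \<in> V \<Longrightarrow> X j (XM mu u) = XM (mu(j := Suc (mu j))) u"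
  unfolding XM_def by (rule X_XL) (simp_all only: set_idx subset_refl distinct_upt)

lemma linI:
  "(\<And>u w. f (u + w) = f u + f w) \<Longrightarrow> (\<And>c u. f (sc c u) = sc c (f u)) \<Longrightarrow> Vector_Spaces.linear sc sc f"
  by (simp add: Vector_Spaces.linear_iff vector_space_sc)

lemma XL_lin: "Vector_Spaces.linear sc sc (XL xs mu)"
proof -
  have pow: "(X i ^^ k) (u + w) = (X i ^^ k) u + (X i ^^ k) w" "(X i ^^ k) (sc c u) = sc c ((X i ^^ k) u)"
    for i k u w c
    by (induction k) (simp_all add: op_simps)
  show ?thesis
    by (rule linI; induction xs) (simp_all add: pow)
qed

lemmas XM_lin = XL_lin[of "[1..<n + 1]", folded XM_def]

lemma XM_zero:
  assumes "\<And>i. i \<in> {1..n} \<Longrightarrow> mu i = 0" shows "XM mu u = u"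
proof -
  have "XL xs mu u = u" if "\<forall>i\<in>set xs. mu i = 0" for xs
    using that by (induction xs) auto
  moreover have "\<forall>i\<in>set [1..<n + 1]. mu i = 0"
    unfolding set_idx using assms by blast
  ultimately show ?thesis unfolding XM_def by blast
qed

lemma S_XM:
  assumes p: "p permutes {1..n}" and u: "u \<in> V"
  shows "mu \<in> compositions n \<Longrightarrow> S p (XM mu u) = XM (mu \<circ> inv_into UNIV p) (S p u)"
proof (induction "\<Sum>i = 1..n. mu i" arbitrary: mu)
  case 0
  then have "mu i = 0" for i by (cases "i \<in> {1..n}") (auto simp: compositions_def)
  then show ?case by (simp add: XM_zero)
next
  case (Suc m)
  have "\<exists>j\<in>{1..n}. mu j \<noteq> 0"
  proof (rule ccontr)
    assume "\<not> (\<exists>j\<in>{1..n}. mu j \<noteq> 0)"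
    then have "(\<Sum>i = 1..n. mu i) = 0" by simp
    then show False using Suc.hyps(2) by simp
  qed
  then obtain j where j: "j \<in> {1..n}" "mu j \<noteq> 0" by blast
  define mu' where "mu' = mu(j := mu j - 1)"
  have mu: "mu = mu'(j := Suc (mu' j))" using j by (auto simp: mu'_def)
  have "(\<Sum>i = 1..n. mu i) = mu j + (\<Sum>i\<in>{1..n} - {j}. mu i)" using j by (simp add: sum.remove)
  moreover have "(\<Sum>i = 1..n. mu' i) = (mu j - 1) + (\<Sum>i\<in>{1..n} - {j}. mu i)"
    using j by (subst sum.remove[of _ j]) (auto simp: mu'_def intro!: sum.cong)
  ultimately have m: "m = (\<Sum>i = 1..n. mu' i)" using Suc.hyps(2) j by simp
  have mu'_in: "mu' \<in> compositions n" using Suc.prems by (auto simp: mu'_def compositions_def)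
  have pj: "p j \<in> {1..n}" using permutes_in_image[OF p] j by blast
  have Spu: "S p u \<in> V" using p u by (rule V_S)
  have "S p (XM mu u) = X (p j) (S p (XM mu' u))"
    unfolding mu using X_XM[OF j(1) u, of mu'] S_X[OF p j(1) V_XM[OF u, of mu']] by simp
  also have "\<dots> = XM ((mu' \<circ> inv_into UNIV p)(p j := Suc ((mu' \<circ> inv_into UNIV p) (p j)))) (S p u)"
    unfolding Suc.hyps(1)[OF m mu'_in] by (rule X_XM[OF pj Spu])
  also have "(mu' \<circ> inv_into UNIV p)(p j := Suc ((mu' \<circ> inv_into UNIV p) (p j))) = mu \<circ> inv_into UNIV p"
    using permutes_inverses[OF p] by (auto simp: mu fun_eq_iff)
  finally show ?case .
qed

definition e :: "(nat \<Rightarrow> nat) \<Rightarrow> tableau \<Rightarrow> 'm" where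
  "e mu T = XM mu (S (inv_into UNIV (w_comp n mu)) (v T))"

lemma inv_w_permutes: "inv_into UNIV (w_comp n mu) permutes {1..n}"
  by (rule permutes_inv[OF w_comp_permutes])

lemma V_e [simp]: "T \<in> SYT n lam \<Longrightarrow> e mu T \<in> V"
  unfolding e_def by (intro V_XM V_S inv_w_permutes V_v)

lemma inv_unrot: "inv_into UNIV (unrot n) = rot n"
  by (rule inv_equality) (simp_all add: rot_unrot unrot_rot)

lemma Phi_e:
  assumes T: "T \<in> SYT n lam" and mu: "mu \<in> compositions n"
  shows "Phi (e mu T) = e (phi_comp n mu) T"
proof -
  let ?w = "w_comp n mu"
  have vT: "v T \<in> V" using T by simp
  have inv: "inv_into UNIV (?w \<circ> unrot n) = rot n \<circ> inv_into UNIV ?w"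
    using o_inv_distrib[OF permutes_bij[OF w_comp_permutes] permutes_bij[OF unrot_permutes[OF n_pos]], of n mu]
    by (simp only: inv_unrot)
  have "Phi (e mu T) = X n (XM (mu \<circ> unrot n) (S (rot n) (S (inv_into UNIV ?w) (v T))))"
    unfolding Phi_def e_def
    using S_XM[OF rot_perm V_S[OF inv_w_permutes vT] mu] by (simp add: inv_rot[OF n_pos])
  also have "S (rot n) (S (inv_into UNIV ?w) (v T)) = S (rot n \<circ> inv_into UNIV ?w) (v T)"
    by (rule S_S[OF rot_perm inv_w_permutes vT])
  also have "X n (XM (mu \<circ> unrot n) (S (rot n \<circ> inv_into UNIV ?w) (v T))) =
      XM ((mu \<circ> unrot n)(n := Suc ((mu \<circ> unrot n) n))) (S (rot n \<circ> inv_into UNIV ?w) (v T))"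
    by (rule X_XM[OF n_in(1) V_S[OF permutes_compose[OF inv_w_permutes rot_perm] vT]])
  also have "(mu \<circ> unrot n)(n := Suc ((mu \<circ> unrot n) n)) = phi_comp n mu"
    by (simp add: phi_comp_def unrot_def Suc_eq_plus1)
  finally show ?thesis
    unfolding e_def w_comp_phi_comp[OF n_pos] inv .
qed

lemma S_e:
  assumes i: "i \<in> {1..<n}" and T: "T \<in> SYT n lam" and mu: "mu \<in> compositions n"
  shows "S (s_perm i) (e mu T) = XM (mu \<circ> s_perm i) (S (s_perm i \<circ> inv_into UNIV (w_comp n mu)) (v T))"
  unfolding e_def
  using S_XM[OF s_perm_perm[OF i] V_S[OF inv_w_permutes V_v[OF T]] mu]
    S_S[OF s_perm_perm[OF i] inv_w_permutes V_v[OF T]]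
  by (simp add: inv_s_perm)

lemma S_e_neq:
  assumes i: "i \<in> {1..<n}" and T: "T \<in> SYT n lam" and mu: "mu \<in> compositions n" and ne: "mu i \<noteq> mu (i + 1)"
  shows "S (s_perm i) (e mu T) = e (mu \<circ> s_perm i) T"
proof -
  have "inv_into UNIV (w_comp n mu \<circ> s_perm i) = s_perm i \<circ> inv_into UNIV (w_comp n mu)"
    using o_inv_distrib[OF permutes_bij[OF w_comp_permutes] permutes_bij[OF s_perm_perm[OF i]], of n mu]
    by (simp only: inv_s_perm)
  then show ?thesis
    unfolding S_e[OF i T mu] by (simp only: e_def w_comp_s_perm[where mu = mu, OF i ne])
qed

definition espan :: "(nat \<Rightarrow> nat) set \<Rightarrow> 'm set" where
  "espan A = vs.span {e nu T | nu T. nu \<in> A \<and> T \<in> SYT n lam}"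

lemma e_in_espan: "nu \<in> A \<Longrightarrow> T \<in> SYT n lam \<Longrightarrow> e nu T \<in> espan A"
  unfolding espan_def by (rule vs.span_base) blast

lemma espan_mono: "A \<subseteq> B \<Longrightarrow> espan A \<subseteq> espan B"
  unfolding espan_def by (rule vs.span_mono) blast

lemma espan_closed [simp]:
  "u \<in> espan A \<Longrightarrow> w \<in> espan A \<Longrightarrow> u + w \<in> espan A"
  "u \<in> espan A \<Longrightarrow> sc c u \<in> espan A" "0 \<in> espan A"
  unfolding espan_def by (auto intro: vs.span_add vs.span_scale vs.span_zero)

lemma linear_span_subset:
  assumes f: "Vector_Spaces.linear sc sc f" and g: "\<And>x. x \<in> G \<Longrightarrow> f x \<in> W" and W: "vs.subspace W"
    and x: "x \<in> vs.span G"
  shows "f x \<in> W"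
  using x
proof (rule vs.span_induct)
  show "vs.subspace {x. f x \<in> W}"
    using W by (auto simp: vs.subspace_def lin_simps[OF f])
qed (use g in auto)

text \<open>
  If \<open>\<mu>\<^sub>i = \<mu>\<^sub>i\<^sub>+\<^sub>1\<close> then \<open>w\<^sub>\<mu>\<close> conjugates \<open>s\<^sub>i\<close> to the simple transposition of the adjacent numbers
  \<open>w\<^sub>\<mu>(i + 1)\<close> and \<open>w\<^sub>\<mu>(i)\<close>, which acts inside the Specht module by the given formula.
\<close>

lemma S_e_eq:
  assumes i: "i \<in> {1..<n}" and T: "T \<in> SYT n lam" and mu: "mu \<in> compositions n" and eq: "mu i = mu (i + 1)"
  shows "S (s_perm i) (e mu T) \<in> espan {mu}"
proof -
  let ?w = "w_comp n mu" and ?p = "inv_into UNIV (w_comp n mu)"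
  define k where "k = ?w (i + 1)"
  have wi: "?w i = k + 1" using w_comp_adjacent_equal[where mu = mu, OF i eq] by (simp add: k_def)
  have "?w (i + 1) \<in> {1..n}" "?w i \<in> {1..n}"
    using i by (simp_all only: permutes_in_image[OF w_comp_permutes]) auto
  then have k: "k \<in> {1..<n}" using wi by (auto simp: k_def)
  have "s_perm i (?p x) = ?p (s_perm k x)" for x
  proof -
    have "?w (s_perm i (?p x)) = s_perm k (?w (?p x))"
    proof -
      have inj: "?w a = ?w b \<longleftrightarrow> a = b" for a b
        using permutes_inj[OF w_comp_permutes, of n mu] by (rule inj_eq)
      have "?w (s_perm i y) = s_perm k (?w y)" for y
        using inj[of y i] inj[of y "i + 1"] wi k_def by (simp add: s_perm_def transpose_def)
      then show ?thesis .
    qed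
    then have "?p (?w (s_perm i (?p x))) = ?p (s_perm k (?w (?p x)))" by (rule arg_cong[where f = ?p])
    then show ?thesis by (simp only: permutes_inverses[OF w_comp_permutes])
  qed
  then have conj: "s_perm i \<circ> ?p = ?p \<circ> s_perm k" by auto
  have musi: "mu \<circ> s_perm i = mu" using eq by (auto simp: s_perm_def transpose_def)
  have "S (s_perm i) (e mu T) = XM mu (S ?p (S (s_perm k) (v T)))"
    unfolding S_e[OF i T mu] conj musi
    using S_S[OF inv_w_permutes s_perm_perm[OF k] V_v[OF T], of mu] by simp
  moreover have "S (s_perm k) (v T) \<in> vs.span (v ` SYT n lam)"
  proof (cases "beta (T k) = beta (T (k + 1))")
    case True
    then show ?thesis
      unfolding S_v_same[OF k T True] using T
      by (intro vs.span_add) (simp_all add: vs.span_scale vs.span_base vs.span_zero)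
  next
    case False
    then show ?thesis
      unfolding S_v_diff[OF k T False] using swap_entries_SYT[OF T k False] by (intro vs.span_base) auto
  qed
  moreover have "XM mu (S ?p x) \<in> espan {mu}" if "x \<in> vs.span (v ` SYT n lam)" for x
  proof (rule linear_span_subset[OF _ _ _ that, where f = "\<lambda>x. XM mu (S ?p x)"])
    show "Vector_Spaces.linear sc sc (\<lambda>x. XM mu (S ?p x))"
      by (rule linI) (simp_all add: op_simps lin_simps[OF XM_lin])
    show "vs.subspace (espan {mu})" by (simp add: espan_def)
    fix x assume "x \<in> v ` SYT n lam"
    then obtain T' where T': "T' \<in> SYT n lam" "x = v T'" by blast
    then show "XM mu (S ?p x) \<in> espan {mu}"
      using e_in_espan[of mu "{mu}" T'] by (simp add: e_def)
  qed
  ultimately show ?thesis by simp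
qed

lemma S_e_espan:
  assumes i: "i \<in> {1..<n}" and T: "T \<in> SYT n lam" and mu: "mu \<in> compositions n"
  shows "S (s_perm i) (e mu T) \<in> espan {mu \<circ> s_perm i}"
proof (cases "mu i = mu (i + 1)")
  case True
  then have "mu \<circ> s_perm i = mu" by (auto simp: s_perm_def transpose_def)
  then show ?thesis using S_e_eq[OF i T mu True] by simp
next
  case False
  then show ?thesis using S_e_neq[OF i T mu False] e_in_espan[of _ _ T] T by simp
qed

definition below :: "(nat \<Rightarrow> nat) \<Rightarrow> (nat \<Rightarrow> nat) set" where
  "below mu = {nu. (step n)\<^sup>+\<^sup>+ nu mu}"

lemma below_in: "nu \<in> below mu \<Longrightarrow> mu \<in> compositions n \<Longrightarrow> nu \<in> compositions n"
  unfolding below_def mem_Collect_eq by (induction rule: converse_tranclp_induct) (auto intro: step_in)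

definition triangular :: "(nat \<Rightarrow> nat) \<Rightarrow> tableau \<Rightarrow> 'm \<Rightarrow> bool" where
  "triangular mu T g \<longleftrightarrow> g - e mu T \<in> espan (below mu)"

lemma triangular_Phi:
  assumes tri: "triangular mu T g" and T: "T \<in> SYT n lam" and mu: "mu \<in> compositions n"
  shows "triangular (phi_comp n mu) T (Phi g)"
proof -
  have Phi_lin: "Vector_Spaces.linear sc sc Phi"
    by (rule linI) (simp_all add: Phi_simps)
  have "Phi (g - e mu T) \<in> espan (below (phi_comp n mu))"
  proof (rule linear_span_subset[OF Phi_lin])
    show "g - e mu T \<in> vs.span {e nu T | nu T. nu \<in> below mu \<and> T \<in> SYT n lam}"
      using tri by (simp add: triangular_def espan_def)
    show "vs.subspace (espan (below (phi_comp n mu)))" by (simp add: espan_def)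
    fix x assume "x \<in> {e nu T | nu T. nu \<in> below mu \<and> T \<in> SYT n lam}"
    then obtain nu T' where nu: "nu \<in> below mu" "T' \<in> SYT n lam" "x = e nu T'" by blast
    then have "phi_comp n nu \<in> below (phi_comp n mu)"
      using steps_phi_comp[OF n_pos] by (simp add: below_def)
    then show "Phi x \<in> espan (below (phi_comp n mu))"
      unfolding nu(3) Phi_e[OF nu(2) below_in[OF nu(1) mu]] using nu(2) by (rule e_in_espan)
  qed
  then show ?thesis
    by (simp add: triangular_def lin_simps[OF Phi_lin] Phi_e[OF T mu])
qed

text \<open>
  The term \<open>x\<^sup>\<mu>v\<^sub>T\<^sup>\<mu>\<close> added by the intertwiner lies below the new leading term, and the lifting
  property \<open>steps_s_perm\<close> takes care of the lower terms of \<open>g\<close>.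
\<close>

lemma triangular_s:
  assumes tri: "triangular mu T g" and T: "T \<in> SYT n lam" and mu: "mu \<in> compositions n"
    and i: "i \<in> {1..<n}" and lt: "mu i < mu (i + 1)"
  shows "triangular (mu \<circ> s_perm i) T (S (s_perm i) g + sc c g)"
proof -
  let ?s = "s_perm i"
  have up: "step n mu (mu \<circ> ?s)" by (rule step_up_s_perm[OF i lt])
  have sub: "below mu \<subseteq> below (mu \<circ> ?s)" and mem: "mu \<in> below (mu \<circ> ?s)"
    using up by (auto simp: below_def intro: tranclp.trancl_into_trancl)
  have "S ?s (g - e mu T) \<in> espan (below (mu \<circ> ?s))"
  proof (rule linear_span_subset[OF S_lin])
    show "g - e mu T \<in> vs.span {e nu T | nu T. nu \<in> below mu \<and> T \<in> SYT n lam}"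
      using tri by (simp add: triangular_def espan_def)
    show "vs.subspace (espan (below (mu \<circ> ?s)))" by (simp add: espan_def)
    fix x assume "x \<in> {e nu T | nu T. nu \<in> below mu \<and> T \<in> SYT n lam}"
    then obtain nu T' where nu: "nu \<in> below mu" "T' \<in> SYT n lam" "x = e nu T'" by blast
    have "height_less n nu mu" using nu(1) steps_height_less by (simp add: below_def)
    then have "nu \<noteq> mu" using height_less_irrefl by blast
    have ne: "nu \<circ> ?s \<noteq> mu \<circ> ?s"
    proof
      assume "nu \<circ> ?s = mu \<circ> ?s"
      then have "(nu \<circ> ?s) (?s x) = (mu \<circ> ?s) (?s x)" for x by (simp only:)
      then have "nu = mu" by (simp add: fun_eq_iff)
      with \<open>nu \<noteq> mu\<close> show False by contradiction
    qed
    have steps: "(step n)\<^sup>*\<^sup>* nu mu" using nu(1) by (simp add: below_def tranclp_into_rtranclp)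
    have "nu \<circ> ?s \<in> below (mu \<circ> ?s)"
      unfolding below_def mem_Collect_eq
      using steps_s_perm[OF i steps]
    proof (rule disjE)
      assume "(step n)\<^sup>*\<^sup>* (nu \<circ> ?s) (mu \<circ> ?s)"
      from rtranclpD[OF this] ne show "(step n)\<^sup>+\<^sup>+ (nu \<circ> ?s) (mu \<circ> ?s)" by blast
    next
      assume "(step n)\<^sup>*\<^sup>* (nu \<circ> ?s) mu"
      then show "(step n)\<^sup>+\<^sup>+ (nu \<circ> ?s) (mu \<circ> ?s)" using up
        by (blast intro: rtranclp_tranclp_tranclp)
    qed
    then have "espan {nu \<circ> ?s} \<subseteq> espan (below (mu \<circ> ?s))" by (intro espan_mono) simp
    then show "S ?s x \<in> espan (below (mu \<circ> ?s))"
      using S_e_espan[OF i nu(2) below_in[OF nu(1) mu]] unfolding nu(3) by blast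
  qed
  moreover have "sc c (g - e mu T) \<in> espan (below (mu \<circ> ?s))"
    using tri espan_mono[OF sub] unfolding triangular_def by (intro espan_closed(2)) blast
  moreover have "sc c (e mu T) \<in> espan (below (mu \<circ> ?s))"
    using e_in_espan[OF mem T] by (intro espan_closed(2))
  ultimately have "S ?s (g - e mu T) + sc c (g - e mu T) + sc c (e mu T) \<in> espan (below (mu \<circ> ?s))"
    by (intro espan_closed(1))
  moreover have "S ?s (g - e mu T) + sc c (g - e mu T) + sc c (e mu T) = S ?s g + sc c g - e (mu \<circ> ?s) T"
    using lt S_e_neq[OF i T mu] by (simp add: op_simps vs.scale_right_diff_distrib)
  ultimately show ?thesis by (simp only: triangular_def)
qed

end

section \<open>The norm of the eigenvectors\<close>

context cherednik_module
begin

definition ca :: "tableau \<Rightarrow> (nat \<Rightarrow> nat) \<Rightarrow> nat \<Rightarrow> int" where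
  "ca T mu = (\<lambda>i. ct (T (w_comp n mu i)))"

definition cb :: "tableau \<Rightarrow> (nat \<Rightarrow> nat) \<Rightarrow> nat \<Rightarrow> int" where
  "cb T mu = (\<lambda>i. int (beta (T (w_comp n mu i))))"

definition ev :: "tableau \<Rightarrow> (nat \<Rightarrow> nat) \<Rightarrow> nat \<Rightarrow> 'r ratfun" where
  "ev T mu = (\<lambda>i. ev_fac (ca T mu) (cb T mu) i (mu i + 1))"

definition norm_val :: "tableau \<Rightarrow> (nat \<Rightarrow> nat) \<Rightarrow> 'r ratfun" where
  "norm_val T mu = norm_formula n mu (ca T mu) (cb T mu)"

definition is_eigenvector :: "(nat \<Rightarrow> nat) \<Rightarrow> tableau \<Rightarrow> 'm \<Rightarrow> bool" where
  "is_eigenvector mu T g \<longleftrightarrow> wt g (ev T mu) (\<lambda>i. cb T mu i - int (mu i)) \<and>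
     triangular mu T g \<and> H g g = norm_val T mu"

lemma wt_cong:
  "wt u a m \<Longrightarrow> (\<And>i. i \<in> {1..n} \<Longrightarrow> a i = a' i) \<Longrightarrow> (\<And>i. i \<in> {1..n} \<Longrightarrow> m i = m' i) \<Longrightarrow> wt u a' m'"
  unfolding wt_def by simp

lemma cnj_ev: "cnj_ratfun (ev T mu i) = ev T mu i"
  by (simp add: ev_def)

text \<open>
  On \<open>S\<^sup>\<lambda>\<close> the \<open>y\<^sub>i\<close> vanish, so \<open>z\<^sub>i\<close> acts through the group: \<open>y\<^sub>ix\<^sub>i\<close> contributes the reflections for all
  \<open>j \<noteq> i\<close> with sign \<open>-\<close> and \<open>\<phi>\<^sub>i\<close> those for \<open>j < i\<close> with sign \<open>+\<close>.  The remaining ones for \<open>j > i\<close> form a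
  Jucys-Murphy element after conjugation by the order-reversing permutation \<open>w\<^sub>0\<close>.
\<close>

lemma eigenvector_zero:
  assumes T: "T \<in> SYT n lam"
  shows "is_eigenvector (\<lambda>_. 0) T (e (\<lambda>_. 0) T)"
proof -
  let ?w = "w_comp n (\<lambda>_. 0)"
  let ?p = "inv_into UNIV ?w" and ?a = "ca T (\<lambda>_. 0)" and ?b = "cb T (\<lambda>_. 0)"
  let ?g = "S ?p (v T)"
  have p: "?p permutes {1..n}" by (rule inv_w_permutes)
  have g: "e (\<lambda>_. 0) T = ?g" by (simp add: e_def XM_zero)
  have vT: "v T \<in> V" and gV: "?g \<in> V" using T p by simp_all
  have w_in: "?w i \<in> {1..n}" if "i \<in> {1..n}" for i
    using that by (simp only: permutes_in_image[OF w_comp_permutes])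
  have pw: "?p (?w i) = i" for i by (rule permutes_inverses(2)[OF w_comp_permutes])
  have Zg: "Z i l ?g = sc (zt (l * ?b i)) ?g" if i: "i \<in> {1..n}" for i l
  proof -
    have "Z i l ?g = S ?p (Z (?w i) l (v T))"
      using S_Z[OF p w_in[OF i] vT, of l] by (simp only: pw)
    then show ?thesis
      unfolding Z_v_all[OF w_in[OF i] T] S_simps by (simp add: cb_def)
  qed
  have Yg: "Y i ?g = 0" if i: "i \<in> {1..n}" for i
    using S_Y[OF p w_in[OF i] vT] Y_v[OF w_in[OF i] T] by (simp add: pw S_simps)
  have "z i ?g = sc (ev_fac ?a ?b i 1) ?g" if i: "i \<in> {1..n}" for i
  proof -
    have split: "{1..n} - {i} = {1..<i} \<union> {i<..n}" "{1..<i} \<inter> {i<..n} = {}" using i by auto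
    have "S ?p (jm (?w i) (v T)) = (\<Sum>j = 1..<?w i. RR i (?p j) ?g)"
      unfolding jm_def S_simps
    proof (rule sum.cong[OF refl])
      fix j assume "j \<in> {1..<?w i}"
      then have "j \<in> {1..n}" using w_in[OF i] by auto
      from S_RR[OF p w_in[OF i] this vT] show "S ?p (RR (?w i) j (v T)) = RR i (?p j) ?g"
        by (simp only: pw)
    qed
    moreover have "(\<Sum>j = 1..<?w i. RR i (?p j) ?g) = (\<Sum>j\<in>{i<..n}. RR i j ?g)"
    proof (rule sum.reindex_bij_witness[of _ ?w ?p])
      fix j assume j: "j \<in> {1..<?w i}"
      then have jn: "j \<in> {1..n}" using w_in[OF i] by auto
      have pj: "?p j \<in> {1..n}" using permutes_in_image[OF p] jn by blast
      show wp: "?w (?p j) = j" by (rule permutes_inverses(1)[OF w_comp_permutes])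
      have "?w (?p j) < ?w i" using j by (simp add: wp)
      then show "?p j \<in> {i<..n}" using w_comp_less_iff[OF pj i] pj by simp
    next
      fix j assume j: "j \<in> {i<..n}"
      then have "j \<in> {1..n}" using i by auto
      then show "?w j \<in> {1..<?w i}"
        using w_comp_less_iff[of j n i "\<lambda>_. 0"] w_in[of j] i j by auto
      show "?p (?w j) = j" by (rule pw)
    qed (rule refl)
    ultimately have upper: "(\<Sum>j\<in>{i<..n}. RR i j ?g) = sc (of_nat CARD('r) * of_int (?a i)) ?g"
      unfolding jm_v[OF w_in[OF i] T] S_simps by (simp add: ca_def)
    have "Y i (X i ?g) = sc kappa ?g - sc (d (?b i) - d (?b i - 1)) ?g
        - sc c0 (jm i ?g + sc (of_nat CARD('r) * of_int (?a i)) ?g)"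
      using Y_X_same[OF i gV] D_weight[of i ?g "?b i"] Zg[OF i]
      unfolding D_def jm_def upper[symmetric] RR_def R_def split(1) sum.union_disjoint[OF finite_atLeastLessThan finite_greaterThanAtMost split(2)]
      by (simp add: Yg[OF i] X_simps)
    then show ?thesis
      unfolding z_def ev_fac_def
      by (simp add: vs.scale_right_distrib vs.scale_left_diff_distrib algebra_simps)
  qed
  then have "wt ?g (ev T (\<lambda>_. 0)) (\<lambda>i. ?b i - int 0)"
    unfolding wt_def ev_def using gV Zg by simp
  moreover have "triangular (\<lambda>_. 0) T ?g"
    by (simp add: triangular_def g)
  moreover have "H ?g ?g = norm_val T (\<lambda>_. 0)"
    using H_S[OF p vT vT] H_v[OF T] by (simp add: norm_val_def norm_formula_zero)
  ultimately show ?thesis unfolding is_eigenvector_def g by blast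
qed

lemma eigenvector_Phi:
  assumes T: "T \<in> SYT n lam" and mu: "mu \<in> compositions n" and g: "is_eigenvector mu T g"
  shows "is_eigenvector (phi_comp n mu) T (Phi g)"
proof -
  let ?mu = "phi_comp n mu"
  let ?a = "ca T mu" and ?b = "cb T mu"
  have wt: "wt g (ev T mu) (\<lambda>i. ?b i - int (mu i))" and tri: "triangular mu T g"
    and norm: "H g g = norm_val T mu"
    using g by (simp_all add: is_eigenvector_def)
  have ab: "ca T ?mu = ?a \<circ> unrot n" "cb T ?mu = ?b \<circ> unrot n"
    by (simp_all add: ca_def cb_def w_comp_phi_comp[OF n_pos] fun_eq_iff)
  have mu_lt: "?mu i = mu (i + 1)" "unrot n i = i + 1" if "i \<in> {1..n}" "i < n" for i
    using that by (auto simp: phi_comp_def unrot_def)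
  have mu_n: "?mu n = mu 1 + 1" "unrot n n = 1"
    by (simp_all add: phi_comp_def unrot_def)
  have "wt (Phi g) (ev T ?mu) (\<lambda>i. cb T ?mu i - int (?mu i))"
  proof (rule wt_cong[OF wt_Phi[OF wt]])
    fix i assume i: "i \<in> {1..n}"
    show "(if i < n then ?b (i + 1) - int (mu (i + 1)) else ?b 1 - int (mu 1) - 1) = cb T ?mu i - int (?mu i)"
    proof (cases "i < n")
      case True
      then show ?thesis using mu_lt[OF i] by (simp add: ab)
    next
      case False
      then have "i = n" using i by simp
      then show ?thesis by (simp add: ab mu_n)
    qed
    show "(if i < n then ev T mu (i + 1) else ev T mu 1 + kappa -
        (d (?b 1 - int (mu 1) - 1) - d (?b 1 - int (mu 1) - 2))) = ev T ?mu i"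
    proof (cases "i < n")
      case True
      then show ?thesis using mu_lt[OF i] by (simp add: ab ev_def ev_fac_def)
    next
      case False
      then have "i = n" using i by simp
      moreover have "?b 1 - int (mu 1 + 1) = ?b 1 - int (mu 1) - 1" "?b 1 - int (mu 1 + 1 + 1) = ?b 1 - int (mu 1) - 2"
        by simp_all
      ultimately show ?thesis
        unfolding ev_def ev_fac_def ab o_def by (simp add: mu_n algebra_simps)
    qed
  qed
  moreover have "H (Phi g) (Phi g) = norm_val T ?mu"
    using H_Phi[OF wt cnj_ev] norm norm_formula_phi_comp[OF n_pos, of mu ?a ?b, where 'r='r]
    by (simp only: norm_val_def ab ev_def)
  ultimately show ?thesis
    unfolding is_eigenvector_def using triangular_Phi[OF tri T mu] by blast
qed

lemma eigenvector_s:
  assumes T: "T \<in> SYT n lam" and mu: "mu \<in> compositions n" and g: "is_eigenvector mu T g"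
    and i: "i \<in> {1..<n}" and lt: "mu i < mu (i + 1)"
  shows "\<exists>g'. is_eigenvector (mu \<circ> s_perm i) T g'"
proof -
  let ?mu = "mu \<circ> s_perm i"
  let ?a = "ca T mu" and ?b = "cb T mu"
  have wt: "wt g (ev T mu) (\<lambda>i. ?b i - int (mu i))" and tri: "triangular mu T g"
    and norm: "H g g = norm_val T mu"
    using g by (simp_all add: is_eigenvector_def)
  define \<gamma> where "\<gamma> = c0 * rho (?b i - int (mu i)) (?b (i + 1) - int (mu (i + 1))) / (ev T mu i - ev T mu (i + 1))"
  have ab: "ca T ?mu = ?a \<circ> s_perm i" "cb T ?mu = ?b \<circ> s_perm i"
    using lt by (simp_all add: ca_def cb_def w_comp_s_perm[OF i] fun_eq_iff)
  have ne: "ev T mu i \<noteq> ev T mu (i + 1)"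
    unfolding ev_def by (rule ev_fac_neq) (use lt in simp)
  have "wt (S (s_perm i) g + sc \<gamma> g) (ev T mu \<circ> s_perm i) ((\<lambda>i. ?b i - int (mu i)) \<circ> s_perm i)"
    using wt_s[OF i wt ne] by (simp add: \<gamma>_def)
  moreover have "ev T mu \<circ> s_perm i = ev T ?mu"
    by (simp add: fun_eq_iff ev_def ab ev_fac_def)
  moreover have "(\<lambda>i. ?b i - int (mu i)) \<circ> s_perm i = (\<lambda>i. cb T ?mu i - int (?mu i))"
    unfolding ab by (simp add: fun_eq_iff)
  ultimately have wt': "wt (S (s_perm i) g + sc \<gamma> g) (ev T ?mu) (\<lambda>i. cb T ?mu i - int (?mu i))"
    by (simp only:)
  have "1 - \<gamma>\<^sup>2 = (if [int (mu (i + 1) - mu i) = ?b (i + 1) - ?b i] (mod int CARD('r))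
     then pair_fac ?a ?b (mu (i + 1) - mu i) (i + 1) i else 1)"
  proof -
    have iff: "[int (mu (i + 1) - mu i) = ?b (i + 1) - ?b i] (mod int CARD('r)) \<longleftrightarrow>
        [?b i - int (mu i) = ?b (i + 1) - int (mu (i + 1))] (mod int CARD('r))"
    proof -
      have "int (mu (i + 1) - mu i) - (?b (i + 1) - ?b i) =
          (?b i - int (mu i)) - (?b (i + 1) - int (mu (i + 1)))" using lt by simp
      then show ?thesis by (simp only: cong_iff_dvd_diff)
    qed
    show ?thesis
    proof (cases "[?b i - int (mu i) = ?b (i + 1) - int (mu (i + 1))] (mod int CARD('r))")
      case True
      define L where "L = (lin_fac ?a ?b (mu (i + 1) - mu i) (i + 1) i :: 'r ratfun)"
      have "L \<noteq> 0" unfolding L_def by (rule lin_fac_neq_c0(1)) (use lt in simp)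
      have diff: "ev T mu i - ev T mu (i + 1) = - L"
        unfolding ev_def L_def by (rule ev_fac_diff[OF lt True])
      have "\<gamma>\<^sup>2 = (c0 * of_nat CARD('r))\<^sup>2 / L\<^sup>2"
        unfolding \<gamma>_def diff using True by (simp add: rho_def power_divide)
      then have "1 - \<gamma>\<^sup>2 = (L\<^sup>2 - (c0 * of_nat CARD('r))\<^sup>2) / L\<^sup>2"
        using \<open>L \<noteq> 0\<close> by (simp add: diff_divide_distrib)
      then show ?thesis using True iff by (simp add: pair_fac_def L_def)
    next
      case False
      then have "\<gamma> = 0" by (simp add: \<gamma>_def rho_def)
      then show ?thesis using False iff by simp
    qed
  qed
  then have "H (S (s_perm i) g + sc \<gamma> g) (S (s_perm i) g + sc \<gamma> g) = norm_val T ?mu"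
    using H_s[OF i wt ne \<gamma>_def cnj_ev] norm norm_formula_s_perm[OF i lt, of ?a ?b, where 'r='r]
    by (simp only: norm_val_def ab)
  then show ?thesis
    unfolding is_eigenvector_def using triangular_s[OF tri T mu i lt] wt' by blast
qed

lemma compositions_zero:
  assumes "mu \<in> compositions n" "\<And>i. i \<in> {1..n} \<Longrightarrow> mu i = 0" shows "mu = (\<lambda>_. 0)"
  using assms by (auto simp: compositions_def fun_eq_iff)

text \<open>
  If \<open>\<mu>\<^sub>n > 0\<close> then \<open>\<mu>\<close> is in the image of \<open>phi_comp\<close>.  Otherwise the last nonzero entry can be
  moved to the right by an adjacent transposition.
\<close>

lemma eigenvector_exists:
  assumes T: "T \<in> SYT n lam" and mu: "mu \<in> compositions n"
  shows "\<exists>g. is_eigenvector mu T g"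
proof -
  \<comment> \<open>The first move lowers the sum of the entries; the second one keeps it and lowers the defect,
      in which a nonzero entry counts by its distance from the last position.\<close>
  define defect where "defect mu = (\<Sum>i = 1..n. if mu i = 0 then 0 else n - i)" for mu :: "nat \<Rightarrow> nat"
  show ?thesis
    using mu
  proof (induction mu rule: wf_induct_rule[OF wf_measures[of "[\<lambda>mu. \<Sum>i = 1..n. mu i, defect]"]])
    case (1 mu)
    note IH = 1(1) and mu = 1(2)
    consider "mu n > 0" | "mu n = 0" "\<exists>i\<in>{1..n}. mu i > 0" | "\<forall>i\<in>{1..n}. mu i = 0"
      using neq0_conv by blast
    then show ?case
    proof cases
      case 1
      define mu' where "mu' = mu(n := mu n - 1) \<circ> rot n"
      have mu_eq: "mu = phi_comp n mu'" unfolding mu'_def by (rule phi_comp_unrot[where mu = mu and n = n, OF n_pos 1])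
      have "mu(n := mu n - 1) \<in> compositions n" using mu by (auto simp: compositions_def)
      then have mu': "mu' \<in> compositions n"
        unfolding mu'_def by (rule comp_perm_in[OF rot_perm])
      have "(\<Sum>i = 1..n. mu' i) = (\<Sum>i = 1..n. (mu(n := mu n - 1)) i)"
        unfolding mu'_def using sum.permute[OF rot_perm, of "mu(n := mu n - 1)"] by (simp only: o_def)
      moreover have "(\<Sum>i = 1..n. (mu(n := mu n - 1)) i) = (mu n - 1) + (\<Sum>i\<in>{1..n} - {n}. mu i)"
        by (subst sum.remove[of _ n]) auto
      moreover have "(\<Sum>i = 1..n. mu i) = mu n + (\<Sum>i\<in>{1..n} - {n}. mu i)"
        by (subst sum.remove[of _ n]) auto
      ultimately have "(\<Sum>i = 1..n. mu' i) < (\<Sum>i = 1..n. mu i)" using 1 by simp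
      then have "(mu', mu) \<in> measures [\<lambda>mu. \<Sum>i = 1..n. mu i, defect]" by simp
      from IH[OF this mu'] obtain g where g: "is_eigenvector mu' T g" by blast
      from eigenvector_Phi[OF T mu' g] show ?thesis unfolding mu_eq[symmetric] by blast
    next
      case 2
      define i where "i = Max {i \<in> {1..n}. mu i > 0}"
      have "i \<in> {i \<in> {1..n}. mu i > 0}" unfolding i_def using 2(2) by (intro Max_in) auto
      then have i: "i \<in> {1..n}" "mu i > 0" by auto
      then have "i \<noteq> n" using 2(1) by auto
      then have i': "i \<in> {1..<n}" using i by auto
      have zero: "mu (i + 1) = 0"
      proof (rule ccontr)
        assume "mu (i + 1) \<noteq> 0"
        then have "i + 1 \<in> {i \<in> {1..n}. mu i > 0}" using i' by auto
        then have "i + 1 \<le> Max {i \<in> {1..n}. mu i > 0}" by (intro Max_ge) simp_all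
        then have "i + 1 \<le> i" unfolding i_def[symmetric] .
        then show False by simp
      qed
      define mu' where "mu' = mu \<circ> s_perm i"
      have mu': "mu' \<in> compositions n" unfolding mu'_def by (rule comp_perm_in[OF s_perm_perm[OF i'] mu])
      have mu_eq: "mu = mu' \<circ> s_perm i" by (simp add: mu'_def fun_eq_iff)
      have "(\<Sum>i = 1..n. mu' i) = (\<Sum>i = 1..n. mu i)"
        unfolding mu'_def using sum.permute[OF s_perm_perm[OF i'], of mu] by (simp only: o_def)
      moreover have "defect mu' < defect mu"
      proof -
        have i1: "i + 1 \<in> {1..n}" "i \<noteq> i + 1" using i' by auto
        have "(\<Sum>j\<in>{1..n} - {i, i + 1}. if mu' j = 0 then 0 else n - j) =
            (\<Sum>j\<in>{1..n} - {i, i + 1}. if mu j = 0 then 0 else n - j)"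
          by (rule sum.cong) (simp_all add: mu'_def s_perm_other)
        then show ?thesis
          unfolding defect_def sum_two_points[OF i(1) i1] using zero i(2) i'
          by (simp add: mu'_def) arith
      qed
      ultimately have "(mu', mu) \<in> measures [\<lambda>mu. \<Sum>i = 1..n. mu i, defect]" by simp
      from IH[OF this mu'] obtain g where g: "is_eigenvector mu' T g" by blast
      have "mu' i < mu' (i + 1)" using zero i(2) by (simp add: mu'_def)
      from eigenvector_s[OF T mu' g i' this] show ?thesis unfolding mu_eq[symmetric] .
    next
      case 3
      then have "mu = (\<lambda>_. 0)" by (intro compositions_zero[OF mu]) blast
      then show ?thesis using eigenvector_zero[OF T] by blast
    qed
  qed
qed

definition eigvec :: "(nat \<Rightarrow> nat) \<Rightarrow> tableau \<Rightarrow> 'm" where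
  "eigvec mu T = (SOME g. is_eigenvector mu T g)"

lemma eigvec:
  assumes "T \<in> SYT n lam" "mu \<in> compositions n"
  shows "eigvec mu T \<in> V" "i \<in> {1..n} \<Longrightarrow> z i (eigvec mu T) = sc (ev T mu i) (eigvec mu T)"
    "eigvec mu T - e mu T \<in> espan (below mu)" "H (eigvec mu T) (eigvec mu T) = norm_val T mu"
proof -
  have "is_eigenvector mu T (eigvec mu T)"
    unfolding eigvec_def using eigenvector_exists[OF assms] by (rule someI_ex)
  then show "eigvec mu T \<in> V" "i \<in> {1..n} \<Longrightarrow> z i (eigvec mu T) = sc (ev T mu i) (eigvec mu T)"
    "eigvec mu T - e mu T \<in> espan (below mu)" "H (eigvec mu T) (eigvec mu T) = norm_val T mu"
    by (simp_all add: is_eigenvector_def wt_def triangular_def)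
qed

text \<open>
  The eigenvectors and the vectors \<open>x\<^sup>\<mu>v\<^sub>T\<^sup>\<mu>\<close> are related by unitriangular matrices, and their spans are
  compared in the order \<open>height_less\<close>.
\<close>

definition lower :: "(nat \<Rightarrow> nat) \<Rightarrow> (nat \<Rightarrow> nat) set" where
  "lower mu = {nu \<in> compositions n. height_less n nu mu}"

definition gspan :: "(nat \<Rightarrow> nat) set \<Rightarrow> 'm set" where
  "gspan A = vs.span {eigvec nu T | nu T. nu \<in> A \<and> T \<in> SYT n lam}"

lemma gspan_mono: "A \<subseteq> B \<Longrightarrow> gspan A \<subseteq> gspan B"
  unfolding gspan_def by (rule vs.span_mono) blast

lemma eigvec_in_gspan: "nu \<in> A \<Longrightarrow> T \<in> SYT n lam \<Longrightarrow> eigvec nu T \<in> gspan A"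
  unfolding gspan_def by (rule vs.span_base) blast

lemma espan_subset_gspan:
  assumes e: "\<And>nu T. nu \<in> A \<Longrightarrow> T \<in> SYT n lam \<Longrightarrow> e nu T \<in> gspan B"
  shows "espan A \<subseteq> gspan B"
  unfolding espan_def
  by (rule vs.span_minimal) (use e in \<open>auto simp: gspan_def\<close>)

lemma espan_lower_subset:
  assumes mu: "mu \<in> compositions n"
    and lower: "\<And>nu T. nu \<in> lower mu \<Longrightarrow> T \<in> SYT n lam \<Longrightarrow> e nu T - eigvec nu T \<in> gspan (lower nu)"
  shows "espan (lower mu) \<subseteq> gspan (lower mu)"
proof (rule espan_subset_gspan)
  fix nu S' assume nu: "nu \<in> lower mu" and S': "S' \<in> SYT n lam"
  have "lower nu \<subseteq> lower mu" using nu height_less_trans unfolding lower_def by blast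
  then have 1: "e nu S' - eigvec nu S' \<in> gspan (lower mu)"
    using lower[OF nu S'] gspan_mono by blast
  have "(e nu S' - eigvec nu S') + eigvec nu S' \<in> gspan (lower mu)"
    using 1 eigvec_in_gspan[OF nu S'] unfolding gspan_def by (rule vs.span_add)
  then show "e nu S' \<in> gspan (lower mu)" by simp
qed

lemma below_subset_lower: "mu \<in> compositions n \<Longrightarrow> below mu \<subseteq> lower mu"
  using below_in steps_height_less by (auto simp: lower_def below_def)

lemma e_in_gspan:
  assumes "mu \<in> compositions n" "T \<in> SYT n lam"
  shows "e mu T - eigvec mu T \<in> gspan (lower mu)"
  using assms
proof (induction mu arbitrary: T rule: wfp_induct_rule[OF wfp_height_less[of n]])
  case (1 mu)
  note IH = 1(1) and mu = 1(2) and T = 1(3)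
  have "espan (lower mu) \<subseteq> gspan (lower mu)"
    by (rule espan_lower_subset[OF mu]) (use IH in \<open>auto simp: lower_def\<close>)
  then have "espan (below mu) \<subseteq> gspan (lower mu)"
    using espan_mono[OF below_subset_lower[OF mu]] by blast
  with eigvec(3)[OF T mu] have "eigvec mu T - e mu T \<in> gspan (lower mu)" by blast
  then have "- (eigvec mu T - e mu T) \<in> gspan (lower mu)" unfolding gspan_def by (rule vs.span_neg)
  then show ?case by simp
qed

text \<open>Orthogonality passes to the span because it defines a subspace in the first argument.\<close>

lemma H_gspan_zero:
  assumes w: "w \<in> V" and zero: "\<And>nu T. nu \<in> A \<Longrightarrow> T \<in> SYT n lam \<Longrightarrow> H (eigvec nu T) w = 0"
    and A: "A \<subseteq> compositions n" and x: "x \<in> gspan A"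
  shows "x \<in> V \<and> H x w = 0"
  using x unfolding gspan_def
proof (rule vs.span_induct)
  show "vs.subspace {x. x \<in> V \<and> H x w = 0}"
    using w by (auto simp: vs.subspace_def H_add H_sc H_0_left)
  show "x \<in> V \<and> H x w = 0" if "x \<in> {eigvec nu T | nu T. nu \<in> A \<and> T \<in> SYT n lam}" for x
    using that zero A eigvec(1) by auto
qed

text \<open>
  Modulo eigenvectors \<open>eigvec \<nu> S\<close> for lower \<open>\<nu>\<close>, the vector \<open>f\<close> is \<open>eigvec \<mu> T\<close>.  These \<open>\<nu>\<close> differ from
  \<open>\<mu>\<close>, so the \<open>\<kappa>\<close>-coefficients \<open>\<nu>\<^sub>i + 1\<close> of the eigenvalues separate them from \<open>\<mu>\<close>, and the lower
  part is orthogonal to \<open>eigvec \<mu> T\<close>.  Since \<open>f\<close> pairs with \<open>eigvec \<mu> T\<close> to a nonzero value, \<open>f\<close> has the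
  same eigenvalues, and so \<open>f\<close> is orthogonal to the lower part as well.
\<close>

theorem norm_of_eigenvector:
  assumes T: "T \<in> SYT n lam" and mu: "mu \<in> compositions n"
    and f: "f - e mu T \<in> espan (lower mu)"
    and eigen: "\<And>i. i \<in> {1..n} \<Longrightarrow> \<exists>c. z i f = sc c f"
  shows "H f f = norm_val T mu"
proof -
  let ?g = "eigvec mu T"
  define s where "s = f - ?g"
  note g = eigvec[OF T mu]
  have lower_in: "lower mu \<subseteq> compositions n" by (auto simp: lower_def)
  have "espan (lower mu) \<subseteq> gspan (lower mu)"
    by (rule espan_lower_subset[OF mu]) (use e_in_gspan lower_in in blast)
  with f have 1: "f - e mu T \<in> gspan (lower mu)" by blast
  have "(f - e mu T) + (e mu T - ?g) \<in> gspan (lower mu)"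
    using 1 e_in_gspan[OF mu T] unfolding gspan_def by (rule vs.span_add)
  then have s: "s \<in> gspan (lower mu)" by (simp add: s_def)
  have f_eq: "f = ?g + s" by (simp add: s_def)
  have separate: "\<exists>i\<in>{1..n}. ev S' nu i \<noteq> ev T mu i" if nu: "nu \<in> lower mu" for nu S'
  proof -
    have "nu \<noteq> mu" using nu height_less_irrefl by (auto simp: lower_def)
    then obtain i where i: "nu i \<noteq> mu i" by auto
    have "nu i = 0 \<and> mu i = 0" if "i \<notin> {1..n}"
      using that nu mu by (simp add: lower_def compositions_def)
    then have "i \<in> {1..n}" using i by (rule_tac ccontr) simp
    moreover have "ev S' nu i \<noteq> ev T mu i"
      unfolding ev_def by (rule ev_fac_neq) (use i in simp)
    ultimately show ?thesis by blast
  qed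
  have orth: "H (eigvec nu S') w = 0"
    if w: "w \<in> V" "\<And>i. i \<in> {1..n} \<Longrightarrow> z i w = sc (ev T mu i) w"
      and nu: "nu \<in> lower mu" and S': "S' \<in> SYT n lam" for w nu S'
  proof -
    obtain i where i: "i \<in> {1..n}" "ev S' nu i \<noteq> ev T mu i" using separate[OF nu] by blast
    have nu_in: "nu \<in> compositions n" using nu lower_in by blast
    show ?thesis
      by (rule H_orthogonal[OF i(1) eigvec(1)[OF S' nu_in] w(1) eigvec(2)[OF S' nu_in i(1)] w(2)[OF i(1)] cnj_ev i(2)])
  qed
  have sg: "s \<in> V \<and> H s ?g = 0"
    by (rule H_gspan_zero[OF g(1) orth[OF g(1,2)] lower_in s])
  then have sV: "s \<in> V" and fV: "f \<in> V" using g(1) by (auto simp: f_eq)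
  have Hfg: "H f ?g = norm_val T mu"
    using sg g(1) by (simp add: f_eq H_add g(4))
  have N: "norm_val T mu \<noteq> 0" unfolding norm_val_def by (rule norm_formula_nz)
  have eig_f: "z i f = sc (ev T mu i) f" if i: "i \<in> {1..n}" for i
  proof -
    obtain c where c: "z i f = sc c f" using eigen[OF i] by blast
    have "c * H f ?g = H (z i f) ?g" unfolding c by (rule H_sc[OF fV g(1), symmetric])
    also have "\<dots> = H f (z i ?g)" by (rule H_z[OF i fV g(1)])
    also have "\<dots> = ev T mu i * H f ?g" unfolding g(2)[OF i] H_sc_right[OF g(1) fV] cnj_ev ..
    finally have "c = ev T mu i" using N by (simp add: Hfg)
    with c show ?thesis by simp
  qed
  have sf: "s \<in> V \<and> H s f = 0"
    by (rule H_gspan_zero[OF fV orth[OF fV eig_f] lower_in s])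
  have "H ?g f = cnj_ratfun (H f ?g)" by (rule H_herm[OF fV g(1)])
  also have "\<dots> = norm_val T mu"
    using H_herm[OF g(1) g(1)] by (simp add: Hfg g(4))
  finally have "H ?g f = norm_val T mu" .
  moreover have "H f f = H ?g f + H s f"
    using H_add[OF g(1) sV fV] by (simp flip: f_eq)
  ultimately show ?thesis using sf by simp
qed

end

section \<open>The standard module as a module of functionals\<close>

lemma free_carrier_single: "set (letters w) \<subseteq> gens CARD('r) n \<Longrightarrow> Poly_Mapping.single w c \<in> (free_carrier n :: 'r free_alg set)"
  by (auto simp: free_carrier_def)

lemma free_carrier_closed [simp]:
  fixes a b :: "'r free_alg"
  shows "0 \<in> (free_carrier n :: 'r free_alg set)"
    "a \<in> free_carrier n \<Longrightarrow> b \<in> free_carrier n \<Longrightarrow> a + b \<in> free_carrier n"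
    "a \<in> free_carrier n \<Longrightarrow> b \<in> free_carrier n \<Longrightarrow> a * b \<in> free_carrier n"
    "scal c \<in> (free_carrier n :: 'r free_alg set)"
proof -
  show "0 \<in> (free_carrier n :: 'r free_alg set)" by (simp add: free_carrier_def)
  show "a + b \<in> free_carrier n" if "a \<in> free_carrier n" "b \<in> free_carrier n"
    using that Poly_Mapping.keys_add[of a b] unfolding free_carrier_def by blast
  show "a * b \<in> free_carrier n" if "a \<in> free_carrier n" "b \<in> free_carrier n"
    unfolding free_carrier_def
  proof clarify
    fix u x assume "u \<in> Poly_Mapping.keys (a * b)" "x \<in> set (letters u)"
    then obtain s t where "s \<in> Poly_Mapping.keys a" "t \<in> Poly_Mapping.keys b" "u = s + t"
      using Poly_Mapping.keys_mult[of a b] by blast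
    then show "x \<in> gens CARD('r) n"
      using that \<open>x \<in> set (letters u)\<close> by (auto simp: free_carrier_def plus_word_def)
  qed
  show "scal c \<in> (free_carrier n :: 'r free_alg set)"
    unfolding scal_def by (rule free_carrier_single) (simp add: zero_word_def)
qed

lemma scal_simps: "scal 1 = 1" "scal 0 = 0" "scal (c + c') = scal c + scal c'" "scal (c * c') = scal c * scal c'"
    "scal (- c) = - scal c"
  by (simp_all add: scal_def single_add mult_single single_uminus)

lemma one_in_free_carrier [simp]: "1 \<in> (free_carrier n :: 'r free_alg set)"
  using free_carrier_closed(4)[of 1 n] by (simp only: scal_simps)

lemma free_carrier_uminus [simp]: "a \<in> free_carrier n \<Longrightarrow> - a \<in> (free_carrier n :: 'r free_alg set)"
  by (simp add: free_carrier_def)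

lemma free_carrier_diff [simp]:
  "a \<in> free_carrier n \<Longrightarrow> b \<in> free_carrier n \<Longrightarrow> a - b \<in> (free_carrier n :: 'r free_alg set)"
  using free_carrier_closed(2)[of a n "- b"] by simp

lemma free_carrier_sum [simp]:
  "(\<And>i. i \<in> A \<Longrightarrow> f i \<in> free_carrier n) \<Longrightarrow> sum f A \<in> (free_carrier n :: 'r free_alg set)"
  by (induction A rule: infinite_finite_induct) auto

lemma free_carrier_power [simp]: "a \<in> free_carrier n \<Longrightarrow> a ^ k \<in> (free_carrier n :: 'r free_alg set)"
  by (induction k) auto

lemma free_carrier_gens [simp]:
  "i \<in> {1..n} \<Longrightarrow> x_el i \<in> (free_carrier n :: 'r free_alg set)"
  "i \<in> {1..n} \<Longrightarrow> y_el i \<in> (free_carrier n :: 'r free_alg set)"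
  "w \<in> monomial_group CARD('r) n \<Longrightarrow> t_el w \<in> (free_carrier n :: 'r free_alg set)"
  unfolding x_el_def y_el_def t_el_def by (auto intro!: free_carrier_single simp: gens_def)

lemma lookup_lmult: "Poly_Mapping.lookup (lmult a u) T = a * Poly_Mapping.lookup u T"
  by (simp add: lmult_def Poly_Mapping.map.rep_eq when_def)

lemma lmult_simps:
  "lmult a (u + w) = lmult a u + lmult a w" "lmult (a + b) u = lmult a u + lmult b u"
  "lmult (a - b) u = lmult a u - lmult b u" "lmult a (u - w) = lmult a u - lmult a w"
  "lmult a (lmult b u) = lmult (a * b) u" "lmult 1 u = u" "lmult 0 u = 0" "lmult a 0 = 0"
  "lmult (- a) u = - lmult a u"
  by (auto intro!: poly_mapping_eqI simp: lookup_lmult lookup_add lookup_minus algebra_simps)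

lemma lmult_single: "lmult a (Poly_Mapping.single T b) = Poly_Mapping.single T (a * b)"
  by (rule poly_mapping_eqI) (simp add: lookup_lmult lookup_single when_def)

lemma lmult_sum: "lmult (sum f A) u = (\<Sum>i\<in>A. lmult (f i) u)"
  by (induction A rule: infinite_finite_induct) (simp_all add: lmult_simps)

lemma lmult_sum_right: "lmult a (sum f A) = (\<Sum>i\<in>A. lmult a (f i))"
  by (induction A rule: infinite_finite_induct) (simp_all add: lmult_simps)

lemma module_carrier_closed [simp]:
  "0 \<in> module_carrier n lam"
  "u \<in> module_carrier n lam \<Longrightarrow> w \<in> module_carrier n lam \<Longrightarrow> u + w \<in> module_carrier n lam"
  "a \<in> free_carrier n \<Longrightarrow> u \<in> module_carrier n lam \<Longrightarrow> lmult a u \<in> module_carrier n lam"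
  "T \<in> SYT n lam \<Longrightarrow> a \<in> free_carrier n \<Longrightarrow> Poly_Mapping.single T a \<in> module_carrier n lam"
proof -
  show "u + w \<in> module_carrier n lam" if "u \<in> module_carrier n lam" "w \<in> module_carrier n lam"
    using that Poly_Mapping.keys_add[of u w] unfolding module_carrier_def
    by (auto simp: lookup_add)
  show "lmult a u \<in> module_carrier n lam" if "a \<in> free_carrier n" "u \<in> module_carrier n lam"
  proof -
    have "Poly_Mapping.keys (lmult a u) \<subseteq> Poly_Mapping.keys u"
      by (auto simp: in_keys_iff lookup_lmult)
    then show ?thesis using that unfolding module_carrier_def by (auto simp: lookup_lmult)
  qed
qed (auto simp: module_carrier_def lookup_single when_def)

lemma module_carrier_sum [simp]:
  "(\<And>i. i \<in> A \<Longrightarrow> f i \<in> module_carrier n lam) \<Longrightarrow> sum f A \<in> module_carrier n lam"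
  by (induction A rule: infinite_finite_induct) auto

lemma standard_relations_uminus:
  assumes "u \<in> standard_relations n lam" shows "- u \<in> standard_relations n lam"
  using standard_relations.lmult[OF free_carrier_closed(4)[of "-1"] assms]
  by (simp add: scal_simps lmult_simps)

lemma standard_relations_sum:
  "(\<And>i. i \<in> A \<Longrightarrow> f i \<in> standard_relations n lam) \<Longrightarrow> sum f A \<in> standard_relations n lam"
  by (induction A rule: infinite_finite_induct) (auto intro: standard_relations.intros)

lemma cherednik_ideal_relation: "p \<in> cherednik_relations n \<Longrightarrow> p \<in> cherednik_ideal n"
  unfolding cherednik_ideal_def genideal_def by blast

lemma cherednik_ideal_mult:
  assumes "p \<in> cherednik_ideal n" "a \<in> free_carrier n" shows "p * a \<in> cherednik_ideal n"
  unfolding cherednik_ideal_def genideal_def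
proof (rule InterI, clarify)
  fix I :: "'a free_alg set" assume I: "ideal I (free_ring n)" "cherednik_relations n \<subseteq> I"
  have "p \<in> I" using assms(1) I unfolding cherednik_ideal_def genideal_def by blast
  then show "p * a \<in> I"
    using ideal.I_r_closed[OF I(1) \<open>p \<in> I\<close>, of a] assms(2) by (simp add: free_ring_def)
qed

lemma sum_of_singles: "(\<Sum>T\<in>Poly_Mapping.keys u. Poly_Mapping.single T (Poly_Mapping.lookup u T)) = u"
  by (rule poly_mapping_eqI)
    (auto simp: lookup_sum lookup_single when_def sum.delta in_keys_iff)

lemma relation_in_standard:
  assumes "p \<in> cherednik_relations n" "u \<in> module_carrier n lam"
  shows "lmult p u \<in> standard_relations n lam"
proof -
  have "lmult p u = (\<Sum>T\<in>Poly_Mapping.keys u. lmult p (Poly_Mapping.single T (Poly_Mapping.lookup u T)))"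
    by (simp only: sum_of_singles flip: lmult_sum_right)
  also have "\<dots> \<in> standard_relations n lam"
    unfolding lmult_single
    using assms(2) cherednik_ideal_relation[OF assms(1)]
    by (intro standard_relations_sum standard_relations.ideal cherednik_ideal_mult)
      (auto simp: module_carrier_def)
  finally show ?thesis .
qed

lemma equiv_standard_eq: "equiv (module_carrier n lam) (standard_eq n lam)"
proof (rule equivI)
  show "refl_on (module_carrier n lam) (standard_eq n lam)"
    by (auto simp: refl_on_def standard_eq_def intro: standard_relations.zero)
  show "sym (standard_eq n lam)"
    by (rule symI) (auto simp: standard_eq_def dest: standard_relations_uminus)
  show "trans (standard_eq n lam)"
  proof (rule transI)
    fix x y z assume "(x, y) \<in> standard_eq n lam" "(y, z) \<in> standard_eq n lam"
    then show "(x, z) \<in> standard_eq n lam"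
      using standard_relations.add[of "x - y" n lam "y - z"] by (auto simp: standard_eq_def)
  qed
qed (auto simp: standard_eq_def)

lemma cls_eq:
  "u \<in> module_carrier n lam \<Longrightarrow> w \<in> module_carrier n lam \<Longrightarrow> u - w \<in> standard_relations n lam \<Longrightarrow>
    cls n lam u = cls n lam w"
  unfolding cls_def by (rule equiv_class_eq[OF equiv_standard_eq]) (simp add: standard_eq_def)

lemma mem_cls: "w \<in> cls n lam u \<longleftrightarrow>
    u \<in> module_carrier n lam \<and> w \<in> module_carrier n lam \<and> u - w \<in> standard_relations n lam"
  by (auto simp: cls_def standard_eq_def)

lemma cls_in [simp]: "u \<in> module_carrier n lam \<Longrightarrow> cls n lam u \<in> standard_module n lam"
  unfolding cls_def standard_module_def by (rule quotientI)

lemma M_act_cls: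
  assumes a: "a \<in> free_carrier n" and u: "u \<in> module_carrier n lam"
  shows "M_act n lam a (cls n lam u) = cls n lam (lmult a u)"
proof -
  have "cls n lam (lmult a w) = cls n lam (lmult a u)" if "w \<in> cls n lam u" for w
  proof -
    have w: "w \<in> module_carrier n lam" "u - w \<in> standard_relations n lam" using that by (auto simp: mem_cls)
    then have "lmult a u - lmult a w \<in> standard_relations n lam"
      using standard_relations.lmult[OF a w(2)] by (simp add: lmult_simps)
    then show ?thesis using cls_eq[of "lmult a u" n lam "lmult a w"] a u w by simp
  qed
  moreover have "u \<in> cls n lam u" using u by (simp add: mem_cls standard_relations.zero)
  ultimately show ?thesis unfolding M_act_def by blast
qed

lemma M_add_cls:
  assumes u: "u \<in> module_carrier n lam" and w: "w \<in> module_carrier n lam"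
  shows "M_add n lam (cls n lam u) (cls n lam w) = cls n lam (u + w)"
proof -
  have "cls n lam (u' + w') = cls n lam (u + w)" if "u' \<in> cls n lam u" "w' \<in> cls n lam w" for u' w'
  proof -
    have m: "u' \<in> module_carrier n lam" "u - u' \<in> standard_relations n lam"
      "w' \<in> module_carrier n lam" "w - w' \<in> standard_relations n lam" using that by (auto simp: mem_cls)
    then have "(u + w) - (u' + w') \<in> standard_relations n lam"
      using standard_relations.add[OF m(2,4)] by (simp add: algebra_simps)
    then show ?thesis using cls_eq[of "u + w" n lam "u' + w'"] u w m by simp
  qed
  moreover have "u \<in> cls n lam u" "w \<in> cls n lam w" using u w by (simp_all add: mem_cls standard_relations.zero)
  ultimately show ?thesis unfolding M_add_def by blast
qed

lemma lookup_one_tensor: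
  "Poly_Mapping.lookup (one_tensor u) T = scal (cconst (Poly_Mapping.lookup u T))"
  by (simp add: one_tensor_def Poly_Mapping.map.rep_eq when_def scal_simps)

lemma one_tensor_add: "one_tensor (u + w) = one_tensor u + one_tensor w"
  by (rule poly_mapping_eqI) (simp add: lookup_one_tensor lookup_add cconst_add scal_simps)

lemma one_tensor_single: "one_tensor (Poly_Mapping.single T c) = lmult (scal (cconst c)) (Poly_Mapping.single T 1)"
  by (rule poly_mapping_eqI) (simp add: lookup_one_tensor lookup_lmult lookup_single when_def scal_simps)

text \<open>
  The standard module is a quotient that depends on \<open>n\<close> and \<open>\<lambda>\<close>.  To compute with equations between
  elements of a type, each vector is replaced by the functional that pairs it with all vectors.
  The algebra acts on such functionals by adjoint operators.
\<close>

locale standard_form =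
  fixes n :: nat and lam :: "nat list list"
    and B0 :: "specht \<Rightarrow> specht \<Rightarrow> complex"
    and B :: "'r::finite free_module set \<Rightarrow> 'r free_module set \<Rightarrow> 'r ratfun"
  assumes n_pos: "n \<ge> 1"
    and lam: "is_multipartition CARD('r) n lam"
    and B0: "is_specht_form CARD('r) n lam B0"
    and B: "is_contravariant_form n lam B0 B"
begin

abbreviation C :: "'r free_module set" where "C \<equiv> module_carrier n lam"
abbreviation A :: "'r free_alg set" where "A \<equiv> free_carrier n"

definition b :: "'r free_module \<Rightarrow> 'r free_module \<Rightarrow> 'r ratfun" where
  "b u w = B (cls n lam u) (cls n lam w)"

lemma b_add: "u \<in> C \<Longrightarrow> u' \<in> C \<Longrightarrow> w \<in> C \<Longrightarrow> b (u + u') w = b u w + b u' w"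
  unfolding b_def
  using B[unfolded is_contravariant_form_def, THEN conjunct1, rule_format,
      of "cls n lam u" "cls n lam u'" "cls n lam w"]
  by (simp add: M_add_cls)

lemma b_all:
  assumes "u \<in> C" "w \<in> C"
  shows b_scal: "b (lmult (scal c) u) w = c * b u w"
    and b_herm: "b w u = cnj_ratfun (b u w)"
    and b_t: "p \<in> monomial_group CARD('r) n \<Longrightarrow> b (lmult (t_el p) u) (lmult (t_el p) w) = b u w"
    and b_x_lin: "b (lmult (x_lin n k) u) w = b u (lmult (y_lin n (\<lambda>i. cnj (k i))) w)"
    and b_y_lin: "b (lmult (y_lin n k) u) w = b u (lmult (x_lin n (\<lambda>i. cnj (k i))) w)"
proof -
  have lin: "x_lin n k \<in> A" "y_lin n k \<in> A" for k
    unfolding x_lin_def y_lin_def by (auto intro!: free_carrier_sum)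
  have cl: "cls n lam u \<in> standard_module n lam" "cls n lam w \<in> standard_module n lam"
    using assms by simp_all
  note * = B[unfolded is_contravariant_form_def, THEN conjunct2, THEN conjunct1, rule_format, OF cl]
  show "b (lmult (scal c) u) w = c * b u w"
    unfolding b_def using conjunct1[OF *, rule_format, of c] assms by (simp add: M_act_cls)
  show "b w u = cnj_ratfun (b u w)"
    unfolding b_def using conjunct1[OF conjunct2[OF *]] .
  show "b (lmult (t_el p) u) (lmult (t_el p) w) = b u w" if "p \<in> monomial_group CARD('r) n"
    unfolding b_def using conjunct1[OF conjunct2[OF conjunct2[OF *]]] that assms by (simp add: M_act_cls)
  show "b (lmult (x_lin n k) u) w = b u (lmult (y_lin n (\<lambda>i. cnj (k i))) w)"
    unfolding b_def
    using conjunct1[OF conjunct2[OF conjunct2[OF conjunct2[OF *]]], rule_format, of k] assms lin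
    by (simp add: M_act_cls)
  show "b (lmult (y_lin n k) u) w = b u (lmult (x_lin n (\<lambda>i. cnj (k i))) w)"
    unfolding b_def
    using conjunct2[OF conjunct2[OF conjunct2[OF conjunct2[OF *]]], rule_format, of k] assms lin
    by (simp add: M_act_cls)
qed

lemma lin_unit:
  assumes "j \<in> {1..n}"
  shows "x_lin n (\<lambda>i. if i = j then 1 else 0) = (x_el j :: 'r free_alg)"
    "y_lin n (\<lambda>i. if i = j then 1 else 0) = (y_el j :: 'r free_alg)"
proof -
  have *: "(\<Sum>i = 1..n. scal (cconst (if i = j then 1 else 0)) * f i) = (f j :: 'r free_alg)" for f :: "nat \<Rightarrow> 'r free_alg"
  proof -
    have "(\<Sum>i = 1..n. scal (cconst (if i = j then 1 else 0)) * f i) = (\<Sum>i = 1..n. if i = j then f i else 0)"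
      by (rule sum.cong) (simp_all add: scal_simps)
    then show ?thesis using assms by simp
  qed
  show "x_lin n (\<lambda>i. if i = j then 1 else 0) = (x_el j :: 'r free_alg)"
    "y_lin n (\<lambda>i. if i = j then 1 else 0) = (y_el j :: 'r free_alg)"
    unfolding x_lin_def y_lin_def by (rule *)+
qed

lemma cnj_unit: "(\<lambda>i. cnj (if i = j then 1 else 0)) = (\<lambda>i. if i = j then 1 else 0)"
  by auto

lemma b_x: "j \<in> {1..n} \<Longrightarrow> u \<in> C \<Longrightarrow> w \<in> C \<Longrightarrow> b (lmult (x_el j) u) w = b u (lmult (y_el j) w)"
  using b_x_lin[of u w "\<lambda>i. if i = j then 1 else 0"] by (simp only: cnj_unit lin_unit)

lemma b_y: "j \<in> {1..n} \<Longrightarrow> u \<in> C \<Longrightarrow> w \<in> C \<Longrightarrow> b (lmult (y_el j) u) w = b u (lmult (x_el j) w)"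
  using b_y_lin[of u w "\<lambda>i. if i = j then 1 else 0"] by (simp only: cnj_unit lin_unit)

text \<open>
  Two vectors of the standard module have the same image under \<open>emb\<close> if and only if they differ by an
  element of the radical of the form.
\<close>

definition emb :: "'r free_module \<Rightarrow> 'r free_module \<Rightarrow> 'r ratfun" where
  "emb u = (\<lambda>w. if w \<in> C then b u w else 0)"

text \<open>
  The action on functionals is defined by the adjoint \<open>a\<close> of an algebra element, which is \<open>y\<^sub>i\<close> for \<open>x\<^sub>i\<close>
  and the inverse for a group element.
\<close>

definition pull :: "'r free_alg \<Rightarrow> ('r free_module \<Rightarrow> 'r ratfun) \<Rightarrow> 'r free_module \<Rightarrow> 'r ratfun" where
  "pull a \<phi> = (\<lambda>w. if w \<in> C then \<phi> (lmult a w) else 0)"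

definition fscale :: "'r ratfun \<Rightarrow> ('r free_module \<Rightarrow> 'r ratfun) \<Rightarrow> 'r free_module \<Rightarrow> 'r ratfun" where
  "fscale c \<phi> = (\<lambda>w. c * \<phi> w)"

definition opX :: "nat \<Rightarrow> ('r free_module \<Rightarrow> 'r ratfun) \<Rightarrow> 'r free_module \<Rightarrow> 'r ratfun" where
  "opX i = pull (y_el i)"

definition opY :: "nat \<Rightarrow> ('r free_module \<Rightarrow> 'r ratfun) \<Rightarrow> 'r free_module \<Rightarrow> 'r ratfun" where
  "opY i = pull (x_el i)"

definition opS :: "(nat \<Rightarrow> nat) \<Rightarrow> ('r free_module \<Rightarrow> 'r ratfun) \<Rightarrow> 'r free_module \<Rightarrow> 'r ratfun" where
  "opS p = pull (t_el (perm_mat n (inv_into UNIV p)))"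

definition opZ :: "nat \<Rightarrow> int \<Rightarrow> ('r free_module \<Rightarrow> 'r ratfun) \<Rightarrow> 'r free_module \<Rightarrow> 'r ratfun" where
  "opZ i l = pull (t_el (zeta_mat CARD('r) n i (- l)))"

definition form :: "('r free_module \<Rightarrow> 'r ratfun) \<Rightarrow> ('r free_module \<Rightarrow> 'r ratfun) \<Rightarrow> 'r ratfun" where
  "form \<phi> \<psi> = \<phi> (SOME w. w \<in> C \<and> emb w = \<psi>)"

definition vec :: "tableau \<Rightarrow> 'r free_module \<Rightarrow> 'r ratfun" where
  "vec T = emb (Poly_Mapping.single T 1)"

lemma vector_space_fscale: "vector_space fscale"
  by unfold_locales (auto simp: fscale_def fun_eq_iff algebra_simps)

lemma pull_linear: "Vector_Spaces.linear fscale fscale (pull a)"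
  unfolding Vector_Spaces.linear_iff using vector_space_fscale
  by (auto simp: pull_def fscale_def fun_eq_iff)

lemma emb_cong: "cls n lam u = cls n lam w \<Longrightarrow> emb u = emb w"
  by (auto simp: emb_def b_def fun_eq_iff)

lemma emb_add: "u \<in> C \<Longrightarrow> w \<in> C \<Longrightarrow> emb (u + w) = emb u + emb w"
  by (auto simp: emb_def fun_eq_iff b_add)

lemma emb_scal: "u \<in> C \<Longrightarrow> emb (lmult (scal c) u) = fscale c (emb u)"
  by (auto simp: emb_def fun_eq_iff fscale_def b_scal)

lemma emb_0: "emb 0 = 0"
  using emb_scal[of 0 0] by (simp add: lmult_simps fscale_def fun_eq_iff)

lemma emb_uminus: "u \<in> C \<Longrightarrow> emb (- u) = - emb u"
  using emb_scal[of u "-1"] by (simp add: scal_simps lmult_simps fscale_def fun_eq_iff)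

lemma C_uminus [simp]: "u \<in> C \<Longrightarrow> - u \<in> C"
  using module_carrier_closed(3)[of "scal (-1)" n u lam] by (simp add: scal_simps lmult_simps)

lemma C_diff [simp]: "u \<in> C \<Longrightarrow> w \<in> C \<Longrightarrow> u - w \<in> C"
  using module_carrier_closed(2)[of u n lam "- w"] by simp

lemma emb_diff: "u \<in> C \<Longrightarrow> w \<in> C \<Longrightarrow> emb (u - w) = emb u - emb w"
  using emb_add[of u "- w"] by (simp add: emb_uminus)

lemma emb_sum: "(\<And>i. i \<in> I \<Longrightarrow> f i \<in> C) \<Longrightarrow> emb (sum f I) = (\<Sum>i\<in>I. emb (f i))"
  by (induction I rule: infinite_finite_induct) (auto simp: emb_0 emb_add)

lemma emb_relation_zero: "u \<in> C \<Longrightarrow> u \<in> standard_relations n lam \<Longrightarrow> emb u = 0"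
  using cls_eq[of u n lam 0] emb_cong[of u 0] by (simp add: emb_0)

lemma emb_relation:
  assumes "a - a' \<in> cherednik_relations n" "a \<in> A" "a' \<in> A" "u \<in> C"
  shows "emb (lmult a u) = emb (lmult a' u)"
proof -
  have "emb (lmult (a - a') u) = 0"
    using relation_in_standard[OF assms(1,4)] assms by (intro emb_relation_zero) auto
  then show ?thesis using assms by (simp add: lmult_simps emb_diff)
qed

text \<open>
  The value of the form does not depend on the chosen representative of the second argument,
  because the form is Hermitian.
\<close>

lemma form_emb:
  assumes u: "u \<in> C" and w: "w \<in> C"
  shows "form (emb u) (emb w) = b u w"
proof -
  define w' where "w' = (SOME w'. w' \<in> C \<and> emb w' = emb w)"
  have w': "w' \<in> C" "emb w' = emb w"
    using someI[of "\<lambda>w'. w' \<in> C \<and> emb w' = emb w" w] w by (auto simp: w'_def)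
  have "b w' u = b w u" using fun_cong[OF w'(2), of u] u by (simp add: emb_def)
  then have "b u w' = b u w" by (simp add: b_herm[OF w'(1) u] b_herm[OF w u])
  moreover have "form (emb u) (emb w) = emb u w'" by (simp only: form_def w'_def)
  ultimately show ?thesis using w'(1) by (simp add: emb_def)
qed

lemma pull_emb:
  assumes "a \<in> A" "a' \<in> A" "u \<in> C" "\<And>w. w \<in> C \<Longrightarrow> b (lmult a u) w = b u (lmult a' w)"
  shows "pull a' (emb u) = emb (lmult a u)"
  using assms by (auto simp: pull_def emb_def fun_eq_iff)

lemma opX_emb: "i \<in> {1..n} \<Longrightarrow> u \<in> C \<Longrightarrow> opX i (emb u) = emb (lmult (x_el i) u)"
  unfolding opX_def by (rule pull_emb) (auto simp: b_x)

lemma opY_emb: "i \<in> {1..n} \<Longrightarrow> u \<in> C \<Longrightarrow> opY i (emb u) = emb (lmult (y_el i) u)"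
  unfolding opY_def by (rule pull_emb) (auto simp: b_y)

lemma emb_t_mult:
  assumes "p \<in> monomial_group CARD('r) n" "q \<in> monomial_group CARD('r) n" "p * q \<in> monomial_group CARD('r) n" "u \<in> C"
  shows "emb (lmult (t_el p * t_el q) u) = emb (lmult (t_el (p * q)) u)"
  using assms by (intro emb_relation cherednik_relations.t_mult) auto

lemma one_in_G: "1\<^sub>m n \<in> monomial_group CARD('r) n"
  using perm_mat_in_group[OF permutes_id, of "CARD('r)" n] by (simp add: perm_mat_id)

lemma emb_t_one: "u \<in> C \<Longrightarrow> emb (lmult (t_el (1\<^sub>m n)) u) = emb u"
  using emb_relation[OF cherednik_relations.t_one, of u] one_in_G by (simp add: lmult_simps)

lemma b_cong_right:
  assumes "u \<in> C" "w \<in> C" "w' \<in> C" "emb w = emb w'" shows "b u w = b u w'"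
  using form_emb[OF assms(1,2)] form_emb[OF assms(1,3)] assms(4) by simp

text \<open>Invariance of the form says that the adjoint of a group element is its inverse.\<close>

lemma pull_t:
  assumes "p \<in> monomial_group CARD('r) n" "q \<in> monomial_group CARD('r) n" "p * q = 1\<^sub>m n" "u \<in> C"
  shows "pull (t_el q) (emb u) = emb (lmult (t_el p) u)"
proof (rule pull_emb)
  fix w assume w: "w \<in> C"
  have "b (lmult (t_el p) u) w = b (lmult (t_el p) u) (lmult (t_el p) (lmult (t_el q) w))"
    using assms w emb_t_mult[OF assms(1,2), of w] one_in_G
    by (intro b_cong_right) (auto simp: lmult_simps emb_t_one)
  also have "\<dots> = b u (lmult (t_el q) w)" using assms w by (intro b_t) auto
  finally show "b (lmult (t_el p) u) w = b u (lmult (t_el q) w)" .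
qed (use assms in auto)

lemma perm_in_G [simp]: "p permutes {1..n} \<Longrightarrow> perm_mat n p \<in> monomial_group CARD('r) n"
  by (simp add: perm_mat_in_group)

lemma zeta_in_G [simp]: "zeta_mat CARD('r) n i l \<in> monomial_group CARD('r) n"
  by (simp add: zeta_mat_in_group)

lemma opS_emb: "p permutes {1..n} \<Longrightarrow> u \<in> C \<Longrightarrow> opS p (emb u) = emb (lmult (t_el (perm_mat n p)) u)"
  unfolding opS_def by (rule pull_t) (simp_all add: permutes_inv mono_mat_inverse_mult)

lemma opZ_emb: "u \<in> C \<Longrightarrow> opZ i l (emb u) = emb (lmult (t_el (zeta_mat CARD('r) n i l)) u)"
  unfolding opZ_def by (rule pull_t) (simp_all add: zeta_mat_times zeta_mat_0)

lemmas op_emb = opX_emb opY_emb opS_emb opZ_emb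

lemma emb_T_T:
  assumes "p \<in> monomial_group CARD('r) n" "q \<in> monomial_group CARD('r) n" "p * q \<in> monomial_group CARD('r) n" "u \<in> C"
  shows "emb (lmult (t_el p) (lmult (t_el q) u)) = emb (lmult (t_el (p * q)) u)"
  using emb_t_mult[OF assms] by (simp add: lmult_simps)

lemma refl_emb:
  assumes ij: "i \<in> {1..n}" "j \<in> {1..n}" and u: "u \<in> C"
  shows "opZ i (int l) (opS (Transposition.transpose i j) (opZ i (- int l) (emb u))) =
    emb (lmult (t_el (refl_mat CARD('r) n i j l)) u)"
proof -
  let ?p = "perm_mat n (Transposition.transpose i j)" and ?z = "zeta_mat CARD('r) n i"
  have tr: "Transposition.transpose i j permutes {1..n}" using ij by (rule permutes_swap_id)
  have pz: "?p * ?z (- int l) \<in> monomial_group CARD('r) n" using perm_zeta_mat_in_group[OF tr] by simp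
  have r: "?z (int l) * (?p * ?z (- int l)) \<in> monomial_group CARD('r) n"
    using refl_mat_in_group[OF ij, of "CARD('r)" l] by (simp add: refl_mat_assoc)
  have "opZ i (int l) (opS (Transposition.transpose i j) (opZ i (- int l) (emb u))) =
      opZ i (int l) (emb (lmult (t_el ?p) (lmult (t_el (?z (- int l))) u)))"
    using u tr by (simp add: op_emb)
  also have "emb (lmult (t_el ?p) (lmult (t_el (?z (- int l))) u)) = emb (lmult (t_el (?p * ?z (- int l))) u)"
    using u tr pz by (intro emb_T_T) simp_all
  finally show ?thesis
    using u pz r emb_T_T[of "?z (int l)" "?p * ?z (- int l)" u] by (simp add: op_emb refl_mat_assoc)
qed

lemma emb_scal_mult: "a \<in> A \<Longrightarrow> u \<in> C \<Longrightarrow> emb (lmult (scal c * a) u) = fscale c (emb (lmult a u))"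
  using emb_scal[of "lmult a u" c] by (simp add: lmult_simps)

lemma emb_lmult_add: "a \<in> A \<Longrightarrow> a' \<in> A \<Longrightarrow> u \<in> C \<Longrightarrow> emb (lmult (a + a') u) = emb (lmult a u) + emb (lmult a' u)"
  by (simp add: lmult_simps emb_add)

lemma emb_lmult_diff: "a \<in> A \<Longrightarrow> a' \<in> A \<Longrightarrow> u \<in> C \<Longrightarrow> emb (lmult (a - a') u) = emb (lmult a u) - emb (lmult a' u)"
  by (simp add: lmult_simps emb_diff)

lemma emb_lmult_sum: "(\<And>i. i \<in> I \<Longrightarrow> f i \<in> A) \<Longrightarrow> u \<in> C \<Longrightarrow> emb (lmult (sum f I) u) = (\<Sum>i\<in>I. emb (lmult (f i) u))"
  by (simp add: lmult_sum emb_sum)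

lemma refl_in_G: "i \<in> {1..n} \<Longrightarrow> j \<in> {1..n} \<Longrightarrow> refl_mat CARD('r) n i j l \<in> monomial_group CARD('r) n"
  by (rule refl_mat_in_group) auto

lemma emb_delta:
  assumes c: "\<And>i. i \<in> {1..n} \<Longrightarrow> c i = (if i = k then c' else 0)" and k: "k \<in> {1..n}"
    and f: "\<And>i. i \<in> {1..n} \<Longrightarrow> f i \<in> A" and a: "a \<in> A" and u: "u \<in> C"
  shows "emb (lmult ((\<Sum>i = 1..n. scal (cconst (c i)) * f i) * a) u) = fscale (cconst c') (emb (lmult (f k) (lmult a u)))"
proof -
  have "(\<Sum>i = 1..n. scal (cconst (c i)) * f i) = (\<Sum>i = 1..n. if i = k then scal (cconst c') * f i else 0)"
    by (rule sum.cong) (simp_all add: c scal_simps)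
  also have "\<dots> = scal (cconst c') * f k" using k by simp
  finally have "(\<Sum>i = 1..n. scal (cconst (c i)) * f i) = scal (cconst c') * f k" .
  then show ?thesis
    using k f[OF k] a u by (simp add: mult.assoc emb_scal_mult lmult_simps)
qed

end

context standard_form
begin

definition V :: "('r free_module \<Rightarrow> 'r ratfun) set" where
  "V = emb ` C"

lemma emb_in_V [simp]: "u \<in> C \<Longrightarrow> emb u \<in> V"
  by (simp add: V_def)

lemma VE: assumes "u \<in> V" obtains w where "w \<in> C" "u = emb w"
  using assms by (auto simp: V_def)

lemma opS_S:
  assumes p: "p permutes {1..n}" and q: "q permutes {1..n}" and w: "w \<in> C"
  shows "opS p (opS q (emb w)) = opS (p \<circ> q) (emb w)"
proof -
  have pq: "p \<circ> q permutes {1..n}" by (rule permutes_compose[OF q p])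
  show ?thesis
    using p q w pq emb_T_T[of "perm_mat n p" "perm_mat n q" w] by (simp add: opS_emb perm_mat_times)
qed

lemma opS_id: "w \<in> C \<Longrightarrow> opS id (emb w) = emb w"
  using opS_emb[OF permutes_id, of w] by (simp add: perm_mat_id emb_t_one)

lemma opZ_Z: "w \<in> C \<Longrightarrow> opZ i l (opZ i m (emb w)) = opZ i (l + m) (emb w)"
  using emb_T_T[of "zeta_mat CARD('r) n i l" "zeta_mat CARD('r) n i m" w]
  by (simp add: opZ_emb zeta_mat_times)

lemma opZ_0: "w \<in> C \<Longrightarrow> opZ i 0 (emb w) = emb w"
  by (simp add: opZ_emb zeta_mat_0 emb_t_one)

lemma opS_Z:
  assumes p: "p permutes {1..n}" and w: "w \<in> C"
  shows "opS p (opZ i l (emb w)) = opZ (p i) l (opS p (emb w))"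
proof -
  have G: "perm_mat n p * zeta_mat CARD('r) n i l \<in> monomial_group CARD('r) n"
    by (rule perm_zeta_mat_in_group[OF p]) simp
  have eq: "perm_mat n p * zeta_mat CARD('r) n i l = zeta_mat CARD('r) n (p i) l * perm_mat n p"
    by (rule perm_mat_zeta_mat[OF p])
  show ?thesis
    using p w G emb_T_T[of "perm_mat n p" "zeta_mat CARD('r) n i l" w]
      emb_T_T[of "zeta_mat CARD('r) n (p i) l" "perm_mat n p" w]
    by (simp add: opZ_emb opS_emb eq)
qed

lemma opX_X:
  assumes "i \<in> {1..n}" "j \<in> {1..n}" "w \<in> C"
  shows "opX i (opX j (emb w)) = opX j (opX i (emb w))"
  using emb_relation[OF cherednik_relations.x_x[OF assms(1,2)], of w] assms
  by (simp add: opX_emb lmult_simps)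

lemma opS_X:
  assumes p: "p permutes {1..n}" and j: "j \<in> {1..n}" and w: "w \<in> C"
  shows "opS p (opX j (emb w)) = opX (p j) (opS p (emb w))"
proof -
  let ?p = "perm_mat n p" and ?v = "perm_mat n (inv_into UNIV p)"
  have pj: "p j \<in> {1..n}" using permutes_in_image[OF p] j by blast
  have G: "?p \<in> monomial_group CARD('r) n" "?v \<in> monomial_group CARD('r) n"
    using p permutes_inv[OF p] by simp_all
  have entry: "entry ?v j i = (if i = p j then 1 else 0)" if "i \<in> {1..n}" for i
    using that j permutes_inverses[OF p] by (auto simp: perm_mat_eq entry_mono_mat)
  have "emb (lmult (t_el ?p * x_el j) w) = emb (lmult ((\<Sum>i = 1..n. scal (cconst (entry ?v j i)) * x_el i) * t_el ?p) w)"
    using G j w by (intro emb_relation cherednik_relations.t_x mono_mat_inverse_mult p)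
      (auto intro!: free_carrier_sum free_carrier_closed(3))
  also have "\<dots> = fscale (cconst 1) (emb (lmult (x_el (p j)) (lmult (t_el ?p) w)))"
    using G by (intro emb_delta entry pj w) auto
  finally show ?thesis
    using p j pj w G by (simp add: opX_emb opS_emb lmult_simps fscale_def)
qed

lemma opS_Y:
  assumes p: "p permutes {1..n}" and j: "j \<in> {1..n}" and w: "w \<in> C"
  shows "opS p (opY j (emb w)) = opY (p j) (opS p (emb w))"
proof -
  let ?p = "perm_mat n p"
  have pj: "p j \<in> {1..n}" using permutes_in_image[OF p] j by blast
  have G: "?p \<in> monomial_group CARD('r) n" using p by simp
  have entry: "entry ?p i j = (if i = p j then 1 else 0)" if "i \<in> {1..n}" for i
    using that j by (simp add: perm_mat_eq entry_mono_mat)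
  have "emb (lmult (t_el ?p * y_el j) w) = emb (lmult ((\<Sum>i = 1..n. scal (cconst (entry ?p i j)) * y_el i) * t_el ?p) w)"
    using G j w by (intro emb_relation cherednik_relations.t_y)
      (auto intro!: free_carrier_sum free_carrier_closed(3))
  also have "\<dots> = fscale (cconst 1) (emb (lmult (y_el (p j)) (lmult (t_el ?p) w)))"
    using G by (intro emb_delta entry pj w) auto
  finally show ?thesis
    using p j pj w G by (simp add: opY_emb opS_emb lmult_simps fscale_def)
qed

lemma opZ_X:
  assumes j: "j \<in> {1..n}" and w: "w \<in> C"
  shows "opZ i l (opX j (emb w)) =
    fscale (cconst (if j = i then zeta CARD('r) powi (- l) else 1)) (opX j (opZ i l (emb w)))"
proof -
  let ?p = "zeta_mat CARD('r) n i l" and ?v = "zeta_mat CARD('r) n i (- l)"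
  have entry: "entry ?v j k = (if k = j then (if j = i then zeta CARD('r) powi (- l) else 1) else 0)"
    if "k \<in> {1..n}" for k
    using that j by (auto simp: zeta_mat_eq entry_mono_mat)
  have "emb (lmult (t_el ?p * x_el j) w) = emb (lmult ((\<Sum>i = 1..n. scal (cconst (entry ?v j i)) * x_el i) * t_el ?p) w)"
    using j w by (intro emb_relation cherednik_relations.t_x)
      (auto simp: zeta_mat_times zeta_mat_0 intro!: free_carrier_sum free_carrier_closed(3))
  also have "\<dots> = fscale (cconst (if j = i then zeta CARD('r) powi (- l) else 1)) (emb (lmult (x_el j) (lmult (t_el ?p) w)))"
    by (intro emb_delta entry j w) auto
  finally show ?thesis
    using j w by (simp add: opX_emb opZ_emb lmult_simps)
qed

lemma opY_X_other:
  assumes ij: "i \<in> {1..n}" "j \<in> {1..n}" "i \<noteq> j" and w: "w \<in> C"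
  shows "opY i (opX j (emb w)) = opX j (opY i (emb w)) +
    fscale c0 (\<Sum>l<CARD('r). fscale (cconst (zeta CARD('r) powi (- int l)))
      (opZ i (int l) (opS (Transposition.transpose i j) (opZ i (- int l) (emb w)))))"
proof -
  have G: "refl_mat CARD('r) n i j l \<in> monomial_group CARD('r) n" for l by (rule refl_in_G[OF ij(1,2)])
  have "emb (lmult (y_el i * x_el j) w) = emb (lmult (x_el j * y_el i + scal c0 * (\<Sum>l<CARD('r).
      scal (cconst (zeta CARD('r) powi (- int l))) * t_el (refl_mat CARD('r) n i j l))) w)"
    using ij w G by (intro emb_relation cherednik_relations.y_x_distinct) auto
  also have "\<dots> = emb (lmult (x_el j * y_el i) w) + fscale c0 (\<Sum>l<CARD('r).
      fscale (cconst (zeta CARD('r) powi (- int l))) (emb (lmult (t_el (refl_mat CARD('r) n i j l)) w)))"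
    using ij w G by (simp add: emb_lmult_add emb_scal_mult emb_lmult_sum)
  finally show ?thesis
    using ij w by (simp add: opX_emb opY_emb refl_emb[OF ij(1,2) w] lmult_simps)
qed

lemma e_el_in_A: "e_el n i j \<in> A"
  unfolding e_el_def by (auto intro!: free_carrier_closed free_carrier_sum)

lemma opY_X_same:
  assumes i: "i \<in> {1..n}" and w: "w \<in> C"
  shows "opY i (opX i (emb w)) = opX i (opY i (emb w)) + fscale kappa (emb w)
        - (\<Sum>j<CARD('r). fscale (d (int j) - d (int j - 1)) (fscale (1 / of_nat CARD('r))
            (\<Sum>l<CARD('r). fscale (cconst (zeta CARD('r) powi (- int (l * j)))) (opZ i (int l) (emb w)))))
        - fscale c0 (\<Sum>j\<in>{1..n} - {i}. \<Sum>l<CARD('r).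
            opZ i (int l) (opS (Transposition.transpose i j) (opZ i (- int l) (emb w))))"
proof -
  have G: "refl_mat CARD('r) n i j l \<in> monomial_group CARD('r) n" if "j \<in> {1..n} - {i}" for j l
    using that i by (intro refl_in_G) auto
  let ?E = "\<Sum>j<CARD('r). scal (d (int j) - d (int j - 1)) * e_el n i j :: 'r free_alg"
  let ?P = "\<Sum>j\<in>{1..n} - {i}. \<Sum>l<CARD('r). t_el (refl_mat CARD('r) n i j l) :: 'r free_alg"
  have E: "?E \<in> A" by (intro free_carrier_sum free_carrier_closed e_el_in_A)
  have P: "?P \<in> A" by (intro free_carrier_sum free_carrier_gens G)
  have xy: "x_el i * y_el i \<in> A" "y_el i * x_el i \<in> A" using i by auto
  have "emb (lmult (y_el i * x_el i) w) = emb (lmult (x_el i * y_el i + scal kappa - ?E - scal c0 * ?P) w)"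
    using i w E P xy by (intro emb_relation cherednik_relations.y_x_same) auto
  also have "\<dots> = emb (lmult (x_el i * y_el i) w) + fscale kappa (emb w) - emb (lmult ?E w) - fscale c0 (emb (lmult ?P w))"
    using w E P xy by (simp add: emb_lmult_add emb_lmult_diff emb_scal_mult emb_scal)
  also have "emb (lmult ?E w) = (\<Sum>j<CARD('r). fscale (d (int j) - d (int j - 1)) (emb (lmult (e_el n i j) w)))"
    using w e_el_in_A by (simp add: emb_lmult_sum emb_scal_mult)
  also have "emb (lmult ?P w) = (\<Sum>j\<in>{1..n} - {i}. \<Sum>l<CARD('r). emb (lmult (t_el (refl_mat CARD('r) n i j l)) w))"
  proof -
    have "emb (lmult ?P w) = (\<Sum>j\<in>{1..n} - {i}. emb (lmult (\<Sum>l<CARD('r). t_el (refl_mat CARD('r) n i j l)) w))"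
      by (intro emb_lmult_sum free_carrier_sum free_carrier_gens G w)
    also have "\<dots> = (\<Sum>j\<in>{1..n} - {i}. \<Sum>l<CARD('r). emb (lmult (t_el (refl_mat CARD('r) n i j l)) w))"
      by (intro sum.cong refl emb_lmult_sum free_carrier_gens G w)
    finally show ?thesis .
  qed
  finally have *: "emb (lmult (y_el i * x_el i) w) = emb (lmult (x_el i * y_el i) w) + fscale kappa (emb w)
    - (\<Sum>j<CARD('r). fscale (d (int j) - d (int j - 1)) (emb (lmult (e_el n i j) w)))
    - fscale c0 (\<Sum>j\<in>{1..n} - {i}. \<Sum>l<CARD('r). emb (lmult (t_el (refl_mat CARD('r) n i j l)) w))" .
  have e: "emb (lmult (e_el n i j) w) = fscale (1 / of_nat CARD('r))
      (\<Sum>l<CARD('r). fscale (cconst (zeta CARD('r) powi (- int (l * j)))) (opZ i (int l) (emb w)))" for j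
    unfolding e_el_def using w by (simp add: emb_scal_mult emb_lmult_sum opZ_emb)
  have refl: "(\<Sum>j\<in>{1..n} - {i}. \<Sum>l<CARD('r). emb (lmult (t_el (refl_mat CARD('r) n i j l)) w)) =
      (\<Sum>j\<in>{1..n} - {i}. \<Sum>l<CARD('r). opZ i (int l) (opS (Transposition.transpose i j) (opZ i (- int l) (emb w))))"
    by (intro sum.cong refl) (use i w in \<open>simp add: refl_emb\<close>)
  have "opY i (opX i (emb w)) = emb (lmult (y_el i * x_el i) w)" "opX i (opY i (emb w)) = emb (lmult (x_el i * y_el i) w)"
    using i w by (simp_all add: opX_emb opY_emb lmult_simps)
  then show ?thesis using * unfolding e refl by (simp only:)
qed

lemma single_in_C [simp]: "T \<in> SYT n lam \<Longrightarrow> Poly_Mapping.single T 1 \<in> C"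
  by simp

lemma one_tensor_vec: "T \<in> SYT n lam \<Longrightarrow> emb (one_tensor (Poly_Mapping.single T c)) = fscale (cconst c) (vec T)"
  by (simp add: one_tensor_single emb_scal vec_def)

lemma one_tensor_single_in_C [simp]: "T \<in> SYT n lam \<Longrightarrow> one_tensor (Poly_Mapping.single T c) \<in> C"
  by (simp add: one_tensor_single)

lemma emb_eq_relation: "u \<in> C \<Longrightarrow> w \<in> C \<Longrightarrow> u - w \<in> standard_relations n lam \<Longrightarrow> emb u = emb w"
  using emb_cong[OF cls_eq] by blast

lemma form_vec: "T \<in> SYT n lam \<Longrightarrow> form (vec T) (vec T) = 1"
proof -
  assume T: "T \<in> SYT n lam"
  let ?v = "Poly_Mapping.single T (1 :: complex)"
  have v: "?v \<in> Specht n lam" using T by (simp add: Specht_def)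
  have o: "one_tensor ?v = (Poly_Mapping.single T 1 :: 'r free_module)"
    by (simp add: one_tensor_single scal_simps lmult_simps)
  have "form (vec T) (vec T) = B (cls n lam (one_tensor ?v)) (cls n lam (one_tensor ?v))"
    using T unfolding vec_def by (simp add: form_emb b_def o)
  also have "\<dots> = cconst (B0 ?v ?v)"
    using B v unfolding is_contravariant_form_def by blast
  also have "B0 ?v ?v = 1"
    using B0 T unfolding is_specht_form_def by blast
  finally show ?thesis by simp
qed

lemma opY_vec: "i \<in> {1..n} \<Longrightarrow> T \<in> SYT n lam \<Longrightarrow> opY i (vec T) = 0"
  unfolding vec_def by (simp add: opY_emb lmult_single emb_relation_zero standard_relations.y)

lemma opZ_vec:
  assumes i: "i \<in> {1..n}" and T: "T \<in> SYT n lam"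
  shows "opZ i 1 (vec T) = fscale (cconst (zeta CARD('r) ^ beta (T i))) (vec T)"
proof -
  have "opZ i 1 (vec T) = emb (Poly_Mapping.single T (t_el (zeta_mat CARD('r) n i 1)))"
    using T unfolding vec_def by (simp add: opZ_emb lmult_single)
  also have "\<dots> = emb (one_tensor (zeta_vec CARD('r) i T))"
    using T standard_relations.zeta[OF i T] by (intro emb_eq_relation) (auto simp: zeta_vec_def)
  finally show ?thesis using T by (simp add: zeta_vec_def one_tensor_vec)
qed

lemma opS_vec:
  assumes i: "i \<in> {1..<n}" and T: "T \<in> SYT n lam" and C: "one_tensor (s_vec n lam i T) \<in> C"
  shows "opS (s_perm i) (vec T) = emb (one_tensor (s_vec n lam i T))"
proof -
  have s: "s_perm i permutes {1..n}" by (rule s_perm_permutes[OF i])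
  have "opS (s_perm i) (vec T) = emb (Poly_Mapping.single T (t_el (perm_mat n (s_perm i))))"
    using T s unfolding vec_def by (simp add: opS_emb lmult_single)
  also have "\<dots> = emb (one_tensor (s_vec n lam i T))"
    using T standard_relations.s[OF i T] s C by (intro emb_eq_relation) (auto simp flip: s_perm_def)
  finally show ?thesis .
qed

lemma opS_vec_diff:
  assumes i: "i \<in> {1..<n}" and T: "T \<in> SYT n lam" and ne: "beta (T i) \<noteq> beta (T (i + 1))"
  shows "opS (s_perm i) (vec T) = vec (swap_entries i T)"
proof -
  have T': "swap_entries i T \<in> SYT n lam" by (rule swap_entries_SYT[OF T i ne])
  have s: "s_vec n lam i T = Poly_Mapping.single (swap_entries i T) 1"
    using ne by (simp add: s_vec_def)
  show ?thesis
    using opS_vec[OF i T] T' by (simp add: s one_tensor_vec fscale_def)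
qed

lemma opS_vec_same:
  assumes i: "i \<in> {1..<n}" and T: "T \<in> SYT n lam" and eq: "beta (T i) = beta (T (i + 1))"
  shows "opS (s_perm i) (vec T) = fscale (1 / of_int (ct (T (i + 1)) - ct (T i))) (vec T) +
        (if swap_entries i T \<in> SYT n lam
         then fscale (cconst (of_real (sqrt (1 - 1 / (of_int (ct (T (i + 1)) - ct (T i)))\<^sup>2)))) (vec (swap_entries i T))
         else 0)"
proof -
  define a where "a = ct (T (i + 1)) - ct (T i)"
  have c: "cconst (1 / of_int a) = (1 / of_int a :: 'r ratfun)"
    by (simp add: cconst_divide cconst_of_int)
  show ?thesis
  proof (cases "swap_entries i T \<in> SYT n lam")
    case True
    have s: "s_vec n lam i T = Poly_Mapping.single T (1 / of_int a) +
        Poly_Mapping.single (swap_entries i T) (of_real (sqrt (1 - 1 / (of_int a)\<^sup>2)))"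
      using eq True by (simp add: s_vec_def Let_def a_def)
    have "opS (s_perm i) (vec T) = emb (one_tensor (s_vec n lam i T))"
      by (rule opS_vec[OF i T]) (simp only: s one_tensor_add module_carrier_closed(2) one_tensor_single_in_C T True)
    also have "\<dots> = fscale (1 / of_int a) (vec T) +
        fscale (cconst (of_real (sqrt (1 - 1 / (of_int a)\<^sup>2)))) (vec (swap_entries i T))"
      unfolding s one_tensor_add
      by (simp only: emb_add one_tensor_single_in_C T True one_tensor_vec c)
    finally show ?thesis unfolding a_def[symmetric] by (simp only: if_P[OF True])
  next
    case False
    have s: "s_vec n lam i T = Poly_Mapping.single T (1 / of_int a)"
      using eq False by (simp add: s_vec_def Let_def a_def)
    have "opS (s_perm i) (vec T) = emb (one_tensor (s_vec n lam i T))"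
      by (rule opS_vec[OF i T]) (simp only: s one_tensor_single_in_C T)
    also have "\<dots> = fscale (1 / of_int a) (vec T)"
      unfolding s by (simp only: T one_tensor_vec c)
    finally show ?thesis unfolding a_def[symmetric] by (simp only: if_not_P[OF False] add_0_right)
  qed
qed

lemma C_lmult_gens [simp]:
  "i \<in> {1..n} \<Longrightarrow> u \<in> C \<Longrightarrow> lmult (x_el i) u \<in> C"
  "i \<in> {1..n} \<Longrightarrow> u \<in> C \<Longrightarrow> lmult (y_el i) u \<in> C"
  "p \<in> monomial_group CARD('r) n \<Longrightarrow> u \<in> C \<Longrightarrow> lmult (t_el p) u \<in> C"
  by (intro module_carrier_closed(3) free_carrier_gens; assumption)+

sublocale cm: cherednik_module n lam V fscale opX opY opS opZ form vec
proof (rule cherednik_module.intro, goal_cases)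
  case 1 show ?case by (rule n_pos)
next
  case 2 show ?case by (rule lam)
next
  case 3 show ?case by (rule vector_space_fscale)
next
  case 4 show ?case using emb_in_V[OF module_carrier_closed(1)] by (simp only: emb_0)
next
  case (5 u w) then show ?case by (elim VE) (simp flip: emb_add)
next
  case (6 u c) then show ?case by (elim VE) (simp flip: emb_scal)
next
  case (7 i u) then show ?case by (elim VE) (simp add: opX_emb del: atLeastAtMost_iff)
next
  case (8 i u) then show ?case by (elim VE) (simp add: opY_emb del: atLeastAtMost_iff)
next
  case (9 p u) then show ?case by (elim VE) (simp add: opS_emb)
next
  case (10 i u l) then show ?case by (elim VE) (simp add: opZ_emb)
next
  case 11 show ?case unfolding opX_def by (rule pull_linear)
next
  case 12 show ?case unfolding opY_def by (rule pull_linear)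
next
  case 13 show ?case unfolding opS_def by (rule pull_linear)
next
  case 14 show ?case unfolding opZ_def by (rule pull_linear)
next
  case 15 then show ?case by (elim VE) (simp add: opS_S)
next
  case 16 then show ?case by (elim VE) (simp add: opS_id)
next
  case 17 then show ?case by (elim VE) (simp add: opZ_Z)
next
  case 18 then show ?case by (elim VE) (simp add: opZ_0)
next
  case 19 then show ?case by (elim VE) (simp add: opS_Z)
next
  case (20 i j u) then show ?case using opX_X by (elim VE) blast
next
  case 21 then show ?case by (elim VE) (simp add: opS_X)
next
  case 22 then show ?case by (elim VE) (simp add: opS_Y)
next
  case (23 i u l) then show ?case by (elim VE) (simp add: opZ_X)
next
  case (24 i j u l) then show ?case by (elim VE) (simp add: opZ_X fscale_def)
next
  case 25 then show ?case using opY_X_other by (elim VE) blast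
next
  case 26 then show ?case using opY_X_same by (elim VE) blast
next
  case (27 u w x) then show ?case by (elim VE) (simp add: form_emb b_add flip: emb_add)
next
  case (28 u w c) then show ?case by (elim VE) (simp add: form_emb b_scal flip: emb_scal)
next
  case (29 u w)
  then obtain u' w' where "u' \<in> C" "w' \<in> C" and [simp]: "u = emb u'" "w = emb w'" by (elim VE)
  then show ?case by (simp add: form_emb b_herm[of u' w'])
next
  case (30 i u w) then show ?case
    by (elim VE) (simp add: opX_emb opY_emb form_emb b_x del: atLeastAtMost_iff)
next
  case (31 p u w) then show ?case by (elim VE) (simp add: opS_emb form_emb b_t)
next
  case (32 i u w l) then show ?case by (elim VE) (simp add: opZ_emb form_emb b_t)
next
  case 33 then show ?case unfolding vec_def by (intro emb_in_V single_in_C)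
next
  case 34 then show ?case by (rule form_vec)
next
  case 35 then show ?case by (rule opY_vec)
next
  case 36 then show ?case by (rule opZ_vec)
next
  case 37 then show ?case by (rule opS_vec_diff)
next
  case 38 then show ?case by (rule opS_vec_same)
qed

lemma emb_x_pow:
  assumes "i \<in> {1..n}" "w \<in> C"
  shows "emb (lmult (x_el i ^ k) w) = (opX i ^^ k) (emb w)"
proof (induction k)
  case (Suc k)
  have "lmult (x_el i ^ k) w \<in> C" using assms by simp
  then have "emb (lmult (x_el i) (lmult (x_el i ^ k) w)) = opX i (emb (lmult (x_el i ^ k) w))"
    using opX_emb[OF assms(1)] by simp
  then show ?case by (simp add: Suc.IH lmult_simps)
qed (simp add: lmult_simps)

lemma emb_x_monomial:
  assumes w: "w \<in> C"
  shows "x_monomial n mu \<in> A" "emb (lmult (x_monomial n mu) w) = cm.XM mu (emb w)"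
proof -
  let ?P = "\<lambda>xs. (\<Prod>i\<leftarrow>xs. x_el i ^ mu i) :: 'r free_alg"
  have *: "?P xs \<in> A \<and> emb (lmult (?P xs) w) = cm.XL xs mu (emb w)" if "set xs \<subseteq> {1..n}" for xs
    using that
  proof (induction xs)
    case (Cons i xs)
    then have i: "i \<in> {1..n}" and IH: "?P xs \<in> A" "emb (lmult (?P xs) w) = cm.XL xs mu (emb w)" by simp_all
    have pow: "x_el i ^ mu i \<in> A" using i by (intro free_carrier_power free_carrier_gens)
    have "emb (lmult (x_el i ^ mu i) (lmult (?P xs) w)) = (opX i ^^ mu i) (emb (lmult (?P xs) w))"
      using i w IH(1) by (intro emb_x_pow) simp_all
    then show ?case using IH pow by (simp add: lmult_simps)
  qed (simp add: lmult_simps)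
  show "x_monomial n mu \<in> A" "emb (lmult (x_monomial n mu) w) = cm.XM mu (emb w)"
    using *[of "[1..<n + 1]"] unfolding x_monomial_def cm.XM_def cm.set_idx by simp_all
qed

lemma emb_xv:
  assumes T: "T \<in> SYT n lam"
  shows "xv n mu T \<in> C" "emb (xv n mu T) = cm.e mu T"
proof -
  let ?t = "t_el (perm_mat n (inv_into UNIV (w_comp n mu))) :: 'r free_alg"
  have t: "?t \<in> A" by (intro free_carrier_gens perm_in_G cm.inv_w_permutes)
  have xv: "xv n mu T = lmult (x_monomial n mu) (lmult ?t (Poly_Mapping.single T 1))"
    by (simp add: xv_def lmult_single)
  have c: "lmult ?t (Poly_Mapping.single T 1) \<in> C" using t T by simp
  show "xv n mu T \<in> C" unfolding xv using emb_x_monomial(1)[OF c] c by simp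
  show "emb (xv n mu T) = cm.e mu T"
    unfolding xv emb_x_monomial(2)[OF c] cm.e_def
    using T by (simp add: opS_emb cm.inv_w_permutes vec_def)
qed

lemma emb_z:
  assumes i: "i \<in> {1..n}" and w: "w \<in> C"
  shows "z_el n i \<in> A" "emb (lmult (z_el n i) w) = cm.z i (emb w)"
proof -
  have G: "refl_mat CARD('r) n i j l \<in> monomial_group CARD('r) n" if "j \<in> {1..<i}" for j l
    using that i by (intro refl_in_G) auto
  have phi: "phi_el n i \<in> A"
    unfolding phi_el_def by (intro free_carrier_sum free_carrier_gens G)
  have yx: "y_el i * x_el i \<in> A" using i by (intro free_carrier_closed(3) free_carrier_gens)
  show "z_el n i \<in> A" unfolding z_el_def
    by (intro free_carrier_closed(2) yx free_carrier_closed(3)[OF free_carrier_closed(4) phi])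
  have "emb (lmult (phi_el n i) w) = (\<Sum>j = 1..<i. emb (lmult (\<Sum>l<CARD('r). t_el (refl_mat CARD('r) n i j l)) w))"
    unfolding phi_el_def by (intro emb_lmult_sum free_carrier_sum free_carrier_gens G w)
  also have "\<dots> = (\<Sum>j = 1..<i. \<Sum>l<CARD('r). emb (lmult (t_el (refl_mat CARD('r) n i j l)) w))"
    by (intro sum.cong refl emb_lmult_sum free_carrier_gens G w)
  also have "\<dots> = cm.jm i (emb w)"
    unfolding cm.jm_def cm.RR_def cm.R_def
    by (intro sum.cong refl refl_emb[symmetric] w) (use i in auto)
  finally have phi_emb: "emb (lmult (phi_el n i) w) = cm.jm i (emb w)" .
  have "emb (lmult (y_el i * x_el i) w) = opY i (opX i (emb w))"
    using i w by (simp add: opX_emb opY_emb lmult_simps)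
  then show "emb (lmult (z_el n i) w) = cm.z i (emb w)"
    unfolding z_el_def cm.z_def using phi yx w phi_emb by (simp add: emb_lmult_add emb_scal_mult)
qed

theorem norm_of_f:
  assumes mu: "mu \<in> compositions n" and T: "T \<in> SYT n lam" and f: "is_f n lam mu T f"
  shows "B f f = cm.norm_val T mu"
proof -
  obtain I c where I: "finite I" "I \<subseteq> {nu \<in> compositions n. comp_less n nu mu} \<times> SYT n lam"
    and f_cls: "f = cls n lam (xv n mu T + (\<Sum>(nu, S)\<in>I. lmult (scal (c nu S)) (xv n nu S)))"
    and eig: "t_eigenvector n lam f"
    using f unfolding is_f_def by blast
  define F where "F = (\<lambda>(nu, S). lmult (scal (c nu S)) (xv n nu S))"
  define w where "w = xv n mu T + sum F I"
  have f_eq: "f = cls n lam w" unfolding f_cls w_def F_def ..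
  have terms: "F x \<in> C" "emb (F x) \<in> cm.espan (cm.lower mu)" if "x \<in> I" for x
  proof -
    obtain nu S where x: "x = (nu, S)" by (cases x)
    then have nu: "nu \<in> compositions n" "comp_less n nu mu" and S: "S \<in> SYT n lam" using I(2) that by auto
    show "F x \<in> C"
      using emb_xv[OF S] by (simp add: x F_def)
    have "nu \<in> cm.lower mu" using nu comp_less_height_less by (simp add: cm.lower_def)
    then show "emb (F x) \<in> cm.espan (cm.lower mu)"
      using emb_xv[OF S] S by (simp add: x F_def emb_scal cm.e_in_espan cm.espan_closed(2))
  qed
  have sum_C: "sum F I \<in> C"
    by (rule module_carrier_sum) (rule terms(1))
  have w: "w \<in> C" unfolding w_def using emb_xv(1)[OF T] sum_C by (rule module_carrier_closed(2))
  have "emb w - cm.e mu T = (\<Sum>x\<in>I. emb (F x))"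
    unfolding w_def emb_add[OF emb_xv(1)[OF T] sum_C] emb_xv(2)[OF T] using emb_sum[of I F] terms(1) by simp
  also have "\<dots> \<in> cm.espan (cm.lower mu)"
    unfolding cm.espan_def by (rule cm.vs.span_sum) (rule terms(2)[unfolded cm.espan_def])
  finally have tri: "emb w - cm.e mu T \<in> cm.espan (cm.lower mu)" .
  have eigen: "\<exists>c. cm.z i (emb w) = fscale c (emb w)" if i: "i \<in> {1..n}" for i
  proof -
    obtain c where "M_act n lam (z_el n i) f = M_act n lam (scal c) f"
      using eig t_subalgebra.intros(2)[OF i] unfolding t_eigenvector_def by blast
    then have "cls n lam (lmult (z_el n i) w) = cls n lam (lmult (scal c) w)"
      unfolding f_eq using emb_z(1)[OF i w] w by (simp add: M_act_cls)
    then have "emb (lmult (z_el n i) w) = emb (lmult (scal c) w)" by (rule emb_cong)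
    then show ?thesis using emb_z(2)[OF i w] w by (auto simp: emb_scal)
  qed
  have "form (emb w) (emb w) = cm.norm_val T mu"
    by (rule cm.norm_of_eigenvector[OF T mu tri eigen])
  then show ?thesis
    using form_emb[OF w w] by (simp add: f_eq b_def)
qed

end

theorem theorem6p1:
  fixes n :: nat and lam :: "nat list list"
    and mu :: "nat \<Rightarrow> nat" and T :: tableau
    and B0 :: "specht \<Rightarrow> specht \<Rightarrow> complex"
    and B :: "'r::finite free_module set \<Rightarrow> 'r free_module set \<Rightarrow> 'r ratfun"
    and f :: "'r free_module set"
    and a b :: "nat \<Rightarrow> int"
  assumes "n \<ge> 1"
    and "is_multipartition CARD('r) n lam"
    and "is_specht_form CARD('r) n lam B0"
    and "is_contravariant_form n lam B0 B"
    and "mu \<in> compositions n"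
    and "T \<in> SYT n lam"
    and "is_f n lam mu T f"
  defines "a \<equiv> \<lambda>i. ct (T (w_comp n mu i))"
    and "b \<equiv> \<lambda>i. int (beta (T (w_comp n mu i)))"
  shows "B f f =
      (\<Prod>i = 1..n. \<Prod>k = 1..mu i.
         kappa * of_nat k - (d (b i) - d (b i - int k)) - c0 * of_nat CARD('r) * of_int (a i))
    * (\<Prod>(i, j) | 1 \<le> i \<and> i < j \<and> j \<le> n \<and> mu i > mu j.
         \<Prod>k | 1 \<le> k \<and> k \<le> mu i - mu j \<and> [int k = b i - b j] (mod int CARD('r)).
           ((kappa * of_nat k - (d (b i) - d (b j)) - c0 * of_nat CARD('r) * of_int (a i - a j))\<^sup>2
              - (c0 * of_nat CARD('r))\<^sup>2)
           / (kappa * of_nat k - (d (b i) - d (b j)) - c0 * of_nat CARD('r) * of_int (a i - a j))\<^sup>2)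
    * (\<Prod>(i, j) | 1 \<le> i \<and> i < j \<and> j \<le> n \<and> int (mu i) < int (mu j) - 1.
         \<Prod>k | 1 \<le> k \<and> k \<le> mu j - mu i - 1 \<and> [int k = b j - b i] (mod int CARD('r)).
           ((kappa * of_nat k - (d (b j) - d (b i)) - c0 * of_nat CARD('r) * of_int (a j - a i))\<^sup>2
              - (c0 * of_nat CARD('r))\<^sup>2)
           / (kappa * of_nat k - (d (b j) - d (b i)) - c0 * of_nat CARD('r) * of_int (a j - a i))\<^sup>2)"
proof -
  interpret sf: standard_form n lam B0 B
    using assms(1-4) by unfold_locales
  show ?thesis
    using sf.norm_of_f[OF assms(5-7)]
    unfolding sf.cm.norm_val_def sf.cm.ca_def sf.cm.cb_def norm_formula_def ev_fac_def pair_prod_def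
      pair_fac_def lin_fac_def a_def b_def .
qed

end
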